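(* Let $(\Delta_n)_{n\ge 0}$ be a sequence of non-negative real numbers with $\Delta_n\to+\infty$ as $n\to\infty$, and for each $n$ let $S_{\Delta_n}(n)$ be the position at time $n$ of the Markov chain on $\mathbb{Z}^2$ started at $(0,0)$ with transition kernel $K_{\Delta_n}$. The following holds, where $\stackrel{d}{\longrightarrow}$ denotes convergence in distribution as $n\to\infty$. 1. If $\Delta_n=o(n^{1/2})$, then $n^{-1/2}S_{\Delta_n}(n)\stackrel{d}{\longrightarrow}\mathcal{N}(0,1)\otimes\mathcal{N}(0,1)$. 2. If $\Delta_n\sim\alpha n^{1/2}$ for some real $\alpha>0$, then $n^{-1/2}S_{\Delta_n}(n)\stackrel{d}{\longrightarrow}\mathcal{S}_{\alpha,2}(1)$, where $\mathcal{S}_{\alpha,2}(1)$ is the probability distribution on $\mathbb{R}^2$ whose Fourier transform $\phi_{\alpha,2}(1)(s,t)=\int_{\mathbb{R}^2}e^{isx_1+itx_2}\,d\mathcal{S}_{\alpha,2}(1)(x_1,x_2)$ is given, for all $s,t\in\mathbb{R}$, by $$\phi_{\alpha,2}(1)(s,t)=\exp\left(-\frac{s^2+t^2}{2}\right)\left[1-ts\int_0^1\exp\left(\frac{s^2+t^2}{2}x\right)\ell_{\alpha,s+t}(x)\,dx\right]$$ (in particular, such a probability distribution exists). 3. If $\Delta_n\gg n^{1/2}$ (i.e. $\Delta_n/n^{1/2}\to+\infty$), then $n^{-1/2}S_{\Delta_n}(n)\stackrel{d}{\longrightarrow}(Z,Z)$, where $Z$ is a random variable with the $\mathcal{N}(0,1)$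 distribution.
   Context: For a real parameter $\Delta\ge 0$ set $u=\frac{2+2\Delta}{2+\Delta}$. The chain $(S_\Delta(n))_{n\ge0}=(S^{(1)}_\Delta(n),S^{(2)}_\Delta(n))_{n\ge 0}$ is the Markov chain on $\mathbb{Z}^2$ with $S_\Delta(0)=(0,0)$ and transition kernel $K_\Delta$ given by: - if $x\ne y$: from $(x,y)$ the chain jumps to each of the four points $(x\pm1,y\pm1)$ (independent choices of signs) with probability $1/4$; - from $(x,x)$: it jumps to $(x+1,x+1)$ and to $(x-1,x-1)$ with probability $u/4$ each, and to $(x+1,x-1)$ and to $(x-1,x+1)$ with probability $(2-u)/4$ each. Definition of $\ell_{\alpha,w}$: Let $\mathrm{erfc}(x)=1-\frac{2}{\sqrt\pi}\int_0^x e^{-y^2}dy$, extended to an entire function on $\mathbb{C}$. Let $w\in\mathbb{R}$, $\alpha>0$. If $\alpha^{-2}-w^2/4\neq0$, set $\gamma=\sqrt{\alpha^{-2}-w^2/4}$ (when $\alpha^{-2}-w^2/4<0$, $\gamma$ is the square root with positive imaginary part), $b_1=-2\alpha^{-1}+2\gamma$, $b_2=-2\alpha^{-1}-2\gamma$, and for $x\ge0$ $$\ell_{\alpha,w}(x)=\frac{1}{2\gamma}\exp\left(-\frac{w^2}{4}x\right)\left[\frac{b_1}{2}\exp\left(\frac{b_1^2}{4}x\right)\mathrm{erfc}\left(-\frac{b_1}{2}\sqrt{x}\right)-\frac{b_2}{2}\exp\left(\frac{b_2^2}{4}x\right)\mathrm{erfc}\left(-\frac{b_2}{2}\sqrt{x}\right)\right].$$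 If $\alpha^{-2}-w^2/4=0$, set for $x\ge 0$ $$\ell_{\alpha,w}(x)=\frac12\exp\left(-\frac{w^2}{4}x\right)\left[-4\frac{\sqrt{x}}{\alpha\sqrt{\pi}}+\left(\frac{4x}{\alpha^2}+2\right)\exp\left(\frac{x}{\alpha^2}\right)\mathrm{erfc}\left(\frac{\sqrt{x}}{\alpha}\right)\right].$$ *)

theory Defs
  imports
    "HOL-Probability.Probability"
    "HOL-Complex_Analysis.Complex_Analysis"
    "HOL-Library.Landau_Symbols"
begin

definition kernel_K :: "real \<Rightarrow> int \<times> int \<Rightarrow> int \<times> int \<Rightarrow> real" where
  "kernel_K \<Delta> p q =
     (let u = (2 + 2 * \<Delta>) / (2 + \<Delta>) in
      if \<bar>fst q - fst p\<bar> = 1 \<and> \<bar>snd q - snd p\<bar> = 1 then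
        (if fst p \<noteq> snd p then 1 / 4
         else if fst q = snd q then u / 4
         else (2 - u) / 4)
      else 0)"

text \<open>Time-homogeneous Markov chains on a countable state space. The conditional probability is
  constrained only when the conditioning event is not null.\<close>

definition markov_chain ::
  "'a measure \<Rightarrow> ('b :: countable \<Rightarrow> 'b \<Rightarrow> real) \<Rightarrow> 'b \<Rightarrow> (nat \<Rightarrow> 'a \<Rightarrow> 'b) \<Rightarrow> bool" where
  "markov_chain M K x0 X \<longleftrightarrow>
     prob_space M \<and>
     (\<forall>n. X n \<in> measurable M (count_space UNIV)) \<and>
     (AE \<omega> in M. X 0 \<omega> = x0) \<and>
     (\<forall>n x y. \<P>(\<omega> in M. \<forall>i\<le>n. X i \<omega> = x i) > 0 \<longrightarrow>
        \<P>(\<omega> in M. X (Suc n) \<omega> = y \<bar> \<forall>i\<le>n. X i \<omega> = x i) = K (x n) y)"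

text \<open>Weak convergence tested against bounded continuous functions; the constant
  \<^const>\<open>weak_conv_m\<close> only covers measures on the real line.\<close>

definition weakly_converges ::
  "(nat \<Rightarrow> 'a :: topological_space measure) \<Rightarrow> 'a measure \<Rightarrow> bool" where
  "weakly_converges \<mu> \<nu> \<longleftrightarrow>
     (\<forall>f :: 'a \<Rightarrow> real. continuous_on UNIV f \<and> bounded (range f) \<longrightarrow>
        (\<lambda>n. \<integral>x. f x \<partial>\<mu> n) \<longlonglongrightarrow> (\<integral>x. f x \<partial>\<nu>))"

definition rescaled_law :: "'a measure \<Rightarrow> nat \<Rightarrow> ('a \<Rightarrow> int \<times> int) \<Rightarrow> (real \<times> real) measure" where
  "rescaled_law M n Y =
     distr M borel (\<lambda>\<omega>. (real_of_int (fst (Y \<omega>)) / sqrt (real n),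
                           real_of_int (snd (Y \<omega>)) / sqrt (real n)))"

definition fourier2 :: "(real \<times> real) measure \<Rightarrow> real \<Rightarrow> real \<Rightarrow> complex" where
  "fourier2 \<mu> s t = (CLINT x|\<mu>. iexp (s * fst x + t * snd x))"

text \<open>The complementary error function as an entire function: the defining integral is taken
  along the segment from \<open>0\<close> to \<open>z\<close>. The holomorphicity and real-line lemmas below say that this is the entire
  extension of the real function.\<close>

definition erfc :: "complex \<Rightarrow> complex" where
  "erfc z = 1 - 2 / of_real (sqrt pi) * contour_integral (linepath 0 z) (\<lambda>y. exp (- (y\<^sup>2)))"

lemma erfc_primitive:
  "\<exists>F. (\<forall>z. (F has_field_derivative exp (- (z\<^sup>2))) (at z)) \<and>
       (\<forall>z. erfc z = 1 - 2 / of_real (sqrt pi) * (F z - F 0))"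
proof -
  have "(\<lambda>y::complex. exp (- (y\<^sup>2))) holomorphic_on UNIV"
    by (intro holomorphic_intros)
  then obtain F where F: "\<And>z::complex. z \<in> UNIV \<Longrightarrow> (F has_field_derivative exp (- (z\<^sup>2))) (at z within UNIV)"
    by (rule holomorphic_convex_primitive'[OF convex_UNIV open_UNIV]) metis
  have "contour_integral (linepath 0 z) (\<lambda>y. exp (- (y\<^sup>2))) = F z - F 0" for z
    using contour_integral_primitive[OF F, of "linepath 0 z"]
    by (intro contour_integral_unique) auto
  with F show ?thesis
    by (intro exI[of _ F]) (auto simp: erfc_def)
qed

lemma erfc_holomorphic: "erfc holomorphic_on UNIV"
proof -
  obtain F where F: "\<And>z. (F has_field_derivative exp (- (z\<^sup>2))) (at z)"
    and eq: "\<And>z. erfc z = 1 - 2 / of_real (sqrt pi) * (F z - F 0)"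
    using erfc_primitive by blast
  have "F holomorphic_on UNIV"
    using F by (auto simp: holomorphic_on_open)
  then have "(\<lambda>z. 1 - 2 / of_real (sqrt pi) * (F z - F 0)) holomorphic_on UNIV"
    by (intro holomorphic_intros) auto
  moreover have "erfc = (\<lambda>z. 1 - 2 / of_real (sqrt pi) * (F z - F 0))"
    using eq by blast
  ultimately show ?thesis by simp
qed

lemma erfc_of_real:
  "erfc (of_real x) = of_real (1 - 2 / sqrt pi * (LBINT y=0..x. exp (- (y\<^sup>2))))"
proof -
  obtain F where F: "\<And>z. (F has_field_derivative exp (- (z\<^sup>2))) (at z)"
    and eq: "\<And>z. erfc z = 1 - 2 / of_real (sqrt pi) * (F z - F 0)"
    using erfc_primitive by blast
  have "((\<lambda>y. F (of_real y)) has_vector_derivative of_real (exp (- (y\<^sup>2)))) (at y within A)"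
    for y A
    using has_vector_derivative_real_field[OF F[of "of_real y"], of A]
    by (simp add: exp_of_real[symmetric])
  then have "(CLBINT y=ereal 0..ereal x. of_real (exp (- (y\<^sup>2)))) = F (of_real x) - F (of_real 0)"
    by (intro interval_integral_FTC_finite) (auto intro!: continuous_intros)
  then show ?thesis
    by (simp add: eq interval_lebesgue_integral_of_real zero_ereal_def)
qed

text \<open>On negative reals \<^const>\<open>csqrt\<close> has positive imaginary part, as required of \<open>\<gamma>\<close>.\<close>

definition ell :: "real \<Rightarrow> real \<Rightarrow> real \<Rightarrow> complex" where
  "ell \<alpha> w x =
     (if 1 / \<alpha>\<^sup>2 - w\<^sup>2 / 4 \<noteq> 0 then
        (let \<gamma> = csqrt (of_real (1 / \<alpha>\<^sup>2 - w\<^sup>2 / 4));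
             b1 = - 2 / of_real \<alpha> + 2 * \<gamma>;
             b2 = - 2 / of_real \<alpha> - 2 * \<gamma>
         in 1 / (2 * \<gamma>) * of_real (exp (- (w\<^sup>2 / 4) * x)) *
            (b1 / 2 * exp (b1\<^sup>2 / 4 * of_real x) * erfc (- (b1 / 2) * of_real (sqrt x)) -
             b2 / 2 * exp (b2\<^sup>2 / 4 * of_real x) * erfc (- (b2 / 2) * of_real (sqrt x))))
      else
        1 / 2 * of_real (exp (- (w\<^sup>2 / 4) * x)) *
        (- 4 * of_real (sqrt x / (\<alpha> * sqrt pi)) +
         of_real ((4 * x / \<alpha>\<^sup>2 + 2) * exp (x / \<alpha>\<^sup>2)) * erfc (of_real (sqrt x / \<alpha>))))"

definition phi2 :: "real \<Rightarrow> real \<Rightarrow> real \<Rightarrow> complex" where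
  "phi2 \<alpha> s t =
     of_real (exp (- ((s\<^sup>2 + t\<^sup>2) / 2))) *
     (1 - of_real (t * s) *
        (CLBINT x:{0..1}. of_real (exp ((s\<^sup>2 + t\<^sup>2) / 2 * x)) * ell \<alpha> (s + t) x))"

definition is_S2_law :: "real \<Rightarrow> (real \<times> real) measure \<Rightarrow> bool" where
  "is_S2_law \<alpha> \<mu> \<longleftrightarrow>
     prob_space \<mu> \<and> sets \<mu> = sets borel \<and> (\<forall>s t. fourier2 \<mu> s t = phi2 \<alpha> s t)"

end

theory Submission
  imports Defs "HOL-Real_Asymp.Real_Asymp"
begin

text \<open>Why the theorem holds. Each coordinate of the walk is a simple random walk, so the rescaled laws
  are tight in every regime and everything is decided by the limit of the Fourier transforms. For
  fixed frequencies \<open>s\<close>, \<open>t\<close> one step multiplies the Fourier transform by \<open>cos s * cos t\<close>, up to a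
  correction proportional to \<open>sin s * sin t\<close> that is felt only on the diagonal. Solving this linear
  recursion (\<open>walk_char_expand\<close>) leaves one unknown, the transform \<open>diag_char \<Delta> w k\<close> of the
  position at time \<open>k\<close> restricted to the event that the walk is on the diagonal, at the frequency
  \<open>w = s + t\<close>.

  The generating function of \<open>diag_char\<close> in the time variable is explicit
  (\<open>diag_char_generating_function\<close>). Instead of decomposing paths into excursions, one uses a test
  function that is an eigenfunction of the kernel off the diagonal: \<open>exp (\<i> w (x + y) / 2)\<close> times
  \<open>r ^ (\<bar>x - y\<bar> / 2)\<close>, where \<open>r < 1\<close> is a root of a quadratic equation. Its expectation along the
  walk telescopes. After the rescaling \<open>w / sqrt n\<close> and \<open>exp (- p / n)\<close> the generating function
  tends to \<open>1 / (p + w\<^sup>2 / 2 + \<beta> * sqrt (p + w\<^sup>2 / 4))\<close>, where \<open>\<beta>\<close> is the limit of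
  \<open>2 sqrt n / (2 + \<Delta>)\<close>. The three regimes are \<open>\<beta> = \<infinity>\<close>, \<open>\<beta> = 2 / \<alpha>\<close> and \<open>\<beta> = 0\<close>, and the limit
  is then the Laplace transform of \<open>0\<close>, of \<open>ell \<alpha> w\<close> (\<open>has_laplace_ell\<close>) and of
  \<open>exp (- w\<^sup>2 x / 2)\<close>. The values \<open>diag_char\<close> are bounded by 1, so a Tauberian argument of
  Karamata type (\<open>window_convergence\<close>) turns convergence of Laplace transforms into convergence of
  the sums over \<open>k < n\<close> that occur in the solved recursion. This gives the limit of the Fourier
  transforms in all three regimes at once (\<open>walk_char_limit\<close>).

  Two general facts conclude. Convergence of Fourier transforms together with tightness implies weak
  convergence in the plane (\<open>levy_continuity_plane\<close>); this is proved by approximating test functions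
  by trigonometric polynomials. A law with Fourier transform \<open>phi2 \<alpha>\<close> exists because it is a
  subsequential limit of the walks with \<open>\<Delta> = \<alpha> sqrt n\<close>
  (\<open>tight_pmf_subsequence_plane\<close>). There a space-filling curve transports the compactness theorem
  from the line to the plane.\<close>

section \<open>Laws of a Markov chain and of the walk\<close>

primrec chain_law :: "('b \<Rightarrow> 'b pmf) \<Rightarrow> 'b \<Rightarrow> nat \<Rightarrow> 'b pmf" where
  "chain_law \<kappa> x0 0 = return_pmf x0"
| "chain_law \<kappa> x0 (Suc n) = bind_pmf (chain_law \<kappa> x0 n) \<kappa>"

text \<open>The definition of a Markov chain conditions on whole histories. Summing over the countably many
  histories that end in \<open>x\<close> removes the past; histories of probability zero contribute nothing on
  either side.\<close>

lemma markov_chain_joint_step: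
  fixes \<kappa> :: "'b :: countable \<Rightarrow> 'b pmf"
  assumes mc: "markov_chain M (\<lambda>x y. pmf (\<kappa> x) y) x0 X"
  shows "emeasure M {\<omega> \<in> space M. X n \<omega> = x \<and> X (Suc n) \<omega> = y} =
         pmf (\<kappa> x) y * emeasure M {\<omega> \<in> space M. X n \<omega> = x}"
proof -
  interpret prob_space M using mc by (simp add: markov_chain_def)
  have meas[measurable]: "X n \<in> measurable M (count_space UNIV)" for n
    using mc by (simp add: markov_chain_def)
  have cond: "\<P>(\<omega> in M. X (Suc n) \<omega> = y \<bar> \<forall>i\<le>n. X i \<omega> = z i) = pmf (\<kappa> (z n)) y"
    if "\<P>(\<omega> in M. \<forall>i\<le>n. X i \<omega> = z i) > 0" for n z y
    using mc that unfolding markov_chain_def by blast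
  define path where "path l = {\<omega> \<in> space M. \<forall>i\<le>n. X i \<omega> = l ! i}" for l :: "'b list"
  define I where "I = {l :: 'b list. length l = Suc n \<and> l ! n = x}"
  define B where "B = {\<omega> \<in> space M. X (Suc n) \<omega> = y}"
  have path_sets[measurable]: "path l \<in> events" for l unfolding path_def by measurable
  have B_sets[measurable]: "B \<in> events" unfolding B_def by measurable
  have disj: "disjoint_family_on path I"
    unfolding disjoint_family_on_def I_def path_def
    by (auto simp: less_Suc_eq_le intro!: nth_equalityI)
  have disj': "disjoint_family_on (\<lambda>l. path l \<inter> B) I"
    using disj unfolding disjoint_family_on_def by blast
  have U: "(\<Union>l\<in>I. path l) = {\<omega> \<in> space M. X n \<omega> = x}"
  proof (intro set_eqI iffI)
    fix \<omega> assume "\<omega> \<in> {\<omega> \<in> space M. X n \<omega> = x}"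
    then have "map (\<lambda>i. X i \<omega>) [0..<Suc n] \<in> I \<and> \<omega> \<in> path (map (\<lambda>i. X i \<omega>) [0..<Suc n])"
      unfolding I_def path_def by (auto simp del: upt_Suc simp: nth_map_upt)
    then show "\<omega> \<in> (\<Union>l\<in>I. path l)" by blast
  qed (auto simp: I_def path_def)
  have U': "(\<Union>l\<in>I. path l \<inter> B) = {\<omega> \<in> space M. X n \<omega> = x \<and> X (Suc n) \<omega> = y}"
    using U unfolding B_def by auto
  have step: "emeasure M (path l \<inter> B) = pmf (\<kappa> x) y * emeasure M (path l)" if "l \<in> I" for l
  proof (cases "prob (path l) > 0")
    case True
    have "\<P>(\<omega> in M. X (Suc n) \<omega> = y \<bar> \<forall>i\<le>n. X i \<omega> = l ! i) = pmf (\<kappa> (l ! n)) y"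
      using True by (intro cond) (simp add: path_def)
    moreover have "{\<omega> \<in> space M. X (Suc n) \<omega> = y \<and> (\<forall>i\<le>n. X i \<omega> = l ! i)} = path l \<inter> B"
      unfolding path_def B_def by auto
    moreover have "l ! n = x" using \<open>l \<in> I\<close> by (simp add: I_def)
    ultimately have "prob (path l \<inter> B) / prob (path l) = pmf (\<kappa> x) y"
      unfolding cond_prob_def by (simp add: path_def)
    with True show ?thesis
      by (simp add: emeasure_eq_measure ennreal_mult[symmetric] field_simps)
  next
    case False
    then have "emeasure M (path l) = 0" by (simp add: zero_less_measure_iff emeasure_eq_measure)
    moreover have "emeasure M (path l \<inter> B) \<le> emeasure M (path l)"
      by (intro emeasure_mono) auto
    ultimately show ?thesis by simp
  qed
  have "emeasure M {\<omega> \<in> space M. X n \<omega> = x \<and> X (Suc n) \<omega> = y} =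
        (\<integral>\<^sup>+l. emeasure M (path l \<inter> B) \<partial>count_space I)"
    unfolding U'[symmetric] by (intro emeasure_UN_countable) (use disj' in auto)
  also have "\<dots> = (\<integral>\<^sup>+l. pmf (\<kappa> x) y * emeasure M (path l) \<partial>count_space I)"
    by (intro nn_integral_cong) (simp add: step)
  also have "\<dots> = pmf (\<kappa> x) y * (\<integral>\<^sup>+l. emeasure M (path l) \<partial>count_space I)"
    by (intro nn_integral_cmult) simp
  also have "(\<integral>\<^sup>+l. emeasure M (path l) \<partial>count_space I) = emeasure M {\<omega> \<in> space M. X n \<omega> = x}"
    unfolding U[symmetric] by (intro emeasure_UN_countable[symmetric]) (use disj in auto)
  finally show ?thesis .
qed

text \<open>From here on only the marginal laws of the chain matter, and these are iterated \<open>bind_pmf\<close>s of the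
  kernel. Any two chains with the same kernel and start are therefore interchangeable.\<close>

lemma markov_chain_law:
  fixes \<kappa> :: "'b :: countable \<Rightarrow> 'b pmf"
  assumes mc: "markov_chain M (\<lambda>x y. pmf (\<kappa> x) y) x0 X"
  shows "distr M (count_space UNIV) (X n) = measure_pmf (chain_law \<kappa> x0 n)"
proof -
  interpret prob_space M using mc by (simp add: markov_chain_def)
  have meas[measurable]: "X n \<in> measurable M (count_space UNIV)" for n
    using mc by (simp add: markov_chain_def)
  have ev: "emeasure (distr M (count_space UNIV) (X n)) {x} = emeasure M {\<omega> \<in> space M. X n \<omega> = x}" for n x
    by (subst emeasure_distr) (auto intro!: arg_cong[where f="emeasure M"])
  show ?thesis
  proof (induction n)
    case 0
    have ae: "AE \<omega> in M. X 0 \<omega> = x0" using mc by (simp add: markov_chain_def)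
    have "distr M (count_space UNIV) (X 0) = distr M (count_space UNIV) (\<lambda>_. x0)"
      using ae by (intro distr_cong_AE) auto
    also have "\<dots> = return (count_space UNIV) x0"
      by (intro measure_eqI) (auto simp: emeasure_distr emeasure_space_1 indicator_def)
    finally show ?case by (simp add: return_pmf.rep_eq)
  next
    case (Suc n)
    show ?case
    proof (rule measure_eqI_countable[where A=UNIV])
      fix y
      have "{\<omega> \<in> space M. X (Suc n) \<omega> = y} =
          (\<Union>x. {\<omega> \<in> space M. X n \<omega> = x \<and> X (Suc n) \<omega> = y})" by auto
      then have "emeasure M {\<omega> \<in> space M. X (Suc n) \<omega> = y} =
          (\<integral>\<^sup>+x. emeasure M {\<omega> \<in> space M. X n \<omega> = x \<and> X (Suc n) \<omega> = y} \<partial>count_space UNIV)"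
        by (simp only:) (intro emeasure_UN_countable, auto simp: disjoint_family_on_def)
      also have "\<dots> = (\<integral>\<^sup>+x. ennreal (pmf (chain_law \<kappa> x0 n) x) * pmf (\<kappa> x) y \<partial>count_space UNIV)"
        by (intro nn_integral_cong)
          (simp add: markov_chain_joint_step[OF mc] ev[symmetric] Suc.IH emeasure_pmf_single mult.commute)
      also have "\<dots> = (\<integral>\<^sup>+x. pmf (\<kappa> x) y \<partial>measure_pmf (chain_law \<kappa> x0 n))"
        by (simp add: nn_integral_measure_pmf)
      also have "\<dots> = emeasure (measure_pmf (chain_law \<kappa> x0 (Suc n))) {y}"
        by (simp add: emeasure_pmf_single ennreal_pmf_bind)
      finally show "emeasure (distr M (count_space UNIV) (X (Suc n))) {y} =
          emeasure (measure_pmf (chain_law \<kappa> x0 (Suc n))) {y}"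
        by (simp add: ev)
    qed auto
  qed
qed

lemma integral_bernoulli_bind:
  fixes f :: "'a \<Rightarrow> 'c :: {banach, second_countable_topology}"
  assumes "0 \<le> p" "p \<le> 1" "\<And>b. finite (set_pmf (g b))"
  shows "measure_pmf.expectation (bind_pmf (bernoulli_pmf p) g) f =
    p *\<^sub>R measure_pmf.expectation (g True) f + (1 - p) *\<^sub>R measure_pmf.expectation (g False) f"
proof -
  have "measure_pmf.expectation (bind_pmf (bernoulli_pmf p) g) f =
    (\<Sum>a\<in>{True,False}. pmf (bernoulli_pmf p) a *\<^sub>R measure_pmf.expectation (g a) f)"
    by (rule pmf_expectation_bind) (use assms in auto)
  then show ?thesis using assms by simp
qed

text \<open>The kernel is sampled by first deciding whether the two coordinates move in the same direction
  and then choosing the direction. The probability of agreement on the diagonal is \<open>u / 2\<close>.\<close>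

definition diag_step :: "real \<Rightarrow> int \<times> int \<Rightarrow> (int \<times> int) pmf" where
  "diag_step \<Delta> p =
     bind_pmf (bernoulli_pmf (if fst p = snd p then (1 + \<Delta>) / (2 + \<Delta>) else 1 / 2)) (\<lambda>agree.
     bind_pmf (bernoulli_pmf (1 / 2)) (\<lambda>up.
       return_pmf (fst p + (if up then 1 else - 1), snd p + (if up = agree then 1 else - 1))))"

lemma integral_diag_step:
  fixes f :: "int \<times> int \<Rightarrow> 'c :: {banach, second_countable_topology}"
  assumes "\<Delta> \<ge> 0"
  defines "\<theta> p \<equiv> (if fst p = snd p then (1 + \<Delta>) / (2 + \<Delta>) else 1 / 2 :: real)"
  shows "measure_pmf.expectation (diag_step \<Delta> p) f =
    (\<theta> p / 2) *\<^sub>R (f (fst p + 1, snd p + 1) + f (fst p - 1, snd p - 1)) +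
    ((1 - \<theta> p) / 2) *\<^sub>R (f (fst p + 1, snd p - 1) + f (fst p - 1, snd p + 1))"
proof -
  have th: "0 \<le> \<theta> p" "\<theta> p \<le> 1" using assms by (auto simp: \<theta>_def)
  show ?thesis
    unfolding diag_step_def \<theta>_def[symmetric] using th
    by (simp add: integral_bernoulli_bind scaleR_add_right)
qed

lemma pmf_diag_step:
  assumes "\<Delta> \<ge> 0"
  shows "pmf (diag_step \<Delta> p) q = kernel_K \<Delta> p q"
proof -
  have "pmf (diag_step \<Delta> p) q = measure_pmf.expectation (diag_step \<Delta> p) (indicator {q})"
    by (simp add: pmf.rep_eq)
  also have "\<dots> = kernel_K \<Delta> p q"
  proof -
    obtain a b c d where pq: "p = (a, b)" "q = (c, d)" by (metis prod.collapse)
    define \<theta> where "\<theta> = (1 + \<Delta>) / (2 + \<Delta>)"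
    have u: "(2 + 2 * \<Delta>) / (2 + \<Delta>) = 2 * \<theta>"
      using assms by (simp add: \<theta>_def field_simps)
    consider "c = a + 1" "d = b + 1" | "c = a + 1" "d = b - 1" | "c = a - 1" "d = b + 1"
      | "c = a - 1" "d = b - 1" | "\<bar>c - a\<bar> \<noteq> 1" | "\<bar>d - b\<bar> \<noteq> 1"
      by linarith
    then show ?thesis
      unfolding integral_diag_step[OF assms] kernel_K_def Let_def u pq \<theta>_def[symmetric]
      by cases (simp_all add: field_simps, auto simp: indicator_def)
  qed
  finally show ?thesis .
qed

abbreviation diag_walk :: "real \<Rightarrow> nat \<Rightarrow> (int \<times> int) pmf" where
  "diag_walk \<Delta> \<equiv> chain_law (diag_step \<Delta>) (0, 0)"

lemma finite_set_diag_step: "finite (set_pmf (diag_step \<Delta> p))"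
  unfolding diag_step_def
  by (simp add: Let_def)

lemma finite_set_diag_walk: "finite (set_pmf (diag_walk \<Delta> n))"
  by (induction n) (auto simp: finite_set_diag_step)

text \<open>The finite support of all laws involved makes every test function integrable, in particular the
  squares whose expectations are the second moments.\<close>

lemma expectation_diag_walk_Suc:
  fixes f :: "int \<times> int \<Rightarrow> 'c :: {banach, second_countable_topology}"
  shows "measure_pmf.expectation (diag_walk \<Delta> (Suc n)) f =
    measure_pmf.expectation (diag_walk \<Delta> n) (\<lambda>p. measure_pmf.expectation (diag_step \<Delta> p) f)"
proof -
  have "measure_pmf.expectation (diag_walk \<Delta> (Suc n)) f =
    (\<Sum>p\<in>set_pmf (diag_walk \<Delta> n). pmf (diag_walk \<Delta> n) p *\<^sub>R measure_pmf.expectation (diag_step \<Delta> p) f)"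
    unfolding chain_law.simps
    by (rule pmf_expectation_bind) (auto simp: finite_set_diag_walk finite_set_diag_step)
  also have "\<dots> = measure_pmf.expectation (diag_walk \<Delta> n) (\<lambda>p. measure_pmf.expectation (diag_step \<Delta> p) f)"
    by (rule integral_measure_pmf[symmetric]) (auto simp: finite_set_diag_walk)
  finally show ?thesis .
qed

section \<open>Fourier analysis of the walk\<close>

lemma integrable_diag_walk: "integrable (measure_pmf (diag_walk \<Delta> n)) f"
  for f :: "_ \<Rightarrow> 'c :: {banach, second_countable_topology}"
  by (rule integrable_measure_pmf_finite[OF finite_set_diag_walk])

text \<open>The interaction on the diagonal affects only the correlation of the two coordinates: each of them
  moves up or down with probability one half wherever the walk is.\<close>

lemma expectation_fst_sq_diag_walk:
  assumes "\<Delta> \<ge> 0"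
  shows "measure_pmf.expectation (diag_walk \<Delta> n) (\<lambda>p. (real_of_int (fst p))\<^sup>2) = real n"
    and "measure_pmf.expectation (diag_walk \<Delta> n) (\<lambda>p. (real_of_int (snd p))\<^sup>2) = real n"
proof -
  have sq: "(\<theta> / 2) * ((x + 1)\<^sup>2 + (x - 1)\<^sup>2) + ((1 - \<theta>) / 2) * ((x + 1)\<^sup>2 + (x - 1)\<^sup>2) = x\<^sup>2 + 1"
    "(\<theta> / 2) * ((x + 1)\<^sup>2 + (x - 1)\<^sup>2) + ((1 - \<theta>) / 2) * ((x - 1)\<^sup>2 + (x + 1)\<^sup>2) = x\<^sup>2 + 1"
    for \<theta> x :: real
    by (simp_all add: field_simps power2_eq_square)
  have step1: "measure_pmf.expectation (diag_step \<Delta> p) (\<lambda>p. (real_of_int (fst p))\<^sup>2) = (real_of_int (fst p))\<^sup>2 + 1" for p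
    unfolding integral_diag_step[OF assms]
    by (simp only: real_scaleR_def fst_conv snd_conv of_int_add of_int_diff of_int_1 sq)
  have step2: "measure_pmf.expectation (diag_step \<Delta> p) (\<lambda>p. (real_of_int (snd p))\<^sup>2) = (real_of_int (snd p))\<^sup>2 + 1" for p
    unfolding integral_diag_step[OF assms]
    by (simp only: real_scaleR_def fst_conv snd_conv of_int_add of_int_diff of_int_1 sq)
  show "measure_pmf.expectation (diag_walk \<Delta> n) (\<lambda>p. (real_of_int (fst p))\<^sup>2) = real n"
    by (induction n) (simp_all del: chain_law.simps(2)
      add: expectation_diag_walk_Suc step1 Bochner_Integration.integral_add[OF integrable_diag_walk integrable_diag_walk])
  show "measure_pmf.expectation (diag_walk \<Delta> n) (\<lambda>p. (real_of_int (snd p))\<^sup>2) = real n"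
    by (induction n) (simp_all del: chain_law.simps(2)
      add: expectation_diag_walk_Suc step2 Bochner_Integration.integral_add[OF integrable_diag_walk integrable_diag_walk])
qed

text \<open>Only the paths that are on the diagonal at time \<open>n\<close> count. There both coordinates agree, so a
  single frequency suffices.\<close>

definition diag_char :: "real \<Rightarrow> real \<Rightarrow> nat \<Rightarrow> complex" where
  "diag_char \<Delta> w n = measure_pmf.expectation (diag_walk \<Delta> n)
     (\<lambda>p. if fst p = snd p then iexp (w * real_of_int (fst p)) else 0)"

definition walk_char :: "real \<Rightarrow> real \<Rightarrow> real \<Rightarrow> nat \<Rightarrow> complex" where
  "walk_char \<Delta> s t n = measure_pmf.expectation (diag_walk \<Delta> n)
     (\<lambda>p. iexp (s * real_of_int (fst p) + t * real_of_int (snd p)))"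

lemma norm_diag_char_le: "norm (diag_char \<Delta> w n) \<le> 1"
proof -
  have "norm (diag_char \<Delta> w n) \<le> measure_pmf.expectation (diag_walk \<Delta> n) (\<lambda>p. 1::real)"
    unfolding diag_char_def
    by (intro order_trans[OF integral_norm_bound] integral_mono integrable_diag_walk) (simp del: of_real_mult)
  then show ?thesis by simp
qed

text \<open>Off the diagonal the coordinates are independent and the factor is \<open>cos s * cos t\<close>. On the diagonal
  the probability of agreement exceeds one half by \<open>\<Delta> / (2 * (2 + \<Delta>))\<close>, which produces the sine term; there
  the wave with frequencies \<open>s\<close>, \<open>t\<close> is the wave with frequency \<open>s + t\<close> of either coordinate.\<close>

lemma walk_char_Suc:
  assumes "\<Delta> \<ge> 0"
  shows "walk_char \<Delta> s t (Suc n) = of_real (cos s * cos t) * walk_char \<Delta> s t n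
     - of_real (\<Delta> / (2 + \<Delta>) * (sin s * sin t)) * diag_char \<Delta> (s + t) n"
proof -
  have shift: "iexp (s * real_of_int (x + e) + t * real_of_int (y + e')) =
     iexp (s * real_of_int x + t * real_of_int y) * (cis (s * real_of_int e) * cis (t * real_of_int e'))" for x y e e'
    by (simp add: cis_conv_exp exp_add[symmetric] algebra_simps)
  have step: "measure_pmf.expectation (diag_step \<Delta> p) (\<lambda>p. iexp (s * real_of_int (fst p) + t * real_of_int (snd p)))
     = of_real (cos s * cos t) * iexp (s * real_of_int (fst p) + t * real_of_int (snd p))
     - of_real (\<Delta> / (2 + \<Delta>) * (sin s * sin t)) * (if fst p = snd p then iexp ((s + t) * real_of_int (fst p)) else 0)" for p
  proof -
    obtain x y where p: "p = (x, y)" by fastforce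
    define E where "E = iexp (s * real_of_int x + t * real_of_int y)"
    define \<theta> where "\<theta> = (if x = y then (1 + \<Delta>) / (2 + \<Delta>) else 1 / 2 :: real)"
    have "measure_pmf.expectation (diag_step \<Delta> p) (\<lambda>p. iexp (s * real_of_int (fst p) + t * real_of_int (snd p))) =
       (\<theta> / 2) *\<^sub>R (E * (cis s * cis t) + E * (cis (-s) * cis (-t)))
       + ((1 - \<theta>) / 2) *\<^sub>R (E * (cis s * cis (-t)) + E * (cis (-s) * cis t))"
      unfolding integral_diag_step[OF assms] \<theta>_def E_def p
      using shift[of x 1 y 1] shift[of x "-1" y "-1"] shift[of x 1 y "-1"] shift[of x "-1" y 1]
      by simp
    also have "\<dots> = E * ((\<theta> / 2) *\<^sub>R (cis s * cis t + cis (-s) * cis (-t))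
       + ((1 - \<theta>) / 2) *\<^sub>R (cis s * cis (-t) + cis (-s) * cis t))"
      by (simp add: algebra_simps)
    also have "(\<theta> / 2) *\<^sub>R (cis s * cis t + cis (-s) * cis (-t))
       + ((1 - \<theta>) / 2) *\<^sub>R (cis s * cis (-t) + cis (-s) * cis t) = of_real (cos s * cos t - (2 * \<theta> - 1) * (sin s * sin t))"
      by (simp add: complex_eq_iff field_simps)
    also have "2 * \<theta> - 1 = (if x = y then \<Delta> / (2 + \<Delta>) else 0)"
      using assms by (simp add: \<theta>_def field_simps)
    also have "E * of_real (cos s * cos t - (if x = y then \<Delta> / (2 + \<Delta>) else 0) * (sin s * sin t))
      = of_real (cos s * cos t) * E - of_real (\<Delta> / (2 + \<Delta>) * (sin s * sin t)) * (if x = y then E else 0)"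
      by (simp add: algebra_simps)
    also have "(if x = y then E else 0) = (if fst p = snd p then iexp ((s + t) * real_of_int (fst p)) else 0)"
      by (simp add: p E_def algebra_simps)
    finally show ?thesis unfolding E_def by (simp only: p fst_conv snd_conv)
  qed
  show ?thesis
    unfolding walk_char_def diag_char_def expectation_diag_walk_Suc step
    by (simp add: integrable_diag_walk)
qed

lemma walk_char_expand:
  assumes "\<Delta> \<ge> 0"
  shows "walk_char \<Delta> s t n = of_real ((cos s * cos t) ^ n)
     - of_real (\<Delta> / (2 + \<Delta>) * (sin s * sin t)) *
       (\<Sum>k<n. of_real ((cos s * cos t) ^ (n - 1 - k)) * diag_char \<Delta> (s + t) k)"
proof (induction n)
  case 0
  show ?case by (simp add: walk_char_def)
next
  case (Suc n)
  define C where "C = cos s * cos t"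
  define b where "b = complex_of_real (\<Delta> / (2 + \<Delta>) * (sin s * sin t))"
  have "(\<Sum>k<n. complex_of_real (C ^ (n - k)) * diag_char \<Delta> (s + t) k)
    = of_real C * (\<Sum>k<n. of_real (C ^ (n - 1 - k)) * diag_char \<Delta> (s + t) k)"
    unfolding sum_distrib_left
  proof (rule sum.cong)
    fix k assume "k \<in> {..<n}"
    then have "n - k = Suc (n - 1 - k)" by simp
    then show "complex_of_real (C ^ (n - k)) * diag_char \<Delta> (s + t) k =
       of_real C * (of_real (C ^ (n - 1 - k)) * diag_char \<Delta> (s + t) k)"
      by simp
  qed simp
  then show ?case
    unfolding walk_char_Suc[OF assms] Suc.IH C_def[symmetric] b_def[symmetric]
    by (simp add: algebra_simps)
qed

text \<open>The difference of the coordinates changes by \<open>0\<close> or \<open>\<plusminus>2\<close> and starts at \<open>0\<close>, so odd differences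
  never occur. Giving them weight zero makes the neighbour identity below hold for every nonzero
  difference, so that parity need not be tracked along the walk.\<close>

definition excursion_weight :: "real \<Rightarrow> int \<Rightarrow> real" where
  "excursion_weight r d = (if even d then r ^ nat \<bar>d div 2\<bar> else 0)"

lemma excursion_weight_neighbours:
  assumes "r \<noteq> 0" "d \<noteq> 0"
  shows "excursion_weight r (d + 2) + excursion_weight r (d - 2) = (r + 1 / r) * excursion_weight r d"
proof (cases "even d")
  case True
  then obtain m where d: "d = 2 * m" by (elim evenE)
  have shift: "(2 * m + 2) div 2 = m + 1" "(2 * m - 2) div 2 = m - 1" by simp_all
  consider j where "m = int (Suc j)" | j where "m = - int (Suc j)"
    using assms(2) d by (metis int_cases mult_eq_0_iff not0_implies_Suc of_nat_0 int_cases4 of_nat_Suc)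
  then show ?thesis
  proof cases
    case 1
    then have "nat \<bar>m + 1\<bar> = Suc (Suc j)" "nat \<bar>m - 1\<bar> = j" "nat \<bar>m\<bar> = Suc j" by simp_all
    then show ?thesis using assms(1) by (simp add: excursion_weight_def d shift field_simps)
  next
    case 2
    then have "nat \<bar>m + 1\<bar> = j" "nat \<bar>m - 1\<bar> = Suc (Suc j)" "nat \<bar>m\<bar> = Suc j" by simp_all
    then show ?thesis using assms(1) by (simp add: excursion_weight_def d shift field_simps)
  qed
qed (simp add: excursion_weight_def)

text \<open>With \<open>h p = exp (\<i> w (x + y) / 2) * excursion_weight r (x - y)\<close> and \<open>r\<close> chosen such that
  \<open>cos w / 2 + (r + 1 / r) / 4 = 1 / z\<close>, one step of the kernel maps \<open>h\<close> to \<open>h / z\<close>, except on the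
  diagonal, where a multiple of the wave \<open>exp (\<i> w x)\<close> is missing. Hence \<open>z ^ n\<close> times the
  expectation of \<open>h\<close> at time \<open>n\<close> loses a multiple of \<open>z ^ n * diag_char \<Delta> w n\<close> in each step. It starts
  at 1 and tends to 0, which gives the sum of the series. The square root comes from solving the
  quadratic equation for \<open>r\<close>, with the root in the unit interval. In probabilistic terms, \<open>r\<close> is the
  generating function of the time of return to the diagonal from a neighbouring difference, weighted
  with the displacement along the diagonal.\<close>

lemma diag_char_generating_function:
  fixes z w :: real
  assumes "\<Delta> \<ge> 0" and z: "0 < z" "z < 1"
  defines "R \<equiv> sqrt ((1 - z * cos w / 2)\<^sup>2 - z\<^sup>2 / 4)"
  shows "(\<lambda>k. of_real (z ^ k) * diag_char \<Delta> w k) sums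
     of_real (1 / (\<Delta> / (2 + \<Delta>) * (1 - z * cos w) + 2 / (2 + \<Delta>) * R))"
proof -
  define a where "a = 1 - z * cos w / 2"
  \<comment> \<open>The smaller root of the quadratic equation \<open>r + 1 / r = 4 / z - 2 cos w = (4 / z) a\<close>.\<close>
  define r where "r = (2 / z) * (a - R)"
  define \<theta> where "\<theta> = (1 + \<Delta>) / (2 + \<Delta>)"
  \<comment> \<open>The coefficient of the diagonal correction in one step of the kernel.\<close>
  define \<kappa> where "\<kappa> = 1 / z - (\<theta> * cos w + (1 - \<theta>) * r)"
  define D where "D = \<Delta> / (2 + \<Delta>) * (1 - z * cos w) + 2 / (2 + \<Delta>) * R"
  have zc: "z * cos w \<le> z" using z by simp
  then have az: "a > z / 2" unfolding a_def using z by linarith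
  then have sq: "a\<^sup>2 > (z / 2)\<^sup>2" using z by (intro power_strict_mono) auto
  have R2: "R\<^sup>2 = a\<^sup>2 - z\<^sup>2 / 4" using sq by (simp add: R_def a_def power_divide)
  have "R > 0" unfolding R_def using sq by (simp add: a_def power_divide)
  have prod: "(a - R) * (a + R) = z\<^sup>2 / 4" using R2 by (simp add: algebra_simps power2_eq_square)
  have "a + R > z / 2" using az \<open>R > 0\<close> by simp
  moreover have aR: "a - R > 0"
    using prod z az \<open>R > 0\<close> by (smt (verit) divide_pos_pos mult_nonpos_nonneg zero_less_power)
  ultimately have "(a - R) * (z / 2) < z\<^sup>2 / 4"
    using prod by (metis mult_strict_left_mono)
  then have aR': "a - R < z / 2" using z by (simp add: power2_eq_square)
  have r: "0 < r" "r < 1" using aR aR' z by (simp_all add: r_def field_simps)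
  have inv: "1 / r = (2 / z) * (a + R)"
    using prod aR z by (simp add: r_def field_simps power2_eq_square)
  have harm: "cos w / 2 + (r + 1 / r) / 4 = 1 / z"
    unfolding inv using z by (simp add: r_def a_def field_simps)
  have zk: "z * \<kappa> = D"
  proof -
    have "z * r = 2 * (a - R)" using z by (simp add: r_def)
    moreover have "z * \<kappa> = 1 - \<theta> * (z * cos w) - (1 - \<theta>) * (z * r)"
      using z by (simp add: \<kappa>_def algebra_simps)
    ultimately have "z * \<kappa> = 1 - \<theta> * (z * cos w) - (1 - \<theta>) * (2 * (a - R))"
      by simp
    also have "\<dots> = (2 * \<theta> - 1) * (1 - z * cos w) + 2 * (1 - \<theta>) * R"
      by (simp add: a_def algebra_simps)
    also have "2 * \<theta> - 1 = \<Delta> / (2 + \<Delta>)"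
      using \<open>\<Delta> \<ge> 0\<close> by (simp add: \<theta>_def field_simps)
    also have "2 * (1 - \<theta>) = 2 / (2 + \<Delta>)"
      using \<open>\<Delta> \<ge> 0\<close> by (simp add: \<theta>_def field_simps)
    also have "\<Delta> / (2 + \<Delta>) * (1 - z * cos w) + 2 / (2 + \<Delta>) * R = D"
      by (simp add: D_def)
    finally show ?thesis .
  qed
  have zc1: "0 \<le> 1 - z * cos w" using zc z by linarith
  have "0 \<le> \<Delta> / (2 + \<Delta>) * (1 - z * cos w)"
    using \<open>\<Delta> \<ge> 0\<close> by (intro mult_nonneg_nonneg zc1) auto
  moreover have "0 < 2 / (2 + \<Delta>) * R" using \<open>\<Delta> \<ge> 0\<close> \<open>R > 0\<close> by simp
  ultimately have "D > 0" unfolding D_def by linarith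
  define h where "h p = iexp (w * (real_of_int (fst p + snd p) / 2)) * of_real (excursion_weight r (fst p - snd p))"
    for p :: "int \<times> int"
  define \<delta> where "\<delta> p = (if fst p = snd p then iexp (w * real_of_int (fst p)) else 0)" for p :: "int \<times> int"
  have step: "measure_pmf.expectation (diag_step \<Delta> p) h = of_real (1 / z) * h p - of_real \<kappa> * \<delta> p" for p
  proof -
    obtain x y where p: "p = (x, y)" by fastforce
    define E where "E = iexp (w * (real_of_int (x + y) / 2))"
    have up: "h (x + 1, y + 1) = E * cis w * of_real (excursion_weight r (x - y))"
      unfolding h_def E_def by (simp add: cis_conv_exp exp_add[symmetric] algebra_simps add_divide_distrib)
    have down: "h (x - 1, y - 1) = E * cis (- w) * of_real (excursion_weight r (x - y))"
      unfolding h_def E_def by (simp add: cis_conv_exp exp_add[symmetric] algebra_simps add_divide_distrib diff_divide_distrib)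
    have right: "h (x + 1, y - 1) = E * of_real (excursion_weight r (x - y + 2))"
      unfolding h_def E_def by (simp add: algebra_simps)
    have left: "h (x - 1, y + 1) = E * of_real (excursion_weight r (x - y - 2))"
      unfolding h_def E_def by (simp add: algebra_simps)
    have cc: "cis w + cis (- w) = of_real (2 * cos w)" by (simp add: complex_eq_iff)
    show ?thesis
    proof (cases "x = y")
      case True
      have "measure_pmf.expectation (diag_step \<Delta> p) h =
         E * (of_real (\<theta> / 2) * (cis w + cis (- w)) + of_real (1 - \<theta>) * of_real r)"
        unfolding integral_diag_step[OF \<open>\<Delta> \<ge> 0\<close>] p fst_conv snd_conv up down left right
          \<theta>_def[symmetric]
        using True by (simp add: excursion_weight_def scaleR_conv_of_real field_simps)
      also have "\<dots> = E * of_real (1 / z - \<kappa>)"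
        unfolding cc by (simp add: \<kappa>_def)
      finally show ?thesis using True
        by (simp add: h_def \<delta>_def p excursion_weight_def E_def algebra_simps)
    next
      case False
      have "measure_pmf.expectation (diag_step \<Delta> p) h =
         E * (of_real (1 / 4) * (cis w + cis (- w)) * of_real (excursion_weight r (x - y)) +
           of_real (1 / 4) * of_real (excursion_weight r (x - y + 2) + excursion_weight r (x - y - 2)))"
        unfolding integral_diag_step[OF \<open>\<Delta> \<ge> 0\<close>] p fst_conv snd_conv up down left right
        using False by (simp add: scaleR_conv_of_real algebra_simps)
      also have "\<dots> = E * of_real ((cos w / 2 + (r + 1 / r) / 4) * excursion_weight r (x - y))"
        unfolding cc using excursion_weight_neighbours[of r "x - y"] r False
        by (simp add: algebra_simps)
      finally show ?thesis unfolding harm using False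
        by (simp add: h_def \<delta>_def p E_def)
    qed
  qed
  define H where "H n = measure_pmf.expectation (diag_walk \<Delta> n) h" for n
  have H_Suc: "H (Suc n) = of_real (1 / z) * H n - of_real \<kappa> * diag_char \<Delta> w n" for n
    unfolding H_def expectation_diag_walk_Suc step diag_char_def \<delta>_def[symmetric]
    by (simp add: integrable_diag_walk)
  have tele: "of_real D * (\<Sum>k<n. of_real (z ^ k) * diag_char \<Delta> w k) = 1 - of_real (z ^ n) * H n" for n
  proof (induction n)
    case 0
    show ?case by (simp add: H_def h_def excursion_weight_def)
  next
    case (Suc n)
    have "of_real (z ^ Suc n) * H (Suc n) = of_real (z ^ n) * H n - of_real (z * \<kappa>) * (of_real (z ^ n) * diag_char \<Delta> w n)"
      using z by (simp add: H_Suc field_simps)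
    then have "1 - of_real (z ^ Suc n) * H (Suc n) =
        (1 - of_real (z ^ n) * H n) + of_real D * (of_real (z ^ n) * diag_char \<Delta> w n)"
      unfolding zk by (simp only: diff_diff_eq2) (simp only: diff_add_eq)
    then show ?case unfolding Suc.IH[symmetric] by (simp only: sum.lessThan_Suc distrib_left)
  qed
  have Hb: "norm (H n) \<le> 1" for n
  proof -
    have "norm (h p) \<le> 1" for p
      using r by (auto simp: h_def norm_mult excursion_weight_def power_le_one)
    then have "norm (H n) \<le> measure_pmf.expectation (diag_walk \<Delta> n) (\<lambda>p. 1::real)"
      unfolding H_def by (intro order_trans[OF integral_norm_bound] integral_mono integrable_diag_walk)
    then show ?thesis by simp
  qed
  have "(\<lambda>n. of_real (z ^ n) * H n) \<longlonglongrightarrow> 0"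
  proof (rule Lim_null_comparison)
    show "(\<lambda>n. z ^ n) \<longlonglongrightarrow> 0" using z by (intro LIMSEQ_realpow_zero) auto
    show "\<forall>\<^sub>F n in sequentially. norm (of_real (z ^ n) * H n) \<le> z ^ n"
      using Hb z by (intro always_eventually allI) (simp add: norm_mult norm_power mult_left_le)
  qed
  then have "(\<lambda>n. (1 - of_real (z ^ n) * H n) / of_real D) \<longlonglongrightarrow> (1 - 0) / of_real D"
    using \<open>D > 0\<close> by (intro tendsto_intros) auto
  moreover have "(\<lambda>n. (1 - of_real (z ^ n) * H n) / of_real D) = (\<lambda>n. \<Sum>k<n. of_real (z ^ k) * diag_char \<Delta> w k)"
    unfolding tele[symmetric] using \<open>D > 0\<close> by auto
  ultimately show ?thesis unfolding sums_def D_def by simp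
qed

section \<open>A Tauberian theorem for rescaled Laplace transforms\<close>

lemma integrable_exp_decay:
  assumes "(r::real) > 0"
  shows "set_integrable lborel {0..} (\<lambda>x. exp (- r * x))"
    and "(LBINT x:{0..}. exp (- r * x)) = 1 / r"
proof -
  have "has_bochner_integral lborel (\<lambda>x. exp (- x) * indicator {0..} (x::real)) 1"
    using has_bochner_integral_I0i_power_exp_m'[of 0] by (simp add: power_0)
  then have "has_bochner_integral lborel (\<lambda>x. exp (- (0 + r * x)) * indicator {0..} (0 + r * x)) (1 /\<^sub>R \<bar>r\<bar>)"
    using assms by (subst lborel_has_bochner_integral_real_affine_iff[symmetric]) auto
  then have "has_bochner_integral lborel (\<lambda>x. indicator {0..} x *\<^sub>R exp (- r * x)) (1 / r)"
    using assms by (simp add: indicator_def zero_le_mult_iff mult.commute if_distrib field_simps cong: if_cong)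
  then show "set_integrable lborel {0..} (\<lambda>x. exp (- r * x))" "(LBINT x:{0..}. exp (- r * x)) = 1 / r"
    unfolding set_integrable_def set_lebesgue_integral_def by (auto simp: has_bochner_integral_iff)
qed

text \<open>The measures \<open>1 / n * (\<Sum>k. exp (- rate * k / n) * \<delta>(k / n))\<close> have uniformly bounded mass.
  The bound comes from \<open>exp x \<ge> 1 + x\<close>.\<close>

lemma weighted_counting_bounds:
  assumes "rate > 0" "n > 0"
  shows "summable (\<lambda>k. exp (- rate * (real k / real n)))"
    and "(\<Sum>k. exp (- rate * (real k / real n))) / real n \<le> 1 / rate + 1"
proof -
  define q where "q = exp (- rate / real n)"
  have q: "0 < q" "q < 1" using assms by (simp_all add: q_def)
  have eq: "exp (- rate * (real k / real n)) = q ^ k" for k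
    by (simp add: q_def exp_of_nat_mult[symmetric] mult_ac)
  show "summable (\<lambda>k. exp (- rate * (real k / real n)))" unfolding eq using q by (simp add: summable_geometric)
  have S: "(\<Sum>k. exp (- rate * (real k / real n))) = 1 / (1 - q)" unfolding eq using q by (simp add: suminf_geometric)
  have "1 + rate / real n \<le> exp (rate / real n)" by (rule exp_ge_add_one_self)
  then have "q * (1 + rate / real n) \<le> 1"
    unfolding q_def by (simp add: exp_minus field_simps)
  then have "q * (n + rate) \<le> n" using assms by (simp add: field_simps)
  then have "(1 - q) * (n + rate) \<ge> rate" by (simp add: algebra_simps)
  then have "1 / (1 - q) \<le> (n + rate) / rate" using assms q by (simp add: field_simps)
  then have "1 / (1 - q) / n \<le> (n + rate) / rate / n" using assms by (intro divide_right_mono) auto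
  also have "\<dots> = 1 / rate + 1 / n" using assms by (simp add: field_simps)
  also have "\<dots> \<le> 1 / rate + 1" using assms by simp
  finally show "(\<Sum>k. exp (- rate * (real k / real n))) / real n \<le> 1 / rate + 1" unfolding S .
qed

text \<open>Row \<open>n\<close> of the array \<open>a\<close> is viewed as a complex measure with mass \<open>a n k / n\<close> at the point
  \<open>k / n\<close>, and \<open>l\<close> as a density. The last assumption is convergence of the Laplace transforms beyond
  the exponential growth rate \<open>s0\<close> of the density.\<close>

locale laplace_convergence =
  fixes a :: "nat \<Rightarrow> nat \<Rightarrow> complex" and l :: "real \<Rightarrow> complex" and B s0 :: real
  assumes a_le: "norm (a n k) \<le> 1"
    and l_meas[measurable]: "l \<in> borel_measurable borel"
    and l_le: "x \<ge> 0 \<Longrightarrow> norm (l x) \<le> B * exp (s0 * x)"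
    and s0: "s0 \<ge> 0"
    and laplace: "s > s0 \<Longrightarrow>
       (\<lambda>n. (\<Sum>k. of_real (exp (- s * (real k / real n))) * a n k) / of_nat n)
         \<longlonglongrightarrow> (CLBINT x:{0..}. of_real (exp (- s * x)) * l x)"
begin

text \<open>Some point beyond the growth rate. With this choice the weight that remains after cancelling
  \<open>exp (s0 * x)\<close> is \<open>exp (- x)\<close>, whose integral over the half-line is 1.\<close>

definition rate :: real where "rate = s0 + 1"

text \<open>Test functions are expressed in the variable \<open>y = exp (- x)\<close>, which ranges over the unit interval. In
  this variable the Laplace transforms at the points \<open>rate + j\<close> are the moments.\<close>

definition avg :: "nat \<Rightarrow> (real \<Rightarrow> real) \<Rightarrow> complex" where
  "avg n G = (\<Sum>k. of_real (exp (- rate * (real k / real n)) * G (exp (- (real k / real n)))) * a n k) / of_nat n"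

definition lim_avg :: "(real \<Rightarrow> real) \<Rightarrow> complex" where
  "lim_avg G = (CLBINT x:{0..}. of_real (exp (- rate * x) * G (exp (- x))) * l x)"

lemma rate_pos: "rate > 0" and B_nonneg: "B \<ge> 0"
proof -
  show "rate > 0" using s0 by (simp add: rate_def)
  show "B \<ge> 0" using order_trans[OF norm_ge_zero l_le[of 0]] by simp
qed

lemma avg_summable:
  assumes "n > 0" and G: "\<And>y. y \<in> {0..1} \<Longrightarrow> \<bar>G y\<bar> \<le> C"
  shows "summable (\<lambda>k. of_real (exp (- rate * (real k / real n)) * G (exp (- (real k / real n)))) * a n k)"
    and "norm (avg n G) \<le> C * (1 / rate + 1)"
proof -
  have C: "C \<ge> 0" using G[of 0] by simp
  have le: "norm (of_real (exp (- rate * (real k / real n)) * G (exp (- (real k / real n)))) * a n k)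
      \<le> C * exp (- rate * (real k / real n))" for k
  proof -
    have "\<bar>G (exp (- (real k / real n)))\<bar> * norm (a n k) \<le> C * 1"
      using a_le[of n k] G[of "exp (- (real k / real n))"] C by (intro mult_mono) auto
    then have "exp (- rate * (real k / real n)) * (\<bar>G (exp (- (real k / real n)))\<bar> * norm (a n k)) \<le> exp (- rate * (real k / real n)) * (C * 1)"
      by (intro mult_left_mono) auto
    then show ?thesis by (simp add: norm_mult mult_ac)
  qed
  note sm = summable_mult[OF weighted_counting_bounds(1)[OF rate_pos assms(1)], of C]
  show "summable (\<lambda>k. of_real (exp (- rate * (real k / real n)) * G (exp (- (real k / real n)))) * a n k)"
    by (rule summable_comparison_test'[OF sm]) (rule le)
  have "norm (\<Sum>k. of_real (exp (- rate * (real k / real n)) * G (exp (- (real k / real n)))) * a n k)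
     \<le> (\<Sum>k. C * exp (- rate * (real k / real n)))"
    by (rule norm_suminf_le[OF le sm])
  also have "\<dots> = C * (\<Sum>k. exp (- rate * (real k / real n)))"
    by (rule suminf_mult[OF weighted_counting_bounds(1)[OF rate_pos assms(1)]])
  finally have "norm (avg n G) \<le> C * ((\<Sum>k. exp (- rate * (real k / real n))) / n)"
    unfolding avg_def using assms by (simp add: norm_divide field_simps)
  also have "\<dots> \<le> C * (1 / rate + 1)"
    using weighted_counting_bounds(2)[OF rate_pos assms(1)] C by (intro mult_left_mono) auto
  finally show "norm (avg n G) \<le> C * (1 / rate + 1)" .
qed

lemma lim_avg_integrable:
  assumes [measurable]: "G \<in> borel_measurable borel" and G: "\<And>y. y \<in> {0..1} \<Longrightarrow> \<bar>G y\<bar> \<le> C"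
  shows "set_integrable lborel {0..} (\<lambda>x. of_real (exp (- rate * x) * G (exp (- x))) * l x)"
    and "norm (lim_avg G) \<le> C * B"
proof -
  have C: "C \<ge> 0" using G[of 0] by simp
  have le: "norm (indicator {0..} x *\<^sub>R (of_real (exp (- rate * x) * G (exp (- x))) * l x))
     \<le> C * B * (indicator {0..} x *\<^sub>R exp (- 1 * x))" for x
  proof (cases "x \<ge> 0")
    case True
    have "\<bar>G (exp (- x))\<bar> * norm (l x) \<le> C * (B * exp (s0 * x))"
      using True G[of "exp (- x)"] l_le[of x] C by (intro mult_mono) auto
    then have "exp (- rate * x) * (\<bar>G (exp (- x))\<bar> * norm (l x)) \<le> exp (- rate * x) * (C * (B * exp (s0 * x)))"
      by (intro mult_left_mono) auto
    also have "\<dots> = C * B * exp (- 1 * x)" by (simp add: rate_def exp_add[symmetric] algebra_simps)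
    finally show ?thesis using True by (simp add: norm_mult mult_ac)
  qed simp
  have int: "integrable lborel (\<lambda>x. C * B * (indicator {0..} x *\<^sub>R exp (- 1 * x :: real)))"
    using integrable_exp_decay(1)[of 1] unfolding set_integrable_def by (intro integrable_mult_right) simp
  show *: "set_integrable lborel {0..} (\<lambda>x. of_real (exp (- rate * x) * G (exp (- x))) * l x)"
    unfolding set_integrable_def
  proof (rule Bochner_Integration.integrable_bound[OF int])
    show "AE x in lborel. norm (indicator {0..} x *\<^sub>R (of_real (exp (- rate * x) * G (exp (- x))) * l x))
       \<le> norm (C * B * (indicator {0..} x *\<^sub>R exp (- 1 * x)))"
      by (intro AE_I2 order_trans[OF le]) simp
  qed measurable
  have "norm (lim_avg G) \<le> (\<integral>x. C * B * (indicator {0..} x *\<^sub>R exp (- 1 * x :: real)) \<partial>lborel)"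
    unfolding lim_avg_def set_lebesgue_integral_def
    using * int le unfolding set_integrable_def
    by (intro order_trans[OF integral_norm_bound] integral_mono integrable_norm)
  also have "\<dots> = C * B"
    using integrable_exp_decay(2)[of 1] unfolding set_lebesgue_integral_def by simp
  finally show "norm (lim_avg G) \<le> C * B" .
qed

lemma avg_tendsto_monomial: "(\<lambda>n. avg n (\<lambda>y. y ^ j)) \<longlonglongrightarrow> lim_avg (\<lambda>y. y ^ j)"
proof -
  have e: "exp (- rate * x) * exp (- x) ^ j = exp (- (rate + j) * x)" for x
    by (simp add: exp_of_nat_mult[symmetric] exp_add[symmetric] algebra_simps)
  show ?thesis
    unfolding avg_def lim_avg_def e by (rule laplace) (simp add: rate_def)
qed

lemma avg_tendsto_polynomial:
  "(\<lambda>n. avg n (\<lambda>y. \<Sum>j\<le>m. c j * y ^ j)) \<longlonglongrightarrow> lim_avg (\<lambda>y. \<Sum>j\<le>m. c j * y ^ j)"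
proof -
  have pow: "\<bar>y ^ j\<bar> \<le> 1" if "y \<in> {0..1}" for y :: real and j using that by (auto intro: power_le_one)
  have Dl: "avg n (\<lambda>y. \<Sum>j\<le>m. c j * y ^ j) = (\<Sum>j\<le>m. of_real (c j) * avg n (\<lambda>y. y ^ j))" if "n > 0" for n
  proof -
    have "(\<Sum>k. of_real (exp (- rate * (real k / real n)) * (\<Sum>j\<le>m. c j * exp (- (real k / real n)) ^ j)) * a n k)
        = (\<Sum>k. \<Sum>j\<le>m. of_real (c j) * (of_real (exp (- rate * (real k / real n)) * exp (- (real k / real n)) ^ j) * a n k))"
      by (intro suminf_cong) (simp add: sum_distrib_left sum_distrib_right mult_ac)
    also have "\<dots> = (\<Sum>j\<le>m. \<Sum>k. of_real (c j) * (of_real (exp (- rate * (real k / real n)) * exp (- (real k / real n)) ^ j) * a n k))"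
      by (rule suminf_sum) (intro summable_mult avg_summable(1)[OF that pow])
    also have "\<dots> = (\<Sum>j\<le>m. of_real (c j) * (\<Sum>k. of_real (exp (- rate * (real k / real n)) * exp (- (real k / real n)) ^ j) * a n k))"
      by (intro sum.cong refl suminf_mult avg_summable(1)[OF that pow])
    finally show ?thesis unfolding avg_def by (simp add: sum_divide_distrib)
  qed
  have Ll: "lim_avg (\<lambda>y. \<Sum>j\<le>m. c j * y ^ j) = (\<Sum>j\<le>m. of_real (c j) * lim_avg (\<lambda>y. y ^ j))"
  proof -
    have int: "set_integrable lborel {0..} (\<lambda>x. of_real (exp (- rate * x) * exp (- x) ^ j) * l x)" for j
      by (rule lim_avg_integrable(1)[of "\<lambda>y. y ^ j", OF _ pow]) auto
    have "lim_avg (\<lambda>y. \<Sum>j\<le>m. c j * y ^ j) = (CLBINT x:{0..}. (\<Sum>j\<le>m. of_real (c j) * (of_real (exp (- rate * x) * exp (- x) ^ j) * l x)))"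
      unfolding lim_avg_def by (simp add: sum_distrib_left sum_distrib_right mult_ac)
    also have "\<dots> = (\<Sum>j\<le>m. (CLBINT x:{0..}. of_real (c j) * (of_real (exp (- rate * x) * exp (- x) ^ j) * l x)))"
      unfolding set_lebesgue_integral_def scaleR_sum_right
      by (rule Bochner_Integration.integral_sum)
        (use set_integrable_mult_right[OF int] in \<open>auto simp: set_integrable_def\<close>)
    finally show ?thesis unfolding lim_avg_def by simp
  qed
  show ?thesis
    unfolding Ll
    by (rule Lim_transform_eventually[where f="\<lambda>n. \<Sum>j\<le>m. of_real (c j) * avg n (\<lambda>y. y ^ j)"])
      (intro tendsto_intros avg_tendsto_monomial, use Dl in \<open>auto intro!: eventually_mono[OF eventually_gt_at_top[of 0]]\<close>)
qed

text \<open>Moments determine the limit: both functionals are continuous for the uniform norm on the unit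
  interval, uniformly in \<open>n\<close>, and polynomials are dense by the Weierstrass theorem.\<close>

lemma avg_tendsto_continuous:
  assumes G: "continuous_on UNIV G"
  shows "(\<lambda>n. avg n G) \<longlonglongrightarrow> lim_avg G"
proof (rule LIMSEQ_I)
  fix \<epsilon> :: real assume "\<epsilon> > 0"
  define K where "K = 1 / rate + 1 + B"
  have K: "K > 0" using rate_pos B_nonneg by (simp add: K_def add_pos_nonneg)
  define e where "e = \<epsilon> / (3 * K)"
  have e: "e > 0" using \<open>\<epsilon> > 0\<close> K by (simp add: e_def)
  obtain p where p: "real_polynomial_function p" "\<And>y. y \<in> {0..1} \<Longrightarrow> \<bar>G y - p y\<bar> < e"
    using Stone_Weierstrass_real_polynomial_function[of "{0..1}" G e] e continuous_on_subset[OF G] by auto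
  obtain c m where pm: "p = (\<lambda>y. \<Sum>j\<le>m. c j * y ^ j)"
    using p(1) by (auto simp: real_polynomial_function_iff_sum)
  have Gb: "\<exists>C. \<forall>y\<in>{0..1}. \<bar>H y\<bar> \<le> C" if "continuous_on UNIV H" for H :: "real \<Rightarrow> real"
    using compact_imp_bounded[OF compact_continuous_image[OF continuous_on_subset[OF that] compact_Icc[of 0 1]]]
    by (auto simp: bounded_iff)
  have pc: "continuous_on UNIV p" unfolding pm by (intro continuous_intros)
  obtain C1 where C1: "\<And>y. y \<in> {0..1} \<Longrightarrow> \<bar>G y\<bar> \<le> C1" using Gb[OF G] by blast
  obtain C2 where C2: "\<And>y. y \<in> {0..1} \<Longrightarrow> \<bar>p y\<bar> \<le> C2" using Gb[OF pc] by blast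
  have [measurable]: "G \<in> borel_measurable borel" "p \<in> borel_measurable borel"
    using G pc by (auto intro: borel_measurable_continuous_onI)
  have le: "\<bar>G y - p y\<bar> \<le> e" if "y \<in> {0..1}" for y using p(2)[OF that] by simp
  have Dd: "norm (avg n G - avg n p) \<le> e * (1 / rate + 1)" if "n > 0" for n
  proof -
    let ?f = "\<lambda>H k. of_real (exp (- rate * (real k / real n)) * H (exp (- (real k / real n)))) * a n k"
    have "avg n G - avg n p = ((\<Sum>k. ?f G k) - (\<Sum>k. ?f p k)) / of_nat n"
      unfolding avg_def by (simp add: diff_divide_distrib)
    also have "(\<Sum>k. ?f G k) - (\<Sum>k. ?f p k) = (\<Sum>k. ?f G k - ?f p k)"
      by (rule suminf_diff[OF avg_summable(1)[OF that C1] avg_summable(1)[OF that C2]])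
    also have "(\<Sum>k. ?f G k - ?f p k) / of_nat n = avg n (\<lambda>y. G y - p y)"
      unfolding avg_def by (simp add: algebra_simps)
    finally have "avg n G - avg n p = avg n (\<lambda>y. G y - p y)" .
    then show ?thesis using avg_summable(2)[OF that le] by simp
  qed
  have Ld: "norm (lim_avg G - lim_avg p) \<le> e * B"
  proof -
    have "lim_avg G - lim_avg p = lim_avg (\<lambda>y. G y - p y)"
      unfolding lim_avg_def
      by (subst set_integral_diff(2)[OF lim_avg_integrable(1)[OF _ C1] lim_avg_integrable(1)[OF _ C2], symmetric])
        (auto simp: algebra_simps)
    then show ?thesis using lim_avg_integrable(2)[OF _ le] by simp
  qed
  have "(\<lambda>n. avg n p) \<longlonglongrightarrow> lim_avg p" unfolding pm by (rule avg_tendsto_polynomial)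
  then obtain N where N: "\<And>n. n \<ge> N \<Longrightarrow> norm (avg n p - lim_avg p) < \<epsilon> / 3"
    using LIMSEQ_D[of _ _ "\<epsilon> / 3"] \<open>\<epsilon> > 0\<close> by (metis divide_pos_pos zero_less_numeral)
  have "norm (avg n G - lim_avg G) < \<epsilon>" if "n \<ge> max N 1" for n
  proof -
    have "norm (avg n G - lim_avg G) \<le> norm (avg n G - avg n p) + norm (avg n p - lim_avg p) + norm (lim_avg G - lim_avg p)"
      by (smt (verit, best) norm_triangle_ineq4 norm_diff_triangle_le norm_minus_commute order_refl)
    also have "\<dots> < e * (1 / rate + 1) + \<epsilon> / 3 + e * B"
      using Dd[of n] N[of n] Ld that by (simp add: add_less_le_mono add_le_less_mono)
    also have "\<dots> = e * K + \<epsilon> / 3" by (simp add: K_def algebra_simps)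
    also have "\<dots> < \<epsilon>" using K \<open>\<epsilon> > 0\<close> by (simp add: e_def)
    finally show ?thesis .
  qed
  then show "\<exists>N. \<forall>n\<ge>N. norm (avg n G - lim_avg G) < \<epsilon>" by blast
qed


text \<open>The test function here is \<open>h\<close> times the indicator of the unit interval, which jumps at 1. It is
  replaced by a continuous function that differs from it only on an interval of length \<open>\<delta>\<close>. As \<open>a\<close>
  is bounded and \<open>l\<close> is locally bounded, the error is of order \<open>\<delta>\<close> on both sides.\<close>

lemma window_convergence:
  fixes h :: "real \<Rightarrow> real"
  assumes h: "continuous_on UNIV h"
  shows "(\<lambda>n. (\<Sum>k<n. of_real (h (real k / real n)) * a n k) / of_nat n)
     \<longlonglongrightarrow> (CLBINT x:{0..1}. of_real (h x) * l x)"
proof (rule LIMSEQ_I)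
  fix \<epsilon> :: real assume "\<epsilon> > 0"
  have "bounded (h ` {0..1})"
    using compact_imp_bounded[OF compact_continuous_image[OF continuous_on_subset[OF h] compact_Icc[of 0 1]]]
    by simp
  then obtain C0 where C0: "\<forall>x\<in>{0..1}. \<bar>h x\<bar> \<le> C0"
    unfolding bounded_iff by auto
  define C where "C = \<bar>C0\<bar> + 1"
  have C: "C > 0" "\<And>x. x \<in> {0..1} \<Longrightarrow> \<bar>h x\<bar> \<le> C"
    using C0 by (simp add: C_def, unfold C_def) (meson abs_ge_self le_add_same_cancel1 order_trans zero_le_one)
  define K where "K = C + C * (B * exp (s0 * 2))"
  have K: "K > 0" using C(1) B_nonneg by (simp add: K_def add_pos_nonneg)
  \<comment> \<open>The bound \<open>\<delta> \<le> 1\<close> places the support of the cutoff to the left of 2.\<close>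
  define \<delta> where "\<delta> = min 1 (\<epsilon> / (3 * K))"
  have \<delta>: "0 < \<delta>" "\<delta> \<le> 1" using K \<open>\<epsilon> > 0\<close> by (simp_all add: \<delta>_def)
  have \<delta>K: "\<delta> * K \<le> \<epsilon> / 3"
    using K by (simp add: \<delta>_def min_def field_simps)
  define \<eta> where "\<eta> x = max 0 (min 1 (1 - (x - 1) / \<delta>))" for x :: real
  define g where "g x = h (max 0 (min x 1)) * \<eta> x" for x
  have \<eta>01: "0 \<le> \<eta> x" "\<eta> x \<le> 1" for x by (auto simp: \<eta>_def)
  have \<eta>1: "\<eta> x = 1" if "x \<le> 1" for x using that \<delta> by (auto simp: \<eta>_def divide_nonpos_pos)
  have \<eta>0: "\<eta> x = 0" if "x \<ge> 1 + \<delta>" for x using that \<delta> by (auto simp: \<eta>_def field_simps)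
  have cont_g: "continuous_on UNIV g"
    unfolding g_def \<eta>_def using \<delta>
    by (intro continuous_intros continuous_on_compose2[OF h]) auto
  have g_le: "\<bar>g x\<bar> \<le> C" for x
    using C(2)[of "max 0 (min x 1)"] \<eta>01[of x] C(1) unfolding g_def abs_mult
    by (smt (verit) atLeastAtMost_iff mult_left_le abs_ge_zero)
  have g_h: "g x = h x" if "x \<in> {0..1}" for x using that \<eta>1[of x] by (simp add: g_def)
  have g0: "g x = 0" if "x \<ge> 1 + \<delta>" for x using \<eta>0[OF that] by (simp add: g_def)
  \<comment> \<open>The maximum with \<open>exp (- 2)\<close> keeps the logarithm continuous up to \<open>y = 0\<close>. It changes nothing, because
  the cutoff has vanished at \<open>x = 2\<close>.\<close>
  define G where "G y = exp (rate * (- ln (max y (exp (- 2))))) * g (- ln (max y (exp (- 2))))" for y :: real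
  have cont_G: "continuous_on UNIV G"
  proof -
    have "continuous_on UNIV (\<lambda>y::real. - ln (max y (exp (- 2))))"
      by (intro continuous_intros) (auto simp: max_def)
    then show ?thesis
      unfolding G_def
      by (intro continuous_on_mult continuous_on_exp continuous_on_const continuous_on_compose2[OF cont_g]) auto
  qed
  have G: "exp (- rate * x) * G (exp (- x)) = g x" for x
  proof (cases "x \<le> 2")
    case True
    then have "max (exp (- x)) (exp (- 2)) = exp (- x)" by (simp add: max_def)
    then show ?thesis by (simp add: G_def exp_add[symmetric] mult.assoc[symmetric])
  next
    case False
    then have "max (exp (- x)) (exp (- 2)) = exp (- 2)" by (simp add: max_def)
    moreover have "g 2 = 0" "g x = 0" using False \<delta> by (auto intro!: g0)
    ultimately show ?thesis by (simp add: G_def)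
  qed
  define S where "S n = (\<Sum>k<n. of_real (h (real k / real n)) * a n k) / of_nat n" for n
  define I where "I = (CLBINT x:{0..1}. of_real (h x) * l x)"
  have DG: "norm (avg n G - S n) \<le> C * \<delta> + C / n" if n: "n > 0" for n
  proof -
    \<comment> \<open>At most \<open>m\<close> of the points \<open>k / n\<close> lie in the interval where the cutoff decreases.\<close>
    define m where "m = nat \<lceil>\<delta> * n\<rceil>"
    have m: "\<delta> * n \<le> m" "m \<le> \<delta> * n + 1" using \<delta> by (auto simp: m_def)
    have z: "g (real k / real n) = 0" if "k \<notin> {..<n + m}" for k
    proof (rule g0)
      have "real k \<ge> real n + real m" using that by simp
      then have "real k \<ge> (1 + \<delta>) * real n" using m by (simp add: algebra_simps)
      then show "1 + \<delta> \<le> real k / real n" using n by (simp add: field_simps)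
    qed
    have "(\<Sum>k. of_real (g (real k / real n)) * a n k) = (\<Sum>k\<in>{..<n + m}. of_real (g (real k / real n)) * a n k)"
      by (rule suminf_finite) (use z in auto)
    also have "{..<n + m} = {..<n} \<union> {n..<n + m}" by auto
    also have "(\<Sum>k\<in>{..<n} \<union> {n..<n + m}. of_real (g (real k / real n)) * a n k) =
      (\<Sum>k<n. of_real (g (real k / real n)) * a n k) + (\<Sum>k=n..<n + m. of_real (g (real k / real n)) * a n k)"
      by (rule sum.union_disjoint) auto
    also have "(\<Sum>k<n. of_real (g (real k / real n)) * a n k) = (\<Sum>k<n. of_real (h (real k / real n)) * a n k)"
      by (intro sum.cong refl) (use n in \<open>auto simp: g_h\<close>)
    finally have "avg n G - S n = (\<Sum>k=n..<n + m. of_real (g (real k / real n)) * a n k) / of_nat n"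
      unfolding avg_def S_def G by (simp add: add_divide_distrib)
    moreover have "norm (\<Sum>k=n..<n + m. of_real (g (real k / real n)) * a n k) \<le> (\<Sum>k=n..<n + m. C)"
    proof (rule sum_norm_le)
      fix k
      have "\<bar>g (real k / real n)\<bar> * norm (a n k) \<le> C * 1"
        using g_le a_le C(1) by (intro mult_mono) auto
      then show "norm (of_real (g (real k / real n)) * a n k) \<le> C" by (simp add: norm_mult)
    qed
    ultimately have "norm (avg n G - S n) \<le> m * C / n" by (simp add: norm_divide divide_right_mono)
    also have "\<dots> \<le> (\<delta> * n + 1) * C / n"
      using m C(1) by (intro divide_right_mono mult_right_mono) auto
    also have "\<dots> = C * \<delta> + C / n" using n by (simp add: field_simps)
    finally show ?thesis .
  qed
  have LG: "norm (lim_avg G - I) \<le> C * (B * exp (s0 * 2)) * \<delta>"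
  proof -
    have [measurable]: "g \<in> borel_measurable borel" "h \<in> borel_measurable borel"
      using cont_g h by (auto intro: borel_measurable_continuous_onI)
    have le: "norm (of_real (g x) * l x) \<le> C * (B * exp (s0 * 2))" if "0 \<le> x" "x \<le> 2" for x
    proof -
      have "\<bar>g x\<bar> * norm (l x) \<le> C * (B * exp (s0 * 2))"
        using g_le[of x] l_le[of x] that s0 B_nonneg C(1)
        by (intro mult_mono order_trans[OF l_le]) (auto intro!: mult_left_mono)
      then show ?thesis by (simp add: norm_mult)
    qed
    have int: "set_integrable lborel A (\<lambda>x. of_real (g x) * l x)"
      if A: "A \<in> sets borel" "A \<subseteq> {0..2}" for A
    proof (rule set_integrable_subset[OF _ _ A(2)])
      show "set_integrable lborel {0..2} (\<lambda>x. of_real (g x) * l x)"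
        unfolding set_integrable_def
        by (rule integrableI_bounded_set[where A="{0..2}" and B="C * (B * exp (s0 * 2))"])
          (use le in auto)
    qed (use A in auto)
    have "lim_avg G = (CLBINT x:{0..}. of_real (g x) * l x)" unfolding lim_avg_def G ..
    also have "\<dots> = (CLBINT x:{0..1} \<union> {1<..1 + \<delta>}. of_real (g x) * l x)"
      unfolding set_lebesgue_integral_def using g0 \<delta>
      by (intro Bochner_Integration.integral_cong) (auto simp: indicator_def)
    also have "\<dots> = (CLBINT x:{0..1}. of_real (g x) * l x) + (CLBINT x:{1<..1 + \<delta>}. of_real (g x) * l x)"
      by (rule set_integral_Un) (use \<delta> in \<open>auto intro!: int\<close>)
    also have "(CLBINT x:{0..1}. of_real (g x) * l x) = I"
      unfolding I_def by (intro set_lebesgue_integral_cong) (auto simp: g_h)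
    finally have "norm (lim_avg G - I) = norm (CLBINT x:{1<..1 + \<delta>}. of_real (g x) * l x)" by simp
    also have "\<dots> \<le> (LBINT x:{1<..1 + \<delta>}. norm (of_real (g x) * l x))"
      by (rule set_integral_norm_bound) (use \<delta> in \<open>auto intro!: int\<close>)
    also have "\<dots> \<le> (LBINT x:{1<..1 + \<delta>}. C * (B * exp (s0 * 2)))"
    proof (rule set_integral_mono)
      show "set_integrable lborel {1<..1 + \<delta>} (\<lambda>x. norm (of_real (g x) * l x))"
        by (intro set_integrable_norm int) (use \<delta> in auto)
      show "set_integrable lborel {1<..1 + \<delta>} (\<lambda>x. C * (B * exp (s0 * 2)))"
        using \<delta> by (simp add: set_integrable_def integrable_indicator_iff)
      show "norm (of_real (g x) * l x) \<le> C * (B * exp (s0 * 2))" if "x \<in> {1<..1 + \<delta>}" for x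
        using that \<delta> by (intro le) auto
    qed
    also have "\<dots> = C * (B * exp (s0 * 2)) * \<delta>"
      using \<delta> by (simp add: set_lebesgue_integral_def)
    finally show ?thesis .
  qed
  obtain N where N: "\<And>n. n \<ge> N \<Longrightarrow> norm (avg n G - lim_avg G) < \<epsilon> / 3"
    using LIMSEQ_D[OF avg_tendsto_continuous[OF cont_G], of "\<epsilon> / 3"] \<open>\<epsilon> > 0\<close> by auto
  obtain N' :: nat where N': "N' > 0" "C / N' < \<epsilon> / 3"
  proof -
    obtain N' :: nat where "real N' > 3 * C / \<epsilon>" using reals_Archimedean2 by blast
    moreover from this have "N' > 0" using C(1) \<open>\<epsilon> > 0\<close>
      by (metis divide_pos_pos gr0I less_asym mult_pos_pos of_nat_0 zero_less_numeral)
    ultimately show ?thesis using that[of N'] \<open>\<epsilon> > 0\<close> by (simp add: field_simps)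
  qed
  have "norm (S n - I) < \<epsilon>" if "n \<ge> max N N'" for n
  proof -
    have n: "n > 0" "n \<ge> N" using that N' by auto
    have "C / n \<le> C / N'" using that N' C(1) by (intro divide_left_mono) auto
    then have "norm (avg n G - S n) < C * \<delta> + \<epsilon> / 3" using DG[OF n(1)] N' by linarith
    moreover have "C * \<delta> + C * (B * exp (s0 * 2)) * \<delta> \<le> \<epsilon> / 3" using \<delta>K by (simp add: K_def algebra_simps)
    moreover have "norm (S n - I) \<le> norm (avg n G - S n) + norm (avg n G - lim_avg G) + norm (lim_avg G - I)"
      by (smt (verit, best) norm_triangle_ineq4 norm_diff_triangle_le norm_minus_commute order_refl)
    ultimately show ?thesis using N[OF n(2)] LG by linarith
  qed
  then show "\<exists>N. \<forall>n\<ge>N. norm ((\<Sum>k<n. of_real (h (real k / real n)) * a n k) / of_nat n -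
      (CLBINT x:{0..1}. of_real (h x) * l x)) < \<epsilon>"
    unfolding S_def I_def by blast
qed

end

section \<open>Laplace transforms of complementary error functions\<close>

text \<open>The open half-line matches the differential equations below. They hold only for \<open>x > 0\<close>, because
  the square root is not differentiable at the origin.\<close>

definition has_laplace :: "(real \<Rightarrow> complex) \<Rightarrow> real \<Rightarrow> complex \<Rightarrow> bool" where
  "has_laplace f p I \<longleftrightarrow>
     has_bochner_integral lborel (\<lambda>x. indicator {0<..} x *\<^sub>R (of_real (exp (- p * x)) * f x)) I"

lemma has_laplace_add:
  "has_laplace f p I \<Longrightarrow> has_laplace g p J \<Longrightarrow> has_laplace (\<lambda>x. f x + g x) p (I + J)"
  unfolding has_laplace_def
  by (drule (1) has_bochner_integral_add) (simp add: algebra_simps)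

lemma has_laplace_cmult: "has_laplace f p I \<Longrightarrow> has_laplace (\<lambda>x. c * f x) p (c * I)"
proof -
  assume "has_laplace f p I"
  then have "has_bochner_integral lborel (\<lambda>x. c * (indicator {0<..} x *\<^sub>R (of_real (exp (- p * x)) * f x))) (c * I)"
    unfolding has_laplace_def by (intro has_bochner_integral_mult_right)
  then show ?thesis
    unfolding has_laplace_def by (simp add: mult.left_commute)
qed

lemma has_laplace_shift:
  "has_laplace f (p + c) I \<Longrightarrow> has_laplace (\<lambda>x. of_real (exp (- c * x)) * f x) p I"
proof -
  have "complex_of_real (exp (- (p + c) * x)) * f x = of_real (exp (- p * x)) * (of_real (exp (- c * x)) * f x)" for x
  proof -
    have "exp (- (p + c) * x) = exp (- p * x) * exp (- c * x)"
      by (simp add: exp_add[symmetric] algebra_simps)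
    then show ?thesis by (simp only: of_real_mult mult.assoc)
  qed
  then show "has_laplace f (p + c) I \<Longrightarrow> has_laplace (\<lambda>x. of_real (exp (- c * x)) * f x) p I"
    unfolding has_laplace_def by (simp only:)
qed

lemma has_laplace_integral_eq:
  assumes "has_laplace f p I"
  shows "(CLBINT x:{0..}. of_real (exp (- p * x)) * f x) = I"
proof -
  have "(CLBINT x:{0..}. of_real (exp (- p * x)) * f x) = (CLBINT x:{0<..}. of_real (exp (- p * x)) * f x)"
    by (rule set_integral_discrete_difference[where X="{0}"]) auto
  then show ?thesis using assms
    unfolding has_laplace_def set_lebesgue_integral_def by (simp add: has_bochner_integral_iff)
qed

lemma has_laplace_exp_bounded:
  assumes cont: "continuous_on {0<..} f"
    and le: "\<And>x. x > 0 \<Longrightarrow> norm (f x) \<le> C * exp (s * x)" and p: "p > s"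
  obtains I where "has_laplace f p I"
proof -
  have dom: "integrable lborel (\<lambda>x. C * (indicator {0..} x * exp (- ((p - s) * x))))"
    using integrable_exp_decay(1)[of "p - s"] p unfolding minus_mult_left
    by (intro integrable_mult_right) (simp only: set_integrable_def real_scaleR_def diff_gt_0_iff_gt)
  have "integrable lborel (\<lambda>x. indicator {0<..} x *\<^sub>R (of_real (exp (- p * x)) * f x))"
  proof (rule Bochner_Integration.integrable_bound[OF dom])
    have "continuous_on {0<..} (\<lambda>x. of_real (exp (- p * x)) * f x)"
      by (intro continuous_intros cont)
    then show "(\<lambda>x. indicator {0<..} x *\<^sub>R (of_real (exp (- p * x)) * f x)) \<in> borel_measurable lborel"
      by (simp add: borel_measurable_continuous_on_indicator)
    show "AE x in lborel. norm (indicator {0<..} x *\<^sub>R (of_real (exp (- p * x)) * f x))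
       \<le> norm (C * (indicator {0..} x * exp (- ((p - s) * x))))"
    proof (rule AE_I2)
      fix x :: real
      show "norm (indicator {0<..} x *\<^sub>R (of_real (exp (- p * x)) * f x))
       \<le> norm (C * (indicator {0..} x * exp (- ((p - s) * x))))"
      proof (cases "x > 0")
        case True
        have "exp (- p * x) * norm (f x) \<le> exp (- p * x) * (C * exp (s * x))"
          by (intro mult_left_mono le True) auto
        also have "\<dots> = C * exp (- ((p - s) * x))" by (simp add: exp_add[symmetric] algebra_simps)
        also have "\<dots> \<le> norm (C * exp (- ((p - s) * x)))" by simp
        finally show ?thesis using True by (simp add: norm_mult)
      qed simp
    qed
  qed
  then show ?thesis using that unfolding has_laplace_def by (auto simp: has_bochner_integral_iff)
qed

text \<open>Integration by parts, in the form of the fundamental theorem of calculus for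
  \<open>exp (- p x) * F x\<close> on the half-line.\<close>

lemma has_laplace_derivative:
  assumes F: "has_laplace F p I" and f: "has_laplace f p J"
    and deriv: "\<And>x. x > 0 \<Longrightarrow> (F has_vector_derivative f x) (at x)"
    and cont: "\<And>x. x > 0 \<Longrightarrow> isCont f x"
    and le: "\<And>x. x > 0 \<Longrightarrow> norm (F x) \<le> C * exp (s * x)" and p: "p > s"
    and F0: "(F \<longlongrightarrow> F0) (at_right 0)"
  shows "J = of_real p * I - F0"
proof -
  define H where "H x = of_real (exp (- p * x)) * F x" for x
  define h where "h x = of_real (exp (- p * x)) * f x - of_real p * (of_real (exp (- p * x)) * F x)" for x
  have h_int: "has_bochner_integral lborel (\<lambda>x. indicator {0<..} x *\<^sub>R h x) (J - of_real p * I)"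
    using has_laplace_add[OF f has_laplace_cmult[OF F, of "- of_real p"]]
    unfolding has_laplace_def h_def by (simp add: algebra_simps)
  have contF: "isCont F x" if "x > 0" for x
    using deriv[OF that] by (rule has_vector_derivative_continuous)
  have "(CLBINT x=0..\<infinity>. h x) = 0 - F0"
  proof (rule interval_integral_FTC_integrable)
    fix x :: real assume "0 < ereal x"
    then have x: "x > 0" by simp
    have "((\<lambda>x. complex_of_real (exp (- p * x))) has_vector_derivative of_real (- p * exp (- p * x))) (at x)"
      by (rule has_vector_derivative_of_real) (auto intro!: derivative_eq_intros)
    from has_vector_derivative_mult[OF this deriv[OF x]]
    show "(H has_vector_derivative h x) (at x)"
      unfolding H_def h_def by (simp add: algebra_simps)
    show "isCont h x"
      unfolding h_def by (intro continuous_intros cont contF x)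
  next
    show "set_integrable lborel (einterval 0 \<infinity>) h"
      using h_int by (simp add: set_integrable_def zero_ereal_def has_bochner_integral_iff)
    have "((\<lambda>x. of_real (exp (- p * x)) * F x) \<longlongrightarrow> of_real (exp (- p * 0)) * F0) (at_right 0)"
      by (intro tendsto_intros F0)
    then show "((H \<circ> real_of_ereal) \<longlongrightarrow> F0) (at_right 0)"
      unfolding zero_ereal_def ereal_tendsto_simps H_def by simp
    have "(H \<longlongrightarrow> 0) at_top"
    proof (rule Lim_null_comparison)
      show "\<forall>\<^sub>F x in at_top. norm (H x) \<le> C * exp (- ((p - s) * x))"
        using eventually_gt_at_top[of 0]
      proof eventually_elim
        case (elim x)
        have "exp (- p * x) * norm (F x) \<le> exp (- p * x) * (C * exp (s * x))"
          by (intro mult_left_mono le elim) auto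
        also have "\<dots> = C * exp (- ((p - s) * x))" by (simp add: exp_add[symmetric] algebra_simps)
        finally show ?case by (simp add: H_def norm_mult)
      qed
      have "q > 0 \<Longrightarrow> ((\<lambda>x. C * exp (- (q * x))) \<longlongrightarrow> 0) at_top" for q :: real
        by real_asymp
      then show "((\<lambda>x. C * exp (- ((p - s) * x))) \<longlongrightarrow> 0) at_top" using p by simp
    qed
    then show "((H \<circ> real_of_ereal) \<longlongrightarrow> 0) (at_left \<infinity>)"
      unfolding ereal_tendsto_simps .
  qed simp
  then have "J - of_real p * I = - F0"
    using h_int unfolding interval_lebesgue_integral_0_infty set_lebesgue_integral_def
    by (simp add: has_bochner_integral_iff)
  then show ?thesis by (simp add: algebra_simps)
qed

text \<open>This is the value of the Gamma function at one half, rescaled.\<close>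

lemma has_laplace_inverse_sqrt:
  assumes "p > 0"
  shows "has_laplace (\<lambda>x. of_real (1 / sqrt x)) p (of_real (sqrt (pi / p)))"
proof -
  let ?g = "\<lambda>x::real. indicator {0..} x * (x powr (1 / 2 - 1) / exp x)"
  have "((\<lambda>x. x powr (1 / 2 - 1) / exp x) has_integral sqrt pi) {0..}"
    using Gamma_integral_real[of "1 / 2"] by (simp add: Gamma_one_half_real)
  then have "(\<integral>\<^sup>+x. ennreal (?g x) \<partial>lborel) = ennreal (sqrt pi)"
    by (intro nn_integral_has_integral_lebesgue) auto
  then have "has_bochner_integral lborel ?g (sqrt pi)"
    by (intro has_bochner_integral_nn_integral) (auto simp: indicator_def)
  then have "has_bochner_integral lborel (\<lambda>x. ?g (0 + p * x)) (sqrt pi /\<^sub>R \<bar>p\<bar>)"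
    using assms by (subst lborel_has_bochner_integral_real_affine_iff[symmetric]) auto
  then have "has_bochner_integral lborel (\<lambda>x. sqrt p * ?g (0 + p * x)) (sqrt p * (sqrt pi /\<^sub>R \<bar>p\<bar>))"
    by (intro has_bochner_integral_mult_right) auto
  moreover have "sqrt p * ?g (0 + p * x) = indicator {0<..} x * (exp (- p * x) * (1 / sqrt x))" for x
  proof (cases "x > 0")
    case True
    have "(p * x) powr (1 / 2 - 1) = (p * x) powr (- (1 / 2))" by simp
    also have "\<dots> = inverse (sqrt (p * x))"
      using True assms by (simp only: powr_minus powr_half_sqrt mult_nonneg_nonneg less_imp_le)
    finally have pw: "(p * x) powr (1 / 2 - 1) = inverse (sqrt p) * inverse (sqrt x)"
      by (simp only: real_sqrt_mult inverse_mult_distrib)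
    have "sqrt p * ?g (0 + p * x) = sqrt p * ((p * x) powr (1 / 2 - 1) / exp (p * x))"
      using True assms by simp
    also have "\<dots> = (sqrt p * inverse (sqrt p)) * (inverse (sqrt x) * inverse (exp (p * x)))"
      unfolding pw by (simp only: divide_inverse mult.assoc)
    also have "\<dots> = exp (- p * x) * (1 / sqrt x)"
      using assms by (simp add: exp_minus divide_inverse)
    finally show ?thesis using True by simp
  next
    case False
    then show ?thesis using assms by (cases "x = 0") (auto simp: indicator_def zero_le_mult_iff)
  qed
  moreover have "sqrt p * (sqrt pi /\<^sub>R \<bar>p\<bar>) = sqrt (pi / p)"
    using assms by (simp add: real_sqrt_divide field_simps)
  ultimately have "has_bochner_integral lborel (\<lambda>x. indicator {0<..} x * (exp (- p * x) * (1 / sqrt x))) (sqrt (pi / p))"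
    by simp
  then have "has_bochner_integral lborel (\<lambda>x. complex_of_real (indicator {0<..} x * (exp (- p * x) * (1 / sqrt x)))) (of_real (sqrt (pi / p)))"
    by (rule has_bochner_integral_of_real)
  then show ?thesis unfolding has_laplace_def by (simp add: scaleR_conv_of_real)
qed

lemma sqrt_le_exp: "x \<ge> 0 \<Longrightarrow> sqrt x \<le> exp x"
proof -
  assume "x \<ge> 0"
  then have "sqrt x \<le> 1 + x"
    by (intro real_le_lsqrt) (auto simp: power2_eq_square algebra_simps)
  then show ?thesis using exp_ge_add_one_self[of x] by linarith
qed

lemma has_laplace_sqrt:
  assumes p: "p > 1"
  shows "has_laplace (\<lambda>x. of_real (sqrt x)) p (of_real (sqrt (pi / p) / (2 * p)))"
proof -
  have le: "norm (complex_of_real (sqrt x)) \<le> 1 * exp (1 * x)" if "x > 0" for x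
    using sqrt_le_exp[of x] that by simp
  obtain I where I: "has_laplace (\<lambda>x. of_real (sqrt x)) p I"
    by (rule has_laplace_exp_bounded[OF _ le p]) (auto intro!: continuous_intros)
  have "of_real (1 / 2) * of_real (sqrt (pi / p)) = of_real p * I - complex_of_real 0"
  proof (rule has_laplace_derivative[OF I has_laplace_cmult[OF has_laplace_inverse_sqrt] _ _ le p])
    fix x :: real assume x: "x > 0"
    have "(sqrt has_real_derivative (1 / 2 * (1 / sqrt x))) (at x)"
      using x by (auto intro!: derivative_eq_intros simp: field_simps)
    then show "((\<lambda>x. complex_of_real (sqrt x)) has_vector_derivative of_real (1 / 2) * of_real (1 / sqrt x)) (at x)"
      unfolding of_real_mult[symmetric] by (rule has_vector_derivative_of_real)
    show "isCont (\<lambda>x. of_real (1 / 2) * complex_of_real (1 / sqrt x)) x"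
      using x by (intro continuous_intros) auto
  next
    have "((\<lambda>x. complex_of_real (sqrt x)) \<longlongrightarrow> of_real (sqrt 0)) (at_right 0)"
      by (intro tendsto_intros)
    then show "((\<lambda>x. complex_of_real (sqrt x)) \<longlongrightarrow> of_real 0) (at_right 0)" by simp
  qed (use p in auto)
  then have "I = of_real (sqrt (pi / p) / (2 * p))" using p by (simp add: field_simps)
  with I show ?thesis by simp
qed

lemma erfc_has_field_derivative:
  "(erfc has_field_derivative (- (2 / of_real (sqrt pi)) * exp (- (z\<^sup>2)))) (at z)"
proof -
  obtain F where F: "\<And>z. (F has_field_derivative exp (- (z\<^sup>2))) (at z)"
    and eq: "\<And>z. erfc z = 1 - 2 / of_real (sqrt pi) * (F z - F 0)"
    using erfc_primitive by blast
  have "((\<lambda>z. 1 - 2 / of_real (sqrt pi) * (F z - F 0)) has_field_derivative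
     (0 - 2 / of_real (sqrt pi) * (exp (- (z\<^sup>2)) - 0))) (at z)"
    by (intro DERIV_diff DERIV_const DERIV_cmult F)
  moreover have "erfc = (\<lambda>z. 1 - 2 / of_real (sqrt pi) * (F z - F 0))" using eq by blast
  ultimately show ?thesis by simp
qed

lemma isCont_erfc: "isCont erfc z"
  using erfc_has_field_derivative by (rule DERIV_isCont)

lemma erfc_0 [simp]: "erfc 0 = 1"
  by (simp add: erfc_def)

text \<open>A crude bound that is valid in the whole plane. It grows too fast for small Laplace
  parameters, but large parameters are enough for the Tauberian theorem.\<close>

lemma norm_erfc_le: "norm (erfc z) \<le> 1 + 2 * norm z * exp ((norm z)\<^sup>2)"
proof -
  have "norm (contour_integral (linepath 0 z) (\<lambda>y. exp (- (y\<^sup>2)))) \<le> exp ((norm z)\<^sup>2) * norm (z - 0)"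
  proof (rule contour_integral_bound_linepath)
    show "(\<lambda>y. exp (- (y\<^sup>2))) contour_integrable_on linepath 0 z"
      by (intro contour_integrable_continuous_linepath continuous_intros)
    fix y assume y: "y \<in> closed_segment 0 z"
    have "norm (exp (- (y\<^sup>2))) \<le> exp (norm (- (y\<^sup>2)))" by (rule norm_exp)
    also have "\<dots> = exp ((norm y)\<^sup>2)" by (simp add: norm_power)
    also have "\<dots> \<le> exp ((norm z)\<^sup>2)"
      using segment_bound1[OF y] by (simp add: power_mono)
    finally show "norm (exp (- (y\<^sup>2))) \<le> exp ((norm z)\<^sup>2)" .
  qed simp
  moreover have "2 / sqrt pi \<le> 2"
    using pi_ge_two by (simp add: field_simps)
  ultimately have "2 / sqrt pi * norm (contour_integral (linepath 0 z) (\<lambda>y. exp (- (y\<^sup>2)))) \<le> 2 * (exp ((norm z)\<^sup>2) * norm z)"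
    by (intro mult_mono) auto
  moreover have "norm (erfc z) \<le> norm (1::complex) + norm (2 / of_real (sqrt pi) * contour_integral (linepath 0 z) (\<lambda>y. exp (- (y\<^sup>2))))"
    unfolding erfc_def by (rule norm_triangle_ineq4)
  ultimately show ?thesis by (simp add: norm_mult norm_divide mult_ac)
qed

text \<open>The building block of \<open>ell\<close>. It solves the linear differential equation
  \<open>E' = a\<^sup>2 E + a / sqrt (pi x)\<close> with \<open>E 0 = 1\<close>, so its Laplace transform can be read off from
  \<open>has_laplace_derivative\<close>.\<close>

definition exp_erfc :: "complex \<Rightarrow> real \<Rightarrow> complex" where
  "exp_erfc a x = exp (a\<^sup>2 * of_real x) * erfc (- a * of_real (sqrt x))"

lemma exp_erfc_deriv:
  assumes x: "x > 0"
  shows "(exp_erfc a has_vector_derivative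
     (a\<^sup>2 * exp_erfc a x + a / of_real (sqrt pi) * of_real (1 / sqrt x))) (at x)"
proof -
  have "(sqrt has_real_derivative (1 / (2 * sqrt x))) (at x)"
    using x by (auto intro!: derivative_eq_intros simp: field_simps)
  then have "((\<lambda>x. complex_of_real (sqrt x)) has_vector_derivative of_real (1 / (2 * sqrt x))) (at x)"
    by (rule has_vector_derivative_of_real)
  then have "((\<lambda>x. - a * complex_of_real (sqrt x)) has_vector_derivative (- a * of_real (1 / (2 * sqrt x)))) (at x)"
    by (rule has_vector_derivative_mult_right)
  from field_vector_diff_chain_at[OF this erfc_has_field_derivative]
  have d1: "((\<lambda>x. erfc (- a * complex_of_real (sqrt x))) has_vector_derivative
     (- a * of_real (1 / (2 * sqrt x))) * (- (2 / of_real (sqrt pi)) * exp (- ((- a * complex_of_real (sqrt x))\<^sup>2)))) (at x)"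
    by (simp add: o_def)
  have "((\<lambda>x. a\<^sup>2 * complex_of_real x) has_vector_derivative (a\<^sup>2 * of_real 1)) (at x)"
    by (intro has_vector_derivative_mult_right has_vector_derivative_of_real DERIV_ident)
  from field_vector_diff_chain_at[OF this DERIV_exp]
  have d2: "((\<lambda>x. exp (a\<^sup>2 * complex_of_real x)) has_vector_derivative a\<^sup>2 * exp (a\<^sup>2 * complex_of_real x)) (at x)"
    by (simp add: o_def)
  have sq: "(- a * complex_of_real (sqrt x))\<^sup>2 = a\<^sup>2 * of_real x"
    using x by (simp add: power_mult_distrib of_real_power[symmetric] del: of_real_power)
  have "exp (a\<^sup>2 * complex_of_real x) * exp (- (a\<^sup>2 * complex_of_real x)) = 1"
    by (simp add: exp_minus)
  then have c: "exp (a\<^sup>2 * complex_of_real x) * ((- a * of_real (1 / (2 * sqrt x))) * (- (2 / of_real (sqrt pi)) * exp (- (a\<^sup>2 * complex_of_real x))))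
     = a / of_real (sqrt pi) * of_real (1 / sqrt x)"
    using x by (simp add: field_simps)
  show ?thesis
    unfolding exp_erfc_def
    using has_vector_derivative_mult[OF d2 d1] unfolding sq c by (simp add: algebra_simps)
qed

lemma norm_exp_erfc_le:
  assumes x: "x \<ge> 0"
  shows "norm (exp_erfc a x) \<le> (1 + 2 * norm a) * exp ((2 * (norm a)\<^sup>2 + 1) * x)"
proof -
  define m where "m = norm a"
  have m: "m \<ge> 0" by (simp add: m_def)
  have "norm (exp_erfc a x) \<le> exp (m\<^sup>2 * x) * (1 + 2 * (m * sqrt x) * exp (m\<^sup>2 * x))"
    unfolding exp_erfc_def norm_mult
  proof (rule mult_mono)
    show "norm (exp (a\<^sup>2 * of_real x)) \<le> exp (m\<^sup>2 * x)"
      using norm_exp[of "a\<^sup>2 * of_real x"] x by (simp add: norm_mult norm_power m_def)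
    show "norm (erfc (- a * of_real (sqrt x))) \<le> 1 + 2 * (m * sqrt x) * exp (m\<^sup>2 * x)"
      using norm_erfc_le[of "- a * of_real (sqrt x)"] x by (simp add: norm_mult power_mult_distrib m_def)
  qed auto
  also have "\<dots> \<le> exp (m\<^sup>2 * x) * (exp (m\<^sup>2 * x) * exp x + 2 * (m * exp x) * exp (m\<^sup>2 * x))"
    using sqrt_le_exp[OF x] m x
    by (intro mult_left_mono add_mono mult_right_mono) (auto simp: exp_add[symmetric])
  also have "\<dots> = (1 + 2 * m) * exp ((2 * m\<^sup>2 + 1) * x)"
  proof -
    have "(2 * m\<^sup>2 + 1) * x = m\<^sup>2 * x + (m\<^sup>2 * x + x)" by (simp add: algebra_simps)
    then have e: "exp ((2 * m\<^sup>2 + 1) * x) = exp (m\<^sup>2 * x) * (exp (m\<^sup>2 * x) * exp x)"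
      by (simp only: exp_add)
    show ?thesis unfolding e by (simp only: distrib_left distrib_right mult_ac mult_1)
  qed
  finally show ?thesis by (simp add: m_def)
qed

lemma continuous_exp_erfc: "continuous_on UNIV (exp_erfc a)"
proof -
  have "continuous_on UNIV (\<lambda>x::real. erfc (- a * of_real (sqrt x)))"
    by (rule continuous_on_compose2[of UNIV erfc])
      (auto intro!: continuous_intros continuous_at_imp_continuous_on isCont_erfc)
  then show ?thesis unfolding exp_erfc_def by (intro continuous_intros)
qed

lemma exp_erfc_at_0: "(exp_erfc a \<longlongrightarrow> 1) (at_right 0)"
proof -
  have "isCont (exp_erfc a) 0" using continuous_exp_erfc[of a] by (simp add: continuous_on_eq_continuous_at)
  then have "(exp_erfc a \<longlongrightarrow> exp_erfc a 0) (at 0 within {0<..})"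
    unfolding isCont_def by (rule tendsto_within_subset) simp
  then show ?thesis by (simp add: exp_erfc_def)
qed

lemma isCont_exp_erfc: "isCont (exp_erfc a) x"
  using continuous_exp_erfc[of a] by (simp add: continuous_on_eq_continuous_at)

lemma sqrt_minus_nonzero:
  fixes a :: complex
  assumes "p > 2 * (norm a)\<^sup>2 + 1"
  shows "p > 1" "of_real (sqrt p) - a \<noteq> 0" "of_real p - a\<^sup>2 \<noteq> 0"
proof -
  show p: "p > 1" using assms by (smt (verit) zero_le_power2)
  have "(norm a)\<^sup>2 < p" using assms by (smt (verit) zero_le_power2)
  then have "norm a < sqrt p" by (rule real_less_rsqrt)
  then show "of_real (sqrt p) - a \<noteq> 0" using p
    by (metis abs_of_pos eq_iff_diff_eq_0 less_irrefl norm_of_real order_le_less_trans norm_ge_zero)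
  show "of_real p - a\<^sup>2 \<noteq> 0"
  proof
    assume "of_real p - a\<^sup>2 = 0"
    then have "norm (a\<^sup>2) = norm (complex_of_real p)" by simp
    then show False using \<open>(norm a)\<^sup>2 < p\<close> p by (simp add: norm_power)
  qed
qed

text \<open>The differential equation turns into \<open>(p - a\<^sup>2) I = 1 + a / sqrt p\<close>, and both sides are divisible
  by \<open>sqrt p + a\<close>.\<close>

lemma has_laplace_exp_erfc:
  assumes p: "p > 2 * (norm a)\<^sup>2 + 1"
  shows "has_laplace (exp_erfc a) p (1 / (of_real (sqrt p) * (of_real (sqrt p) - a)))"
proof -
  note nz = sqrt_minus_nonzero[OF p]
  obtain I where I: "has_laplace (exp_erfc a) p I"
    by (rule has_laplace_exp_bounded[OF continuous_on_subset[OF continuous_exp_erfc] _ p])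
      (auto intro: norm_exp_erfc_le)
  have "a\<^sup>2 * I + a / of_real (sqrt pi) * of_real (sqrt (pi / p)) = of_real p * I - 1"
    by (rule has_laplace_derivative[OF I has_laplace_add[OF has_laplace_cmult[OF I] has_laplace_cmult[OF has_laplace_inverse_sqrt]]
      exp_erfc_deriv _ norm_exp_erfc_le p exp_erfc_at_0])
      (use nz in \<open>auto intro!: continuous_intros isCont_exp_erfc\<close>)
  moreover have "a / of_real (sqrt pi) * of_real (sqrt (pi / p)) = a / of_real (sqrt p)"
    by (simp add: real_sqrt_divide)
  ultimately have eq: "(of_real p - a\<^sup>2) * I = 1 + a / of_real (sqrt p)"
    by (simp add: algebra_simps)
  define q where "q = complex_of_real (sqrt p)"
  have q: "q \<noteq> 0" "q\<^sup>2 = of_real p"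
    using nz by (simp_all add: q_def of_real_power[symmetric] del: of_real_power)
  have fac: "of_real p - a\<^sup>2 = (q - a) * (q + a)" unfolding q(2)[symmetric] by (simp add: power2_eq_square algebra_simps)
  have qa: "q - a \<noteq> 0" "q + a \<noteq> 0" using nz fac by (auto simp: q_def)
  have "(q - a) * (q + a) * I = (q + a) / q" using eq q unfolding fac q_def[symmetric] by (simp add: field_simps)
  then have "(q + a) * ((q - a) * I) = (q + a) * (1 / q)" by (simp add: mult_ac)
  then have "(q - a) * I = 1 / q" using mult_left_cancel[OF qa(2)] by blast
  then have "I = 1 / q / (q - a)" using qa(1) by (simp only: eq_divide_eq mult.commute) simp
  then have "I = 1 / (q * (q - a))" by simp
  with I show ?thesis by (simp add: q_def)
qed

text \<open>Needed for the case of a double root. The product \<open>x * E x\<close> satisfies the differential equation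
  of \<open>E\<close> with an additional inhomogeneous term \<open>E\<close>.\<close>

lemma has_laplace_ident_exp_erfc:
  assumes p: "p > 2 * (norm a)\<^sup>2 + 2"
  shows "has_laplace (\<lambda>x. of_real x * exp_erfc a x) p
     ((1 / (of_real (sqrt p) * (of_real (sqrt p) - a)) + a / (2 * of_real (sqrt p) ^ 3)) / (of_real p - a\<^sup>2))"
proof -
  have p': "p > 2 * (norm a)\<^sup>2 + 1" using p by simp
  note nz = sqrt_minus_nonzero[OF p']
  have le: "norm (of_real x * exp_erfc a x) \<le> (1 + 2 * norm a) * exp ((2 * (norm a)\<^sup>2 + 2) * x)" if x: "x > 0" for x
  proof -
    have "x \<le> exp x" using exp_ge_add_one_self[of x] by linarith
    then have "x * norm (exp_erfc a x) \<le> exp x * ((1 + 2 * norm a) * exp ((2 * (norm a)\<^sup>2 + 1) * x))"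
      using norm_exp_erfc_le[of x a] x by (intro mult_mono) auto
    also have "\<dots> = (1 + 2 * norm a) * exp ((2 * (norm a)\<^sup>2 + 2) * x)"
      by (simp add: exp_add[symmetric] algebra_simps)
    finally show ?thesis using x by (simp add: norm_mult)
  qed
  obtain I where I: "has_laplace (\<lambda>x. of_real x * exp_erfc a x) p I"
    by (rule has_laplace_exp_bounded[OF _ le p])
      (auto intro!: continuous_intros continuous_on_subset[OF continuous_exp_erfc])
  let ?J = "1 / (of_real (sqrt p) * (of_real (sqrt p) - a))"
  have "?J + (a\<^sup>2 * I + a / of_real (sqrt pi) * of_real (sqrt (pi / p) / (2 * p))) = of_real p * I - 0"
  proof (rule has_laplace_derivative[OF I has_laplace_add[OF has_laplace_exp_erfc[OF p'] has_laplace_add[OF has_laplace_cmult[OF I] has_laplace_cmult[OF has_laplace_sqrt]]]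
      _ _ le p])
    fix x :: real assume x: "x > 0"
    have "(complex_of_real has_vector_derivative of_real 1) (at x)"
      by (intro has_vector_derivative_of_real DERIV_ident)
    from has_vector_derivative_mult[OF this exp_erfc_deriv[OF x, of a]]
    have "((\<lambda>x. of_real x * exp_erfc a x) has_vector_derivative
       of_real x * (a\<^sup>2 * exp_erfc a x + a / of_real (sqrt pi) * of_real (1 / sqrt x)) + 1 * exp_erfc a x) (at x)"
      by simp
    moreover have "complex_of_real x * of_real (1 / sqrt x) = of_real (sqrt x)"
      unfolding of_real_mult[symmetric] using x by (simp add: real_div_sqrt)
    then have "of_real x * (a / of_real (sqrt pi) * of_real (1 / sqrt x)) = a / of_real (sqrt pi) * of_real (sqrt x)"
      by (metis mult.left_commute)
    then have "of_real x * (a\<^sup>2 * exp_erfc a x + a / of_real (sqrt pi) * of_real (1 / sqrt x)) + 1 * exp_erfc a x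
      = exp_erfc a x + (a\<^sup>2 * (of_real x * exp_erfc a x) + a / of_real (sqrt pi) * of_real (sqrt x))"
      by (simp only: distrib_left mult_1 mult.left_commute[of "of_real x" "a\<^sup>2"]) (simp only: add_ac)
    ultimately show "((\<lambda>x. of_real x * exp_erfc a x) has_vector_derivative
       exp_erfc a x + (a\<^sup>2 * (of_real x * exp_erfc a x) + a / of_real (sqrt pi) * of_real (sqrt x))) (at x)"
      by (simp only:)
    show "isCont (\<lambda>x. exp_erfc a x + (a\<^sup>2 * (of_real x * exp_erfc a x) + a / of_real (sqrt pi) * of_real (sqrt x))) x"
      by (intro continuous_intros isCont_exp_erfc)
  next
    have "((\<lambda>x. of_real x * exp_erfc a x) \<longlongrightarrow> of_real 0 * 1) (at_right 0)"
      by (intro tendsto_intros exp_erfc_at_0)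
    then show "((\<lambda>x. of_real x * exp_erfc a x) \<longlongrightarrow> 0) (at_right 0)" by simp
  qed (use nz in auto)
  moreover have "a / of_real (sqrt pi) * of_real (sqrt (pi / p) / (2 * p)) = a / (2 * of_real (sqrt p) ^ 3)"
  proof -
    have "sqrt p ^ 3 = sqrt p * p" using nz(1) by (simp add: power3_eq_cube)
    then have "complex_of_real (sqrt p) ^ 3 = of_real (sqrt p) * of_real p"
      by (metis of_real_mult of_real_power)
    then show ?thesis by (simp add: real_sqrt_divide)
  qed
  ultimately have "I * (of_real p - a\<^sup>2) = ?J + a / (2 * of_real (sqrt p) ^ 3)" by (simp add: algebra_simps)
  then have "I = (?J + a / (2 * of_real (sqrt p) ^ 3)) / (of_real p - a\<^sup>2)"
    using nz by (simp add: eq_divide_eq)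
  with I show ?thesis by simp
qed


definition exp_bounded :: "(real \<Rightarrow> complex) \<Rightarrow> bool" where
  "exp_bounded f \<longleftrightarrow> (\<exists>C s. C \<ge> 0 \<and> s \<ge> 0 \<and> (\<forall>x\<ge>0. norm (f x) \<le> C * exp (s * x)))"

lemma exp_bounded_add: "exp_bounded f \<Longrightarrow> exp_bounded g \<Longrightarrow> exp_bounded (\<lambda>x. f x + g x)"
proof -
  assume "exp_bounded f" "exp_bounded g"
  then obtain C s D r where f: "C \<ge> 0" "s \<ge> 0" "\<And>x. x \<ge> 0 \<Longrightarrow> norm (f x) \<le> C * exp (s * x)"
    and g: "D \<ge> 0" "r \<ge> 0" "\<And>x. x \<ge> 0 \<Longrightarrow> norm (g x) \<le> D * exp (r * x)"
    unfolding exp_bounded_def by blast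
  have "norm (f x + g x) \<le> (C + D) * exp ((s + r) * x)" if x: "x \<ge> 0" for x
  proof -
    have "C * exp (s * x) \<le> C * exp ((s + r) * x)" "D * exp (r * x) \<le> D * exp ((s + r) * x)"
      using f(1,2) g(1,2) x by (auto intro!: mult_left_mono mult_right_mono)
    then show ?thesis
      using norm_triangle_ineq[of "f x" "g x"] f(3)[OF x] g(3)[OF x] by (simp only: distrib_right)
  qed
  then show ?thesis using f(1,2) g(1,2) unfolding exp_bounded_def by (intro exI[of _ "C + D"] exI[of _ "s + r"]) auto
qed

lemma exp_bounded_mult: "exp_bounded f \<Longrightarrow> exp_bounded g \<Longrightarrow> exp_bounded (\<lambda>x. f x * g x)"
proof -
  assume "exp_bounded f" "exp_bounded g"
  then obtain C s D r where f: "C \<ge> 0" "s \<ge> 0" "\<And>x. x \<ge> 0 \<Longrightarrow> norm (f x) \<le> C * exp (s * x)"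
    and g: "D \<ge> 0" "r \<ge> 0" "\<And>x. x \<ge> 0 \<Longrightarrow> norm (g x) \<le> D * exp (r * x)"
    unfolding exp_bounded_def by blast
  have "norm (f x * g x) \<le> (C * D) * exp ((s + r) * x)" if x: "x \<ge> 0" for x
  proof -
    have "norm (f x) * norm (g x) \<le> (C * exp (s * x)) * (D * exp (r * x))"
      using f g x by (intro mult_mono) auto
    also have "\<dots> = (C * D) * exp ((s + r) * x)"
      by (simp only: distrib_right exp_add) (simp only: mult_ac)
    finally show ?thesis by (simp only: norm_mult)
  qed
  then show ?thesis using f(1,2) g(1,2) unfolding exp_bounded_def
    by (intro exI[of _ "C * D"] exI[of _ "s + r"]) auto
qed

lemma exp_bounded_const: "exp_bounded (\<lambda>x. c)"
  unfolding exp_bounded_def by (intro exI[of _ "norm c"] exI[of _ 0]) auto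

lemma exp_bounded_ident: "exp_bounded of_real"
proof -
  have "x \<le> exp x" for x :: real using exp_ge_add_one_self[of x] by linarith
  then have "norm (complex_of_real x) \<le> 1 * exp (1 * x)" if "x \<ge> 0" for x
    using that by simp
  then show ?thesis unfolding exp_bounded_def by (intro exI[of _ 1]) auto
qed

lemma exp_bounded_sqrt: "exp_bounded (\<lambda>x. of_real (sqrt x))"
proof -
  have "norm (complex_of_real (sqrt x)) \<le> 1 * exp (1 * x)" if "x \<ge> 0" for x
    using that sqrt_le_exp[of x] by simp
  then show ?thesis unfolding exp_bounded_def by (intro exI[of _ 1]) auto
qed

lemma exp_bounded_decay: "c \<ge> 0 \<Longrightarrow> exp_bounded (\<lambda>x. of_real (exp (- c * x)))"
  unfolding exp_bounded_def by (intro exI[of _ 1] exI[of _ 0]) auto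

lemma exp_bounded_exp_erfc: "exp_bounded (exp_erfc a)"
  unfolding exp_bounded_def using norm_exp_erfc_le[of _ a]
  by (intro exI[of _ "1 + 2 * norm a"] exI[of _ "2 * (norm a)\<^sup>2 + 1"]) auto

lemma ell_nondegenerate:
  assumes "1 / \<alpha>\<^sup>2 - w\<^sup>2 / 4 \<noteq> 0"
  defines "\<gamma> \<equiv> csqrt (of_real (1 / \<alpha>\<^sup>2 - w\<^sup>2 / 4))"
  shows "ell \<alpha> w = (\<lambda>x. of_real (exp (- (w\<^sup>2 / 4) * x)) * (1 / (2 * \<gamma>) *
     ((- 1 / of_real \<alpha> + \<gamma>) * exp_erfc (- 1 / of_real \<alpha> + \<gamma>) x +
      - (- 1 / of_real \<alpha> - \<gamma>) * exp_erfc (- 1 / of_real \<alpha> - \<gamma>) x)))"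
proof
  fix x
  define A1 where "A1 = - 1 / complex_of_real \<alpha> + \<gamma>"
  define A2 where "A2 = - 1 / complex_of_real \<alpha> - \<gamma>"
  have h: "- 2 / of_real \<alpha> + 2 * \<gamma> = 2 * A1" "- 2 / of_real \<alpha> - 2 * \<gamma> = 2 * A2"
    by (simp_all add: A1_def A2_def)
  have q: "2 * A / 2 = A" "(2 * A)\<^sup>2 / 4 = A\<^sup>2" for A :: complex by (simp_all add: power_mult_distrib)
  show "ell \<alpha> w x = of_real (exp (- (w\<^sup>2 / 4) * x)) * (1 / (2 * \<gamma>) *
     ((- 1 / of_real \<alpha> + \<gamma>) * exp_erfc (- 1 / of_real \<alpha> + \<gamma>) x +
      - (- 1 / of_real \<alpha> - \<gamma>) * exp_erfc (- 1 / of_real \<alpha> - \<gamma>) x))"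
    unfolding ell_def Let_def if_P[OF assms(1)] \<gamma>_def[symmetric] h A1_def[symmetric] A2_def[symmetric] q exp_erfc_def
    by (simp only: mult_minus_left diff_conv_add_uminus mult_ac)
qed

lemma ell_degenerate:
  assumes "1 / \<alpha>\<^sup>2 - w\<^sup>2 / 4 = 0" and "\<alpha> > 0"
  defines "a \<equiv> - 1 / complex_of_real \<alpha>"
  shows "ell \<alpha> w = (\<lambda>x. of_real (exp (- (w\<^sup>2 / 4) * x)) *
     (exp_erfc a x + (2 * a\<^sup>2 * (of_real x * exp_erfc a x) + 2 * a / of_real (sqrt pi) * of_real (sqrt x))))"
proof
  fix x
  have c: "\<not> (1 / \<alpha>\<^sup>2 - w\<^sup>2 / 4 \<noteq> 0)" using assms(1) by simp
  have sq: "a\<^sup>2 = of_real (1 / \<alpha>\<^sup>2)" by (simp add: a_def power_divide)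
  have ar: "complex_of_real (sqrt x / \<alpha>) = - a * of_real (sqrt x)" by (simp add: a_def)
  have ex: "complex_of_real (exp (x / \<alpha>\<^sup>2)) = exp (a\<^sup>2 * of_real x)"
    unfolding sq by (simp add: exp_of_real[symmetric])
  have "1 / 2 * (- 4 * of_real (sqrt x / (\<alpha> * sqrt pi)) + of_real ((4 * x / \<alpha>\<^sup>2 + 2) * exp (x / \<alpha>\<^sup>2)) * erfc (of_real (sqrt x / \<alpha>)))
    = exp_erfc a x + (2 * a\<^sup>2 * (of_real x * exp_erfc a x) + 2 * a / of_real (sqrt pi) * of_real (sqrt x))"
    unfolding of_real_mult[of "4 * x / \<alpha>\<^sup>2 + 2"] ex ar exp_erfc_def
    by (simp add: a_def field_simps power2_eq_square)
  then show "ell \<alpha> w x = of_real (exp (- (w\<^sup>2 / 4) * x)) *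
     (exp_erfc a x + (2 * a\<^sup>2 * (of_real x * exp_erfc a x) + 2 * a / of_real (sqrt pi) * of_real (sqrt x)))"
    unfolding ell_def if_not_P[OF c] by (simp only: mult.assoc mult.left_commute[of "1 / 2"])
qed

lemma ell_exp_bounded: "\<alpha> > 0 \<Longrightarrow> exp_bounded (ell \<alpha> w)"
  by (cases "1 / \<alpha>\<^sup>2 - w\<^sup>2 / 4 = 0")
    (simp_all only: ell_nondegenerate ell_degenerate not_False_eq_True,
      (intro exp_bounded_mult exp_bounded_add exp_bounded_const exp_bounded_ident exp_bounded_sqrt
        exp_bounded_exp_erfc exp_bounded_decay; simp)+)

lemma continuous_ell: "\<alpha> > 0 \<Longrightarrow> continuous_on UNIV (ell \<alpha> w)"
  by (cases "1 / \<alpha>\<^sup>2 - w\<^sup>2 / 4 = 0")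
    (simp_all only: ell_nondegenerate ell_degenerate not_False_eq_True,
      (intro continuous_intros continuous_exp_erfc)+)

text \<open>With \<open>q = sqrt (s + w\<^sup>2 / 4)\<close> the claimed transform is \<open>1 / ((q - A1) * (q - A2))\<close>, where \<open>A1\<close> and
  \<open>A2\<close> are the roots \<open>- 1 / \<alpha> \<plusminus> \<gamma>\<close>. For distinct roots this is a partial fraction decomposition
  into the transforms of \<open>exp_erfc A1\<close> and \<open>exp_erfc A2\<close>; for a double root the second-order term
  is the transform of a combination of \<open>exp_erfc a x\<close>, \<open>x * exp_erfc a x\<close> and \<open>sqrt x\<close>.\<close>

lemma has_laplace_ell:
  assumes "\<alpha> > 0"
  obtains s0 where "\<And>s. s > s0 \<Longrightarrow>
    has_laplace (ell \<alpha> w) s (of_real (1 / (s + w\<^sup>2 / 2 + 2 / \<alpha> * sqrt (s + w\<^sup>2 / 4))))"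
proof (cases "1 / \<alpha>\<^sup>2 - w\<^sup>2 / 4 = 0")
  case False
  define \<gamma> where "\<gamma> = csqrt (of_real (1 / \<alpha>\<^sup>2 - w\<^sup>2 / 4))"
  define A1 where "A1 = - 1 / complex_of_real \<alpha> + \<gamma>"
  define A2 where "A2 = - 1 / complex_of_real \<alpha> - \<gamma>"
  have \<gamma>: "\<gamma> \<noteq> 0" "\<gamma>\<^sup>2 = of_real (1 / \<alpha>\<^sup>2 - w\<^sup>2 / 4)"
  proof -
    show "\<gamma>\<^sup>2 = of_real (1 / \<alpha>\<^sup>2 - w\<^sup>2 / 4)" unfolding \<gamma>_def by (rule power2_csqrt)
    then show "\<gamma> \<noteq> 0" using False by (metis of_real_eq_0_iff zero_power2)
  qed
  show ?thesis
  proof (rule that)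
    fix s assume s: "s > (2 * (norm A1)\<^sup>2 + 1) + (2 * (norm A2)\<^sup>2 + 1)"
    define P where "P = s + w\<^sup>2 / 4"
    have "P \<ge> s" by (simp add: P_def)
    moreover have "0 \<le> (norm A1)\<^sup>2" "0 \<le> (norm A2)\<^sup>2" by simp_all
    ultimately have P: "P > 2 * (norm A1)\<^sup>2 + 1" "P > 2 * (norm A2)\<^sup>2 + 1" using s by linarith+
    define q where "q = complex_of_real (sqrt P)"
    have q: "q \<noteq> 0" "q - A1 \<noteq> 0" "q - A2 \<noteq> 0" "q\<^sup>2 = of_real P"
      using sqrt_minus_nonzero[OF P(1)] sqrt_minus_nonzero[OF P(2)]
      by (auto simp: q_def of_real_power[symmetric] simp del: of_real_power)
    have "has_laplace (\<lambda>x. 1 / (2 * \<gamma>) * (A1 * exp_erfc A1 x + - A2 * exp_erfc A2 x)) P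
      (1 / (2 * \<gamma>) * (A1 * (1 / (q * (q - A1))) + - A2 * (1 / (q * (q - A2)))))"
      unfolding q_def by (intro has_laplace_cmult has_laplace_add has_laplace_exp_erfc P)
    then have "has_laplace (ell \<alpha> w) s (1 / (2 * \<gamma>) * (A1 * (1 / (q * (q - A1))) + - A2 * (1 / (q * (q - A2)))))"
      unfolding ell_nondegenerate[OF False] \<gamma>_def[symmetric] A1_def[symmetric] A2_def[symmetric] P_def
      by (rule has_laplace_shift)
    moreover have "1 / (2 * \<gamma>) * (A1 * (1 / (q * (q - A1))) + - A2 * (1 / (q * (q - A2)))) = 1 / ((q - A1) * (q - A2))"
    proof -
      have "A1 * (1 / (q * (q - A1))) + - A2 * (1 / (q * (q - A2))) = (A1 * (q - A2) - A2 * (q - A1)) / (q * (q - A1) * (q - A2))"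
        using q by (simp add: divide_simps)
      also have "A1 * (q - A2) - A2 * (q - A1) = 2 * \<gamma> * q" by (simp add: A1_def A2_def algebra_simps)
      finally show ?thesis using q(1) \<gamma>(1) by (simp add: mult.assoc)
    qed
    moreover have "(q - A1) * (q - A2) = of_real (s + w\<^sup>2 / 2 + 2 / \<alpha> * sqrt (s + w\<^sup>2 / 4))"
    proof -
      have "(q - A1) * (q - A2) = q\<^sup>2 + 2 * q / of_real \<alpha> + (1 / (of_real \<alpha>)\<^sup>2 - \<gamma>\<^sup>2)"
        by (simp add: A1_def A2_def algebra_simps power2_eq_square add_divide_distrib)
      then show ?thesis unfolding q(4) \<gamma>(2) unfolding q_def P_def by simp
    qed
    ultimately show "has_laplace (ell \<alpha> w) s (of_real (1 / (s + w\<^sup>2 / 2 + 2 / \<alpha> * sqrt (s + w\<^sup>2 / 4))))"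
      by simp
  qed
next
  case True
  define a where "a = - 1 / complex_of_real \<alpha>"
  show ?thesis
  proof (rule that)
    fix s assume s: "s > 2 * (norm a)\<^sup>2 + 2"
    define P where "P = s + w\<^sup>2 / 4"
    have "P \<ge> s" by (simp add: P_def)
    then have P: "P > 2 * (norm a)\<^sup>2 + 2" "P > 2 * (norm a)\<^sup>2 + 1" using s by linarith+
    define q where "q = complex_of_real (sqrt P)"
    have q: "q \<noteq> 0" "q - a \<noteq> 0" "of_real P - a\<^sup>2 \<noteq> 0" "q\<^sup>2 = of_real P" and P1: "P > 1"
      using sqrt_minus_nonzero[OF P(2)] by (auto simp: q_def of_real_power[symmetric] simp del: of_real_power)
    have fac: "of_real P - a\<^sup>2 = (q - a) * (q + a)" unfolding q(4)[symmetric] by (simp add: power2_eq_square algebra_simps)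
    then have qa: "q + a \<noteq> 0" using q by auto
    let ?V = "1 / (q * (q - a)) + (2 * a\<^sup>2 * ((1 / (q * (q - a)) + a / (2 * q ^ 3)) / (of_real P - a\<^sup>2)) + 2 * a / of_real (sqrt pi) * of_real (sqrt (pi / P) / (2 * P)))"
    have "has_laplace (\<lambda>x. exp_erfc a x + (2 * a\<^sup>2 * (of_real x * exp_erfc a x) + 2 * a / of_real (sqrt pi) * of_real (sqrt x))) P ?V"
      unfolding q_def by (intro has_laplace_cmult has_laplace_add has_laplace_exp_erfc has_laplace_ident_exp_erfc has_laplace_sqrt P P1)
    then have "has_laplace (ell \<alpha> w) s ?V"
      unfolding ell_degenerate[OF True \<open>\<alpha> > 0\<close>] a_def[symmetric] P_def by (rule has_laplace_shift)
    moreover have "?V = 1 / ((q - a) * (q - a))"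
    proof -
      have sq3: "2 * a / of_real (sqrt pi) * of_real (sqrt (pi / P) / (2 * P)) = a / q ^ 3"
      proof -
        have "q ^ 3 = q * of_real P" unfolding q(4)[symmetric] by (simp add: power3_eq_cube power2_eq_square)
        then show ?thesis by (simp add: q_def real_sqrt_divide)
      qed
      show ?thesis unfolding sq3 fac using q(1,2) qa by (simp add: divide_simps) algebra
    qed
    moreover have "(q - a) * (q - a) = of_real (s + w\<^sup>2 / 2 + 2 / \<alpha> * sqrt (s + w\<^sup>2 / 4))"
    proof -
      have "(q - a) * (q - a) = q\<^sup>2 + 2 * q / of_real \<alpha> + of_real (1 / \<alpha>\<^sup>2)"
        by (simp add: a_def algebra_simps power2_eq_square add_divide_distrib)
      moreover have "1 / \<alpha>\<^sup>2 = w\<^sup>2 / 4" using True by simp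
      ultimately show ?thesis unfolding q(4) by (simp add: q_def P_def)
    qed
    ultimately show "has_laplace (ell \<alpha> w) s (of_real (1 / (s + w\<^sup>2 / 2 + 2 / \<alpha> * sqrt (s + w\<^sup>2 / 4))))"
      by simp
  qed
qed

section \<open>Levy's continuity theorem in the plane\<close>

abbreviation outside_square :: "real \<Rightarrow> (real \<times> real) set" where
  "outside_square L \<equiv> {p. \<bar>fst p\<bar> > L \<or> \<bar>snd p\<bar> > L}"

inductive trig_poly :: "(real \<times> real \<Rightarrow> complex) \<Rightarrow> bool" where
  wave: "trig_poly (\<lambda>p. c * iexp (s * fst p + t * snd p))"
| add: "trig_poly f \<Longrightarrow> trig_poly g \<Longrightarrow> trig_poly (\<lambda>p. f p + g p)"

lemma trig_poly_mult:
  assumes "trig_poly f" "trig_poly g"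
  shows "trig_poly (\<lambda>p. f p * g p)"
  using assms(1)
proof induction
  case (wave c s t)
  from assms(2) show ?case
  proof induction
    case (wave d s' t')
    have "(\<lambda>p. c * iexp (s * fst p + t * snd p) * (d * iexp (s' * fst p + t' * snd p)))
       = (\<lambda>p. (c * d) * iexp ((s + s') * fst p + (t + t') * snd p))"
      by (rule ext) (simp add: exp_add[symmetric] algebra_simps)
    then show ?case by (simp only: trig_poly.wave)
  next
    case (add f g)
    show ?case unfolding distrib_left by (rule trig_poly.add) (rule add.IH)+
  qed
next
  case (add f h)
  show ?case unfolding distrib_right by (rule trig_poly.add) (rule add.IH)+
qed

lemma trig_poly_const: "trig_poly (\<lambda>p. c)"
  using trig_poly.wave[of c 0 0] by simp

lemma trig_poly_cmult: "trig_poly f \<Longrightarrow> trig_poly (\<lambda>p. c * f p)"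
  by (rule trig_poly_mult[OF trig_poly_const])

lemma trig_poly_cos: "trig_poly (\<lambda>p. of_real (cos (s * fst p + t * snd p)))"
proof -
  have "(\<lambda>p. complex_of_real (cos (s * fst p + t * snd p))) =
    (\<lambda>p. (1 / 2) * iexp (s * fst p + t * snd p) + (1 / 2) * iexp ((- s) * fst p + (- t) * snd p))"
    unfolding cis_conv_exp[symmetric] by (auto simp: fun_eq_iff complex_eq_iff cos_diff cos_add sin_diff sin_add field_simps)
  then show ?thesis by (simp only:) (intro trig_poly.intros)
qed

lemma trig_poly_sin: "trig_poly (\<lambda>p. of_real (sin (s * fst p + t * snd p)))"
proof -
  have "(\<lambda>p. complex_of_real (sin (s * fst p + t * snd p))) =
    (\<lambda>p. of_real (cos (s * fst p + t * snd p)) * \<i> + (- \<i>) * iexp (s * fst p + t * snd p))"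
    unfolding cis_conv_exp[symmetric] by (auto simp: fun_eq_iff complex_eq_iff)
  then show ?thesis
    by (simp only:) (intro trig_poly.intros trig_poly_mult trig_poly_cos trig_poly_const)
qed

lemma trig_poly_continuous: "trig_poly f \<Longrightarrow> continuous_on UNIV f"
  by (induction rule: trig_poly.induct) (intro continuous_intros; simp)+

lemma trig_poly_bounded: "trig_poly f \<Longrightarrow> \<exists>B. \<forall>p. norm (f p) \<le> B"
proof (induction rule: trig_poly.induct)
  case (wave c s t)
  have "norm (c * iexp (s * fst p + t * snd p)) = norm c" for p :: "real \<times> real"
    unfolding norm_mult norm_exp_i_times by simp
  then show ?case by auto
next
  case (add f g)
  then obtain B C where "\<And>p. norm (f p) \<le> B" "\<And>p. norm (g p) \<le> C" by auto
  then have "norm (f p + g p) \<le> B + C" for p by (meson add_mono norm_triangle_ineq order_trans)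
  then show ?case by blast
qed

lemma integrable_bounded_continuous:
  fixes f :: "real \<times> real \<Rightarrow> 'b :: {banach, second_countable_topology}"
  assumes "prob_space M" "sets M = sets borel" "continuous_on UNIV f" "\<And>p. norm (f p) \<le> B"
  shows "integrable M f"
proof -
  interpret prob_space M by fact
  have "f \<in> borel_measurable M"
    unfolding measurable_cong_sets[OF assms(2) refl] by (rule borel_measurable_continuous_onI[OF assms(3)])
  then show ?thesis using assms(4) by (intro integrable_const_bound[of _ B]) auto
qed

lemma trig_poly_integrable:
  assumes "prob_space M" "sets M = sets borel" "trig_poly f"
  shows "integrable M f"
  using integrable_bounded_continuous[OF assms(1,2) trig_poly_continuous[OF assms(3)]] trig_poly_bounded[OF assms(3)] by blast

lemma trig_poly_tendsto:
  assumes \<mu>: "\<And>n. prob_space (\<mu> n)" "\<And>n. sets (\<mu> n) = sets borel"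
    and \<nu>: "prob_space \<nu>" "sets \<nu> = sets borel"
    and conv: "\<And>s t. (\<lambda>n. fourier2 (\<mu> n) s t) \<longlonglongrightarrow> fourier2 \<nu> s t"
    and "trig_poly f"
  shows "(\<lambda>n. \<integral>p. f p \<partial>\<mu> n) \<longlonglongrightarrow> (\<integral>p. f p \<partial>\<nu>)"
  using \<open>trig_poly f\<close>
proof induction
  case (wave c s t)
  have "(\<lambda>n. c * fourier2 (\<mu> n) s t) \<longlonglongrightarrow> c * fourier2 \<nu> s t"
    by (intro tendsto_intros conv)
  then show ?case unfolding fourier2_def by (simp only: integral_mult_right_zero)
next
  case (add f g)
  then show ?case
    using trig_poly_integrable[OF \<mu>] trig_poly_integrable[OF \<nu>]
    by (simp add: Bochner_Integration.integral_add tendsto_add)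
qed

definition torus_map :: "real \<Rightarrow> real \<times> real \<Rightarrow> complex \<times> complex" where
  "torus_map c p = (cis (c * fst p), cis (c * snd p))"

text \<open>A polynomial in the real and imaginary parts of \<open>exp (\<i> c x)\<close> and \<open>exp (\<i> c y)\<close> is a combination of
  waves, by the Euler formulas.\<close>

lemma trig_poly_torus_map:
  fixes q :: "complex \<times> complex \<Rightarrow> real"
  assumes "real_polynomial_function q"
  shows "trig_poly (\<lambda>p. of_real (q (torus_map c p)))"
  using assms
proof induction
  case (linear f)
  interpret bounded_linear f by fact
  have lin: "f (z1, z2) = f (1, 0) * Re z1 + f (\<i>, 0) * Im z1 + f (0, 1) * Re z2 + f (0, \<i>) * Im z2" for z1 z2
  proof -
    have "(z1, z2) = Re z1 *\<^sub>R (1, 0) + Im z1 *\<^sub>R (\<i>, 0) + Re z2 *\<^sub>R (0, 1) + Im z2 *\<^sub>R (0, \<i>)"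
      by (simp add: complex_eq_iff)
    then have "f (z1, z2) = f (Re z1 *\<^sub>R (1, 0) + Im z1 *\<^sub>R (\<i>, 0) + Re z2 *\<^sub>R (0, 1) + Im z2 *\<^sub>R (0, \<i>))"
      by (rule arg_cong)
    also have "\<dots> = f (1, 0) * Re z1 + f (\<i>, 0) * Im z1 + f (0, 1) * Re z2 + f (0, \<i>) * Im z2"
      unfolding add scaleR by (simp add: mult.commute)
    finally show ?thesis .
  qed
  have eq: "(\<lambda>p. complex_of_real (f (torus_map c p))) =
     (\<lambda>p. of_real (f (1, 0)) * of_real (cos (c * fst p + 0 * snd p)) + of_real (f (\<i>, 0)) * of_real (sin (c * fst p + 0 * snd p))
        + of_real (f (0, 1)) * of_real (cos (0 * fst p + c * snd p)) + of_real (f (0, \<i>)) * of_real (sin (0 * fst p + c * snd p)))"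
    by (rule ext, unfold torus_map_def, subst lin) simp
  show ?case unfolding eq
    by (intro trig_poly.add trig_poly_cmult trig_poly_cos trig_poly_sin)
next
  case (const c)
  show ?case by (rule trig_poly_const)
next
  case (add f g)
  show ?case unfolding of_real_add by (rule trig_poly.add) (rule add.IH)+
next
  case (mult f g)
  show ?case unfolding of_real_mult by (rule trig_poly_mult) (rule mult.IH)+
qed

text \<open>The square of side \<open>2 L\<close> is wrapped onto part of a torus. It covers only half of each circle, so the
  wrapping is injective and \<open>f\<close> becomes a continuous function on a compact subset of the torus. The
  Tietze theorem extends it without increasing its bound, and the Stone-Weierstrass theorem
  approximates the extension by a polynomial. Because the approximation is uniform on the whole
  torus, the resulting trigonometric polynomial stays bounded on the whole plane.\<close>

lemma trig_poly_approx:
  fixes f :: "real \<times> real \<Rightarrow> real"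
  assumes f: "continuous_on UNIV f" and B: "\<And>p. \<bar>f p\<bar> \<le> B" and L: "L > 0" and e: "e > 0"
  obtains h where "trig_poly (\<lambda>p. of_real (h p))" "\<And>p. \<bar>h p\<bar> \<le> B + e"
    "\<And>p. \<bar>fst p\<bar> \<le> L \<Longrightarrow> \<bar>snd p\<bar> \<le> L \<Longrightarrow> \<bar>f p - h p\<bar> < e"
proof -
  define c where "c = pi / (2 * L)"
  define K where "K = {- L..L} \<times> {- L..L}"
  have K: "compact K" unfolding K_def by (intro compact_Times compact_Icc)
  have cis_inj: "x = y" if "cis (c * x) = cis (c * y)" "x \<in> {- L..L}" "y \<in> {- L..L}" for x y
  proof -
    have "c > 0" "c * L = pi / 2" using L by (simp_all add: c_def)
    then have b: "\<bar>c * u\<bar> \<le> pi / 2" if "u \<in> {- L..L}" for u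
    proof -
      have "c * \<bar>u\<bar> \<le> c * L" using that \<open>c > 0\<close> by (intro mult_left_mono) auto
      then show ?thesis using \<open>c > 0\<close> \<open>c * L = pi / 2\<close> by (simp add: abs_mult)
    qed
    have sin_eq: "sin (c * x) = sin (c * y)" using that(1) by (metis cis.simps(2))
    have bd: "- (pi / 2) \<le> c * x" "c * x \<le> pi / 2" "- (pi / 2) \<le> c * y" "c * y \<le> pi / 2"
      using b[OF that(2)] b[OF that(3)] by linarith+
    have "c * x = c * y" by (rule sin_inj_pi[OF bd sin_eq])
    then show ?thesis using \<open>c > 0\<close> by simp
  qed
  have inj: "inj_on (torus_map c) K"
    unfolding inj_on_def K_def torus_map_def using cis_inj by auto
  have cont: "continuous_on A (torus_map c)" for A
    unfolding torus_map_def by (intro continuous_intros)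
  have "continuous_on (torus_map c ` K) (\<lambda>z. f (the_inv_into K (torus_map c) z))"
    by (rule continuous_on_compose2[OF f continuous_on_inv_into[OF cont K inj]]) auto
  moreover have "closedin (top_of_set UNIV) (torus_map c ` K)"
    using compact_continuous_image[OF cont K] by (simp add: compact_imp_closed)
  moreover have "0 \<le> B" using order_trans[OF abs_ge_zero B] by blast
  ultimately obtain g where g: "continuous_on UNIV g" "\<And>z. z \<in> torus_map c ` K \<Longrightarrow> g z = f (the_inv_into K (torus_map c) z)"
    "\<And>z. norm (g z) \<le> B"
    using Tietze[of "torus_map c ` K" "\<lambda>z. f (the_inv_into K (torus_map c) z)" UNIV B] B by auto
  define T where "T = cball (0::complex) 1 \<times> cball (0::complex) 1"
  obtain q where q: "real_polynomial_function q" "\<And>z. z \<in> T \<Longrightarrow> \<bar>g z - q z\<bar> < e"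
    using Stone_Weierstrass_real_polynomial_function[of T g e] e continuous_on_subset[OF g(1)]
    unfolding T_def by (auto simp: compact_Times)
  have T: "torus_map c p \<in> T" for p by (simp add: torus_map_def T_def)
  show ?thesis
  proof (rule that)
    show "trig_poly (\<lambda>p. of_real (q (torus_map c p)))" by (rule trig_poly_torus_map[OF q(1)])
    show "\<bar>q (torus_map c p)\<bar> \<le> B + e" for p
      using q(2)[OF T[of p]] g(3)[of "torus_map c p"] unfolding real_norm_def by linarith
    show "\<bar>f p - q (torus_map c p)\<bar> < e" if "\<bar>fst p\<bar> \<le> L" "\<bar>snd p\<bar> \<le> L" for p
    proof -
      have "p \<in> K" using that by (cases p) (auto simp: K_def abs_le_iff)
      then have "g (torus_map c p) = f p" using g(2) the_inv_into_f_f[OF inj] by simp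
      then show ?thesis using q(2)[OF T[of p]] by simp
    qed
  qed
qed

lemma outside_square_borel [measurable]: "outside_square l \<in> sets borel"
  by (intro borel_open open_Collect_disj open_Collect_less continuous_intros)

lemma outside_square_small:
  fixes \<nu> :: "(real \<times> real) measure"
  assumes "prob_space \<nu>" "sets \<nu> = sets borel" "e > 0"
  shows "\<exists>L>0. measure \<nu> (outside_square L) < (e::real)"
proof -
  interpret prob_space \<nu> by fact
  define A where "A k = {p :: real \<times> real. \<bar>fst p\<bar> > real k \<or> \<bar>snd p\<bar> > real k}" for k
  have "open (A k)" for k
    unfolding A_def by (intro open_Collect_disj open_Collect_less continuous_intros)
  then have "range A \<subseteq> sets \<nu>" using assms(2) by auto
  moreover have "decseq A"
    unfolding A_def decseq_def by (fastforce)
  ultimately have "(\<lambda>k. measure \<nu> (A k)) \<longlonglongrightarrow> measure \<nu> (\<Inter>k. A k)"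
    by (rule finite_Lim_measure_decseq)
  moreover have "(\<Inter>k. A k) = {}"
  proof -
    have "p \<notin> A (nat \<lceil>max \<bar>fst p\<bar> \<bar>snd p\<bar>\<rceil>)" for p
    proof -
      define k where "k = nat \<lceil>max \<bar>fst p\<bar> \<bar>snd p\<bar>\<rceil>"
      have "max \<bar>fst p\<bar> \<bar>snd p\<bar> \<le> real k" unfolding k_def by (rule real_nat_ceiling_ge)
      then have "p \<notin> A k" unfolding A_def by (simp add: not_less)
      then show ?thesis unfolding k_def .
    qed
    then show ?thesis by blast
  qed
  ultimately have "(\<lambda>k. measure \<nu> (A k)) \<longlonglongrightarrow> 0" by simp
  then have "\<forall>\<^sub>F k in sequentially. measure \<nu> (A k) < e" using \<open>e > 0\<close> by (rule order_tendstoD(2))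
  then obtain k where k: "measure \<nu> (A k) < e" "k > 0"
    by (metis (mono_tags, lifting) eventually_gt_at_top eventually_conj eventually_happens trivial_limit_sequentially)
  show ?thesis using k unfolding A_def by (intro exI[of _ "real k"]) auto
qed

text \<open>Outside a large square both the test function and its trigonometric approximation are bounded and
  all the laws have little mass; inside the square they are close. For the trigonometric
  polynomial itself convergence is a finite combination of the assumed convergences.\<close>

theorem levy_continuity_plane:
  fixes \<mu> :: "nat \<Rightarrow> (real \<times> real) measure"
  assumes \<mu>: "\<And>n. prob_space (\<mu> n)" "\<And>n. sets (\<mu> n) = sets borel"
    and \<nu>: "prob_space \<nu>" "sets \<nu> = sets borel"
    and tight: "\<And>e. e > 0 \<Longrightarrow> \<exists>L. \<forall>n. measure (\<mu> n) (outside_square L) < (e::real)"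
    and conv: "\<And>s t. (\<lambda>n. fourier2 (\<mu> n) s t) \<longlonglongrightarrow> fourier2 \<nu> s t"
  shows "weakly_converges \<mu> \<nu>"
  unfolding weakly_converges_def
proof (intro allI impI, elim conjE)
  fix f :: "real \<times> real \<Rightarrow> real" assume f: "continuous_on UNIV f" and "bounded (range f)"
  then obtain B where B: "\<And>p. \<bar>f p\<bar> \<le> B" by (auto simp: bounded_iff)
  then have B0: "B \<ge> 0" using order_trans[OF abs_ge_zero B] by blast
  show "(\<lambda>n. \<integral>p. f p \<partial>\<mu> n) \<longlonglongrightarrow> (\<integral>p. f p \<partial>\<nu>)"
  proof (rule LIMSEQ_I)
    fix \<epsilon> :: real assume "\<epsilon> > 0"
    define e where "e = min 1 (\<epsilon> / (4 * (2 * B + 2)))"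
    have e: "e > 0" "e \<le> 1"
      using \<open>\<epsilon> > 0\<close> B0 by (auto simp: e_def)
    have "e * (2 * B + 2) \<le> \<epsilon> / (4 * (2 * B + 2)) * (2 * B + 2)"
      using B0 by (intro mult_right_mono) (auto simp: e_def)
    also have "\<dots> = \<epsilon> / 4" using B0 by (simp add: field_simps)
    finally have e2: "e * (2 * B + 2) \<le> \<epsilon> / 4" .
    obtain L1 where L1: "\<And>n. measure (\<mu> n) (outside_square L1) < e" using tight[OF e(1)] by blast
    obtain L2 where L2: "L2 > 0" "measure \<nu> (outside_square L2) < e"
      using outside_square_small[OF \<nu> e(1)] by blast
    define L where "L = max L1 L2"
    have L: "L > 0" using L2 by (simp add: L_def)
    define A where "A = outside_square L"
    have A: "A \<in> sets borel" unfolding A_def by (rule outside_square_borel)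
    have sub: "A \<subseteq> outside_square l" if "l \<le> L" for l using that by (auto simp: A_def)
    obtain h where h: "trig_poly (\<lambda>p. of_real (h p))" "\<And>p. \<bar>h p\<bar> \<le> B + e"
      "\<And>p. \<bar>fst p\<bar> \<le> L \<Longrightarrow> \<bar>snd p\<bar> \<le> L \<Longrightarrow> \<bar>f p - h p\<bar> < e"
      using trig_poly_approx[OF f B L e(1)] by blast
    have hc: "continuous_on UNIV h"
      using continuous_on_Re[OF trig_poly_continuous[OF h(1)]] by simp
    have close: "\<bar>(\<integral>p. f p \<partial>M) - (\<integral>p. h p \<partial>M)\<bar> \<le> \<epsilon> / 4"
      if M: "prob_space M" "sets M = sets borel" and small: "measure M A \<le> e" for M
    proof -
      interpret prob_space M by fact
      have AM: "A \<in> sets M" using A M(2) by simp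
      have fi: "integrable M f" by (rule integrable_bounded_continuous[OF M f]) (use B in simp)
      have hi: "integrable M h" by (rule integrable_bounded_continuous[OF M hc]) (use h(2) in simp)
      have "\<bar>f p - h p\<bar> \<le> e + (2 * B + 1) * indicator A p" for p
      proof (cases "p \<in> A")
        case True
        then show ?thesis using B[of p] h(2)[of p] e by simp
      next
        case False
        then show ?thesis using h(3)[of p] by (auto simp: A_def not_less)
      qed
      then have "(\<integral>p. \<bar>f p - h p\<bar> \<partial>M) \<le> (\<integral>p. e + (2 * B + 1) * indicator A p \<partial>M)"
        using fi hi AM by (intro integral_mono) (auto simp: emeasure_eq_measure)
      also have "\<dots> = e + (2 * B + 1) * measure M A"
        using AM by (simp add: emeasure_eq_measure prob_space)
      also have "\<dots> \<le> e + (2 * B + 1) * e" using small B0 by (intro add_left_mono mult_left_mono) auto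
      also have "\<dots> = e * (2 * B + 2)" by (simp add: algebra_simps)
      also note e2
      finally have "(\<integral>p. \<bar>f p - h p\<bar> \<partial>M) \<le> \<epsilon> / 4" .
      moreover have "\<bar>(\<integral>p. f p \<partial>M) - (\<integral>p. h p \<partial>M)\<bar> \<le> (\<integral>p. \<bar>f p - h p\<bar> \<partial>M)"
        using integral_norm_bound[of M "\<lambda>p. f p - h p"] fi hi by simp
      ultimately show ?thesis by linarith
    qed
    have small: "measure (\<mu> n) A \<le> e" for n
    proof -
      interpret prob_space "\<mu> n" by (rule \<mu>)
      have "measure (\<mu> n) A \<le> measure (\<mu> n) (outside_square L1)"
        using \<mu>(2)[of n] outside_square_borel by (intro finite_measure_mono sub) (auto simp: L_def)
      then show ?thesis using L1[of n] by simp
    qed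
    have small': "measure \<nu> A \<le> e"
    proof -
      interpret prob_space \<nu> by (rule \<nu>)
      have "measure \<nu> A \<le> measure \<nu> (outside_square L2)"
        using \<nu>(2) outside_square_borel by (intro finite_measure_mono sub) (auto simp: L_def)
      then show ?thesis using L2 by simp
    qed
    have "(\<lambda>n. \<integral>p. complex_of_real (h p) \<partial>\<mu> n) \<longlonglongrightarrow> (\<integral>p. of_real (h p) \<partial>\<nu>)"
      by (rule trig_poly_tendsto[OF \<mu> \<nu> conv h(1)])
    then have "(\<lambda>n. \<integral>p. h p \<partial>\<mu> n) \<longlonglongrightarrow> (\<integral>p. h p \<partial>\<nu>)"
      by (simp add: tendsto_of_real_iff)
    then obtain N where N: "\<And>n. n \<ge> N \<Longrightarrow> \<bar>(\<integral>p. h p \<partial>\<mu> n) - (\<integral>p. h p \<partial>\<nu>)\<bar> < \<epsilon> / 4"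
      using LIMSEQ_D[of _ _ "\<epsilon> / 4"] \<open>\<epsilon> > 0\<close> by fastforce
    have "norm ((\<integral>p. f p \<partial>\<mu> n) - (\<integral>p. f p \<partial>\<nu>)) < \<epsilon>" if "n \<ge> N" for n
      using N[OF that] close[OF \<mu> small, of n] close[OF \<nu> small'] \<open>\<epsilon> > 0\<close> unfolding real_norm_def by linarith
    then show "\<exists>N. \<forall>n\<ge>N. norm ((\<integral>p. f p \<partial>\<mu> n) - (\<integral>p. f p \<partial>\<nu>)) < \<epsilon>" by blast
  qed
qed

section \<open>Weak limits of tight laws in the plane\<close>

lemma cos_plus_of_nat_mult_two_pi: "cos (x + real m * (2 * pi)) = cos x"
proof -
  have "real m * (2 * pi) = 2 * real m * pi" by simp
  then show ?thesis unfolding cos_add by (simp only: cos_2npi sin_2npi mult_1_right mult_zero_right diff_0_right)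
qed

text \<open>A continuous function of period 2 with the plateau 0 on \<open>[0, 1/3]\<close> and the plateau 1 on
  \<open>[2/3, 1]\<close>. It reads off the first ternary digit of a number with digits 0 and 2 only.\<close>

definition plateau_wave :: "real \<Rightarrow> real" where
  "plateau_wave t = max 0 (min 1 (1 / 2 - cos (pi * t)))"

lemma plateau_wave_period: "plateau_wave (t + 2 * of_nat m) = plateau_wave t"
proof -
  have "pi * (t + 2 * of_nat m) = pi * t + of_nat m * (2 * pi)" by (simp add: algebra_simps)
  then show ?thesis unfolding plateau_wave_def by (simp only: cos_plus_of_nat_mult_two_pi)
qed

lemma plateau_wave_0: "0 \<le> t \<Longrightarrow> t \<le> 1 / 3 \<Longrightarrow> plateau_wave t = 0"
  using cos_monotone_0_pi_le[of "pi * t" "pi / 3"] by (simp add: plateau_wave_def cos_60)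

lemma plateau_wave_1:
  assumes "2 / 3 \<le> t" "t \<le> 1"
  shows "plateau_wave t = 1"
proof -
  have "cos (2 / 3 * pi) = cos (pi - pi / 3)" by (rule arg_cong[of _ _ cos]) simp
  then have "cos (2 / 3 * pi) = - 1 / 2" by (simp only: cos_pi_minus cos_60 minus_divide_left)
  moreover have "cos (pi * t) \<le> cos (2 / 3 * pi)"
    using assms by (intro cos_monotone_0_pi_le) (auto simp: mult.commute)
  ultimately show ?thesis by (simp add: plateau_wave_def)
qed

lemma plateau_wave_01: "0 \<le> plateau_wave t" "plateau_wave t \<le> 1"
  by (auto simp: plateau_wave_def)

definition ternary :: "(nat \<Rightarrow> nat) \<Rightarrow> real" where
  "ternary d = (\<Sum>j. 2 * real (d j) / 3 ^ Suc j)"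

lemma ternary_summable:
  assumes "\<And>j. d j \<le> 1"
  shows "summable (\<lambda>j. 2 * real (d j) / 3 ^ Suc j)"
proof (rule summable_comparison_test')
  show "summable (\<lambda>j. 2 / 3 * (1 / 3) ^ j :: real)" by (intro summable_mult summable_geometric) simp
  show "norm (2 * real (d j) / 3 ^ Suc j) \<le> 2 / 3 * (1 / 3) ^ j" if "j \<ge> 0" for j
    using assms[of j] by (simp add: power_divide divide_right_mono)
qed

lemma ternary_bounds:
  assumes "\<And>j. d j \<le> 1"
  shows "0 \<le> ternary d" "ternary d \<le> 1"
proof -
  show "0 \<le> ternary d" unfolding ternary_def by (intro suminf_nonneg ternary_summable assms) simp
  have "ternary d \<le> (\<Sum>j. 2 / 3 * (1 / 3) ^ j)"
    unfolding ternary_def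
  proof (intro suminf_le ternary_summable assms)
    show "2 * real (d j) / 3 ^ Suc j \<le> 2 / 3 * (1 / 3) ^ j" for j
      using assms[of j] by (simp add: power_divide divide_right_mono)
    show "summable (\<lambda>j. 2 / 3 * (1 / 3) ^ j :: real)" by (intro summable_mult summable_geometric) simp
  qed
  also have "\<dots> = 1" by (subst suminf_mult) (auto simp: suminf_geometric summable_geometric)
  finally show "ternary d \<le> 1" .
qed

lemma ternary_Suc:
  assumes "\<And>j. d j \<le> 1"
  shows "3 * ternary d = 2 * real (d 0) + ternary (\<lambda>j. d (Suc j))"
proof -
  have "ternary d = (\<Sum>j. 2 * real (d (Suc j)) / 3 ^ Suc (Suc j)) + 2 * real (d 0) / 3 ^ Suc 0"
    unfolding ternary_def by (rule suminf_split_head[symmetric, unfolded eq_diff_eq diff_eq_eq]) (rule ternary_summable[OF assms])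
  also have "(\<Sum>j. 2 * real (d (Suc j)) / 3 ^ Suc (Suc j)) = (\<Sum>j. 1 / 3 * (2 * real (d (Suc j)) / 3 ^ Suc j))"
    by (intro suminf_cong) simp
  also have "\<dots> = 1 / 3 * ternary (\<lambda>j. d (Suc j))"
    unfolding ternary_def by (rule suminf_mult[OF ternary_summable]) (rule assms)
  finally show ?thesis by simp
qed

text \<open>Multiplying by a power of 3 shifts the digits. The integer part produced in this way is even, so
  a function of period 2 does not see it.\<close>

lemma ternary_shift:
  assumes "\<And>j. d j \<le> 1"
  shows "\<exists>M::nat. 3 ^ m * ternary d = ternary (\<lambda>j. d (j + m)) + 2 * real M"
proof (induction m)
  case 0
  show ?case by (intro exI[of _ 0]) simp
next
  case (Suc m)
  then obtain M where "3 ^ m * ternary d = ternary (\<lambda>j. d (j + m)) + 2 * real M" by blast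
  then have "3 ^ Suc m * ternary d = 3 * ternary (\<lambda>j. d (j + m)) + 6 * real M" by simp
  also have "3 * ternary (\<lambda>j. d (j + m)) = 2 * real (d m) + ternary (\<lambda>j. d (j + Suc m))"
    using ternary_Suc[of "\<lambda>j. d (j + m)"] assms by simp
  finally have "3 ^ Suc m * ternary d = ternary (\<lambda>j. d (j + Suc m)) + 2 * real (d m + 3 * M)" by simp
  then show ?case by blast
qed

lemma plateau_wave_ternary:
  assumes "\<And>j. d j \<le> 1"
  shows "plateau_wave (3 ^ m * ternary d) = real (d m)"
proof -
  obtain M where "3 ^ m * ternary d = ternary (\<lambda>j. d (j + m)) + 2 * real M"
    using ternary_shift[of d m] assms by blast
  then have "plateau_wave (3 ^ m * ternary d) = plateau_wave (ternary (\<lambda>j. d (j + m)))"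
    by (simp only: plateau_wave_period)
  moreover have "3 * ternary (\<lambda>j. d (j + m)) = 2 * real (d m) + ternary (\<lambda>j. d (j + Suc m))"
    using ternary_Suc[of "\<lambda>j. d (j + m)"] assms by simp
  moreover have "0 \<le> ternary (\<lambda>j. d (j + Suc m))" "ternary (\<lambda>j. d (j + Suc m)) \<le> 1"
    by (intro ternary_bounds assms)+
  moreover have "d m = 0 \<or> d m = 1" using assms[of m] by linarith
  ultimately show ?thesis
    using plateau_wave_0[of "ternary (\<lambda>j. d (j + m))"] plateau_wave_1[of "ternary (\<lambda>j. d (j + m))"] by auto
qed

definition binary_digit :: "real \<Rightarrow> nat \<Rightarrow> nat" where
  "binary_digit x j = nat (\<lfloor>2 ^ Suc j * x\<rfloor> mod 2)"

lemma binary_digit_le: "binary_digit x j \<le> 1"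
  unfolding binary_digit_def by (simp add: nat_le_iff)

lemma binary_digit_sums:
  assumes "0 \<le> x" "x < 1"
  shows "(\<lambda>j. real (binary_digit x j) / 2 ^ Suc j) sums x"
proof -
  have part: "(\<Sum>j<n. real (binary_digit x j) / 2 ^ Suc j) = of_int \<lfloor>2 ^ n * x\<rfloor> / 2 ^ n" for n
  proof (induction n)
    case 0
    have "\<lfloor>x\<rfloor> = 0" using assms by (simp add: floor_eq_iff)
    then show ?case by simp
  next
    case (Suc n)
    have "\<lfloor>2 ^ n * x\<rfloor> = \<lfloor>2 ^ Suc n * x / real_of_int 2\<rfloor>" by simp
    also have "\<dots> = \<lfloor>2 ^ Suc n * x\<rfloor> div 2" by (rule floor_divide_real_eq_div) simp
    finally have "\<lfloor>2 ^ Suc n * x\<rfloor> = 2 * \<lfloor>2 ^ n * x\<rfloor> + \<lfloor>2 ^ Suc n * x\<rfloor> mod 2" by simp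
    then have "real_of_int \<lfloor>2 ^ Suc n * x\<rfloor> = 2 * real_of_int \<lfloor>2 ^ n * x\<rfloor> + real (binary_digit x n)"
      unfolding binary_digit_def by (metis of_int_add of_int_mult of_int_numeral of_nat_nat pos_mod_sign zero_less_numeral)
    then show ?case unfolding sum.lessThan_Suc Suc.IH by (simp add: field_simps)
  qed
  have "(\<lambda>n. of_int \<lfloor>2 ^ n * x\<rfloor> / 2 ^ n) \<longlonglongrightarrow> x"
  proof (rule tendsto_sandwich)
    show "\<forall>\<^sub>F n in sequentially. x - (1 / 2) ^ n \<le> of_int \<lfloor>2 ^ n * x\<rfloor> / 2 ^ n"
    proof (intro always_eventually allI)
      fix n
      have "2 ^ n * x - 1 \<le> of_int \<lfloor>2 ^ n * x\<rfloor>" by linarith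
      then have "(2 ^ n * x - 1) / 2 ^ n \<le> of_int \<lfloor>2 ^ n * x\<rfloor> / 2 ^ n" by (rule divide_right_mono) simp
      then show "x - (1 / 2) ^ n \<le> of_int \<lfloor>2 ^ n * x\<rfloor> / 2 ^ n" by (simp add: diff_divide_distrib power_divide)
    qed
    show "\<forall>\<^sub>F n in sequentially. of_int \<lfloor>2 ^ n * x\<rfloor> / 2 ^ n \<le> x"
      by (intro always_eventually allI) (simp add: divide_le_eq mult.commute)
    have "(\<lambda>n. x - (1 / 2) ^ n) \<longlonglongrightarrow> x - 0" by (intro tendsto_intros LIMSEQ_realpow_zero) auto
    then show "(\<lambda>n. x - (1 / 2) ^ n) \<longlonglongrightarrow> x" by simp
  qed simp
  then show ?thesis unfolding sums_def part .
qed

text \<open>Schoenberg's space-filling curve: coordinate \<open>i \<in> {0, 1}\<close> is assembled, as a binary expansion, from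
  the ternary digits at the positions that are congruent to \<open>i\<close> modulo 2.\<close>

definition schoenberg :: "nat \<Rightarrow> real \<Rightarrow> real" where
  "schoenberg i t = (\<Sum>k. plateau_wave (3 ^ (2 * k + i) * t) / 2 ^ Suc k)"

lemma continuous_schoenberg: "continuous_on UNIV (schoenberg i)"
proof (rule uniform_limit_theorem)
  show "uniform_limit UNIV (\<lambda>n t. \<Sum>k<n. plateau_wave (3 ^ (2 * k + i) * t) / 2 ^ Suc k) (schoenberg i) sequentially"
    unfolding schoenberg_def
  proof (rule Weierstrass_m_test)
    show "norm (plateau_wave (3 ^ (2 * n + i) * t) / 2 ^ Suc n) \<le> (1 / 2) ^ n" for n t
      using plateau_wave_01[of "3 ^ (2 * n + i) * t"] by (simp add: power_divide field_simps)
    show "summable (\<lambda>n. (1 / 2) ^ n :: real)" by (intro summable_geometric) simp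
  qed
  show "\<forall>\<^sub>F n in sequentially. continuous_on UNIV (\<lambda>t. \<Sum>k<n. plateau_wave (3 ^ (2 * k + i) * t) / 2 ^ Suc k)"
    unfolding plateau_wave_def by (intro always_eventually allI continuous_intros) auto
qed simp

lemma schoenberg_period: "schoenberg i (t + 2 * real k) = schoenberg i t"
proof -
  have "3 ^ m * (t + 2 * real k) = 3 ^ m * t + 2 * real (3 ^ m * k)" for m by (simp add: algebra_simps)
  then show ?thesis unfolding schoenberg_def by (simp only: plateau_wave_period)
qed

lemma schoenberg_onto_square:
  assumes "0 \<le> x" "x < 1" "0 \<le> y" "y < 1"
  obtains t where "0 \<le> t" "t \<le> 1" "schoenberg 0 t = x" "schoenberg 1 t = y"
proof -
  define d where "d j = (if even j then binary_digit x (j div 2) else binary_digit y (j div 2))" for j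
  have d: "d j \<le> 1" for j using binary_digit_le[of x "j div 2"] binary_digit_le[of y "j div 2"] by (simp add: d_def)
  have "schoenberg 0 (ternary d) = x" "schoenberg 1 (ternary d) = y"
    unfolding schoenberg_def plateau_wave_ternary[OF d]
    using binary_digit_sums[OF assms(1,2)] binary_digit_sums[OF assms(3,4)]
    by (auto simp: d_def sums_iff)
  then show ?thesis using ternary_bounds[OF d] by (intro that[of "ternary d"])
qed

text \<open>Half the difference between the identity and the triangle wave of period 2. It is continuous and
  takes the constant value \<open>k\<close> on the interval from \<open>2 k\<close> to \<open>2 k + 1\<close>.\<close>

definition plateau_scale :: "real \<Rightarrow> real" where
  "plateau_scale t = (t - arccos (cos (pi * t)) / pi) / 2"

lemma plateau_scale_eq:
  assumes "0 \<le> t" "t \<le> 1"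
  shows "plateau_scale (t + 2 * real k) = real k"
proof -
  have "pi * (t + 2 * real k) = pi * t + of_nat k * (2 * pi)" by (simp add: algebra_simps)
  then have "cos (pi * (t + 2 * real k)) = cos (pi * t)" by (simp only: cos_plus_of_nat_mult_two_pi)
  moreover have "arccos (cos (pi * t)) = pi * t" using assms by (intro arccos_cos) auto
  ultimately show ?thesis unfolding plateau_scale_def by simp
qed

text \<open>On the interval from \<open>2 k\<close> to \<open>2 k + 1\<close> this is Schoenberg's curve, stretched to fill the square of
  side \<open>2 k\<close> around the origin.\<close>

definition plane_curve :: "real \<Rightarrow> real \<times> real" where
  "plane_curve t = (plateau_scale t * (2 * schoenberg 0 t - 1), plateau_scale t * (2 * schoenberg 1 t - 1))"

lemma continuous_plane_curve: "continuous_on UNIV plane_curve"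
proof -
  have "continuous_on UNIV plateau_scale"
    unfolding plateau_scale_def by (intro continuous_intros continuous_on_arccos) auto
  then show ?thesis unfolding plane_curve_def by (intro continuous_intros continuous_schoenberg)
qed

text \<open>The bound on \<open>t\<close> says that points of a bounded region have preimages in a bounded interval. It
  lets tightness be lifted from the plane to the line.\<close>

lemma plane_curve_onto:
  fixes p :: "real \<times> real"
  obtains t where "plane_curve t = p" "\<bar>t\<bar> \<le> 2 * max \<bar>fst p\<bar> \<bar>snd p\<bar> + 5"
proof -
  obtain x y where p: "p = (x, y)" by fastforce
  \<comment> \<open>The added 1 puts the point strictly inside the square, as binary expansions are used only for
  numbers strictly below 1.\<close>
  define k where "k = nat \<lceil>max \<bar>x\<bar> \<bar>y\<bar>\<rceil> + 1"
  have k: "max \<bar>x\<bar> \<bar>y\<bar> < real k" "real k \<le> max \<bar>x\<bar> \<bar>y\<bar> + 2"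
    unfolding k_def by linarith+
  then have kp: "real k > 0" by linarith
  have xy: "0 \<le> (x / k + 1) / 2" "(x / k + 1) / 2 < 1" "0 \<le> (y / k + 1) / 2" "(y / k + 1) / 2 < 1"
    using k kp by (auto simp: field_simps abs_less_iff)
  obtain t where t: "0 \<le> t" "t \<le> 1" "schoenberg 0 t = (x / k + 1) / 2" "schoenberg 1 t = (y / k + 1) / 2"
    using schoenberg_onto_square[OF xy] by blast
  have "plane_curve (t + 2 * real k) = p"
    unfolding plane_curve_def plateau_scale_eq[OF t(1,2)] schoenberg_period t(3,4) p
    using kp by (simp add: field_simps)
  moreover have "\<bar>t + 2 * real k\<bar> \<le> 2 * max \<bar>fst p\<bar> \<bar>snd p\<bar> + 5"
    using t k unfolding p fst_conv snd_conv by linarith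
  ultimately show ?thesis by (rule that)
qed

text \<open>Choose a preimage under \<open>plane_curve\<close> for every point. The lifted laws on the line are tight, hence
  have a weakly convergent subsequence, and the image of its limit under the continuous
  curve is the desired limit in the plane. For discrete laws the choice of preimages raises no
  question of measurability.\<close>

theorem tight_pmf_subsequence_plane:
  fixes q :: "nat \<Rightarrow> (real \<times> real) pmf"
  assumes tight: "\<And>e. e > 0 \<Longrightarrow> \<exists>L. \<forall>n. measure (measure_pmf (q n)) (outside_square L) < (e::real)"
  obtains r :: "nat \<Rightarrow> nat" and \<mu> where "strict_mono r" "prob_space \<mu>" "sets \<mu> = sets borel"
    "\<And>f :: real \<times> real \<Rightarrow> complex. continuous_on UNIV f \<Longrightarrow> bounded (range f) \<Longrightarrow>
        (\<lambda>n. measure_pmf.expectation (q (r n)) f) \<longlonglongrightarrow> (\<integral>p. f p \<partial>\<mu>)"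
proof -
  have "\<forall>p. \<exists>t. plane_curve t = p \<and> \<bar>t\<bar> \<le> 2 * max \<bar>fst p\<bar> \<bar>snd p\<bar> + 5"
    using plane_curve_onto by blast
  from choice[OF this] obtain lift where lift: "\<And>p. plane_curve (lift p) = p"
    "\<And>p. \<bar>lift p\<bar> \<le> 2 * max \<bar>fst p\<bar> \<bar>snd p\<bar> + 5"
    by blast
  define \<nu> where "\<nu> n = distr (measure_pmf (q n)) borel lift" for n
  have \<nu>: "real_distribution (\<nu> n)" for n
    unfolding \<nu>_def by (intro prob_space.real_distribution_distr prob_space_measure_pmf) simp
  have "tight \<nu>"
    unfolding tight_def
  proof (intro conjI allI impI \<nu>)
    fix e :: real assume "e > 0"
    then obtain L where L: "\<And>n. measure (measure_pmf (q n)) (outside_square L) < e"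
      using tight by blast
    define R where "R = 2 * \<bar>L\<bar> + 6"
    have "measure (\<nu> n) {- R<..R} > 1 - e" for n
    proof -
      have sub: "- outside_square L \<subseteq> lift -` {- R<..R}"
      proof
        fix p :: "real \<times> real" assume "p \<in> - outside_square L"
        then show "p \<in> lift -` {- R<..R}" using lift(2)[of p] unfolding R_def by auto
      qed
      have "1 - e < 1 - measure (measure_pmf (q n)) (outside_square L)" using L[of n] by simp
      also have "\<dots> = measure (measure_pmf (q n)) (- outside_square L)"
        using measure_pmf.prob_compl[of "outside_square L" "q n"] by (simp add: Compl_eq_Diff_UNIV)
      also have "\<dots> \<le> measure (measure_pmf (q n)) (lift -` {- R<..R})"
        by (intro measure_pmf.finite_measure_mono sub) simp
      also have "\<dots> = measure (\<nu> n) {- R<..R}"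
        unfolding \<nu>_def by (subst measure_distr) auto
      finally show ?thesis .
    qed
    then show "\<exists>a b. a < b \<and> (\<forall>n. 1 - e < measure (\<nu> n) {a<..b})"
      by (intro exI[of _ "- R"] exI[of _ R]) (auto simp: R_def)
  qed
  then obtain r N where r: "strict_mono (r :: nat \<Rightarrow> nat)" and N: "real_distribution N" "weak_conv_m (\<nu> \<circ> id \<circ> r) N"
    using tight_imp_convergent_subsubsequence[of \<nu> id] strict_mono_id by blast
  interpret N: real_distribution N by fact
  have curve[measurable]: "plane_curve \<in> borel_measurable borel"
    by (rule borel_measurable_continuous_onI[OF continuous_plane_curve])
  show ?thesis
  proof (rule that[OF r])
    show "prob_space (distr N borel plane_curve)" by (rule N.prob_space_distr) simp
    show "sets (distr N borel plane_curve) = sets borel" by simp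
    fix f :: "real \<times> real \<Rightarrow> complex" assume f: "continuous_on UNIV f" "bounded (range f)"
    obtain B where B: "\<And>p. norm (f p) \<le> B" using f(2) by (auto simp: bounded_iff)
    have [measurable]: "f \<in> borel_measurable borel" by (rule borel_measurable_continuous_onI[OF f(1)])
    have "continuous_on UNIV (\<lambda>t. f (plane_curve t))"
      by (rule continuous_on_compose2[OF f(1) continuous_plane_curve]) simp
    then have "(\<lambda>n. \<integral>t. f (plane_curve t) \<partial>(\<nu> \<circ> id \<circ> r) n) \<longlonglongrightarrow> (\<integral>t. f (plane_curve t) \<partial>N)"
      using B \<nu> by (intro weak_conv_imp_integral_bdd_continuous_conv[OF _ N, where B=B])
        (auto simp: continuous_on_eq_continuous_at)
    moreover have "(\<integral>t. f (plane_curve t) \<partial>(\<nu> \<circ> id \<circ> r) n) = measure_pmf.expectation (q (r n)) f" for n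
      unfolding \<nu>_def comp_def id_def by (subst integral_distr) (auto simp: lift)
    moreover have "(\<integral>t. f (plane_curve t) \<partial>N) = (\<integral>p. f p \<partial>distr N borel plane_curve)"
      by (subst integral_distr) auto
    ultimately show "(\<lambda>n. measure_pmf.expectation (q (r n)) f) \<longlonglongrightarrow> (\<integral>p. f p \<partial>distr N borel plane_curve)"
      by simp
  qed
qed

section \<open>Limits of the Fourier transforms\<close>

lemma cos_scaling_limit: "(\<lambda>n. real n * (1 - cos (s / sqrt (real n)))) \<longlonglongrightarrow> s\<^sup>2 / 2"
proof -
  have pos: "(\<lambda>n. real n * (1 - cos (s / sqrt (real n)))) \<longlonglongrightarrow> s\<^sup>2 / 2" if "s > 0" for s :: real
    unfolding power2_eq_square using that by real_asymp
  consider "s > 0" | "s = 0" | "- s > 0" by linarith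
  then show ?thesis by cases (use pos[of s] pos[of "- s"] in simp_all)
qed

lemma sin_scaling_limit: "(\<lambda>n. sqrt (real n) * sin (s / sqrt (real n))) \<longlonglongrightarrow> s"
proof -
  have pos: "(\<lambda>n. sqrt (real n) * sin (s / sqrt (real n))) \<longlonglongrightarrow> s" if "s > 0" for s :: real
    using that by real_asymp
  consider "s > 0" | "s = 0" | "- s > 0" by linarith
  then show ?thesis
  proof cases
    case 3
    then show ?thesis using tendsto_minus[OF pos[of "- s"]] by simp
  qed (use pos[of s] in simp_all)
qed

lemma exp_scaling_limit: "(\<lambda>n. real n * (1 - exp (- x / real n))) \<longlonglongrightarrow> x"
proof -
  consider "x > 0" | "x = 0" | "x < 0" by linarith
  then show ?thesis
  proof cases
    case 1 then show ?thesis by real_asymp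
  next
    case 3 then show ?thesis by real_asymp
  qed simp
qed

lemma inverse_sqrt_limit: "(\<lambda>n. 1 / sqrt (real n)) \<longlonglongrightarrow> 0"
  by real_asymp

lemma cos_tendsto_1: "(\<lambda>n. cos (s / sqrt (real n))) \<longlonglongrightarrow> 1"
proof -
  have "(\<lambda>n. cos (s * (1 / sqrt (real n)))) \<longlonglongrightarrow> cos (s * 0)"
    by (intro tendsto_intros inverse_sqrt_limit)
  then show ?thesis by simp
qed

lemma exp_tendsto_1: "(\<lambda>n. exp (- x / real n)) \<longlonglongrightarrow> (1::real)"
proof -
  have "(\<lambda>n. exp (- x * (1 / real n))) \<longlonglongrightarrow> exp (- x * 0)"
    by (intro tendsto_intros lim_1_over_n)
  then show ?thesis by simp
qed

text \<open>The generating function at \<open>z = exp (- p / n)\<close>, with the factor \<open>n\<close> distributed such that each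
  factor in the denominator has a finite or infinite limit.\<close>

lemma diag_char_laplace_eq:
  assumes "\<Delta> \<ge> 0" "p > 0" "n > 0"
  shows "(\<Sum>k. of_real (exp (- p * (real k / real n))) * diag_char \<Delta> w k) / of_nat n =
    of_real (1 / (\<Delta> / (2 + \<Delta>) * (real n * (1 - exp (- p / real n) * cos w)) +
       2 * sqrt (real n) / (2 + \<Delta>) *
         sqrt (real n * ((1 - exp (- p / real n) * cos w / 2)\<^sup>2 - (exp (- p / real n))\<^sup>2 / 4))))"
proof -
  define z where "z = exp (- p / real n)"
  have z: "0 < z" "z < 1" using assms by (simp_all add: z_def)
  have zk: "exp (- p * (real k / real n)) = z ^ k" for k
    by (simp add: z_def exp_of_nat_mult[symmetric] mult_ac)
  define Q where "Q = (1 - z * cos w / 2)\<^sup>2 - z\<^sup>2 / 4"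
  define D where "D = \<Delta> / (2 + \<Delta>) * (1 - z * cos w) + 2 / (2 + \<Delta>) * sqrt Q"
  have "(\<Sum>k. of_real (exp (- p * (real k / real n))) * diag_char \<Delta> w k) = of_real (1 / D)"
    unfolding zk D_def Q_def using diag_char_generating_function[OF \<open>\<Delta> \<ge> 0\<close> z] by (rule sums_unique[symmetric])
  then have "(\<Sum>k. of_real (exp (- p * (real k / real n))) * diag_char \<Delta> w k) / of_nat n = of_real (1 / (real n * D))"
    by (simp add: mult.commute)
  also have "real n * D = \<Delta> / (2 + \<Delta>) * (real n * (1 - z * cos w)) + 2 * sqrt (real n) / (2 + \<Delta>) * sqrt (real n * Q)"
  proof -
    have "sqrt (real n) * sqrt (real n * Q) = real n * sqrt Q"
      by (simp add: real_sqrt_mult)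
    moreover have "2 * sqrt (real n) / (2 + \<Delta>) = 2 / (2 + \<Delta>) * sqrt (real n)" by simp
    ultimately show ?thesis unfolding D_def by (simp only: distrib_left mult.left_commute mult.assoc)
  qed
  finally show ?thesis unfolding z_def Q_def .
qed

lemma diag_char_laplace_parts:
  fixes p w :: real
  assumes "p > 0"
  defines "z n \<equiv> exp (- p / real n)" and "c n \<equiv> cos (w / sqrt (real n))"
  shows "(\<lambda>n. real n * (1 - z n * c n)) \<longlonglongrightarrow> p + w\<^sup>2 / 2"
    and "(\<lambda>n. real n * ((1 - z n * c n / 2)\<^sup>2 - (z n)\<^sup>2 / 4)) \<longlonglongrightarrow> p + w\<^sup>2 / 4"
proof -
  note lims = exp_scaling_limit[of p, folded z_def] cos_scaling_limit[of w, folded c_def]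
    exp_tendsto_1[of p, folded z_def] cos_tendsto_1[of w, folded c_def]
  have "(\<lambda>n. real n * (1 - z n) + z n * (real n * (1 - c n))) \<longlonglongrightarrow> p + 1 * (w\<^sup>2 / 2)"
    by (intro tendsto_intros lims)
  then show 1: "(\<lambda>n. real n * (1 - z n * c n)) \<longlonglongrightarrow> p + w\<^sup>2 / 2" by (simp add: algebra_simps)
  have "(\<lambda>n. (real n * (1 - z n * c n) + real n * (1 - z n)) / 2 * (1 - z n * c n / 2 + z n / 2))
      \<longlonglongrightarrow> (p + w\<^sup>2 / 2 + p) / 2 * (1 - 1 * 1 / 2 + 1 / 2)"
    by (intro tendsto_intros lims 1) auto
  moreover have "(\<lambda>n. (real n * (1 - z n * c n) + real n * (1 - z n)) / 2 * (1 - z n * c n / 2 + z n / 2))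
     = (\<lambda>n. real n * ((1 - z n * c n / 2)\<^sup>2 - (z n)\<^sup>2 / 4))"
    by (rule ext) (simp add: field_simps power2_eq_square)
  moreover have "(p + w\<^sup>2 / 2 + p) / 2 * (1 - 1 * 1 / 2 + 1 / 2) = p + w\<^sup>2 / 4" by simp
  ultimately show "(\<lambda>n. real n * ((1 - z n * c n / 2)\<^sup>2 - (z n)\<^sup>2 / 4)) \<longlonglongrightarrow> p + w\<^sup>2 / 4"
    by (simp only:)
qed

lemma ratio_tendsto_1:
  assumes "filterlim \<Delta> at_top sequentially"
  shows "(\<lambda>n. \<Delta> n / (2 + \<Delta> n)) \<longlonglongrightarrow> (1::real)"
proof -
  have "((\<lambda>x::real. x / (2 + x)) \<longlongrightarrow> 1) at_top" by real_asymp
  then show ?thesis by (rule filterlim_compose) (rule assms)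
qed

lemma diag_char_laplace_limit:
  assumes nonneg: "\<And>n. \<Delta> n \<ge> 0" and div: "filterlim \<Delta> at_top sequentially" and p: "p > 0"
    and \<beta>: "(\<lambda>n. 2 * sqrt (real n) / (2 + \<Delta> n)) \<longlonglongrightarrow> \<beta>" "\<beta> \<ge> 0"
  shows "(\<lambda>n. (\<Sum>k. of_real (exp (- p * (real k / real n))) * diag_char (\<Delta> n) (w / sqrt (real n)) k) / of_nat n)
    \<longlonglongrightarrow> of_real (1 / (p + w\<^sup>2 / 2 + \<beta> * sqrt (p + w\<^sup>2 / 4)))"
proof (rule Lim_transform_eventually)
  have "p + w\<^sup>2 / 2 + \<beta> * sqrt (p + w\<^sup>2 / 4) > 0"
    using p \<beta>(2) by (intro add_pos_nonneg mult_nonneg_nonneg) auto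
  then show "(\<lambda>n. complex_of_real (1 / (\<Delta> n / (2 + \<Delta> n) * (real n * (1 - exp (- p / real n) * cos (w / sqrt (real n)))) +
       2 * sqrt (real n) / (2 + \<Delta> n) *
         sqrt (real n * ((1 - exp (- p / real n) * cos (w / sqrt (real n)) / 2)\<^sup>2 - (exp (- p / real n))\<^sup>2 / 4)))))
    \<longlonglongrightarrow> of_real (1 / (p + w\<^sup>2 / 2 + \<beta> * sqrt (p + w\<^sup>2 / 4)))"
    using diag_char_laplace_parts[OF p, of w]
    by (intro tendsto_of_real tendsto_divide tendsto_const tendsto_add[of _ "p + w\<^sup>2 / 2"]
        tendsto_mult[OF ratio_tendsto_1[OF div], of _ "p + w\<^sup>2 / 2", simplified mult_1]
        tendsto_mult[OF \<beta>(1)] tendsto_real_sqrt) auto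
  show "\<forall>\<^sub>F n in sequentially. complex_of_real (1 / (\<Delta> n / (2 + \<Delta> n) * (real n * (1 - exp (- p / real n) * cos (w / sqrt (real n)))) +
       2 * sqrt (real n) / (2 + \<Delta> n) *
         sqrt (real n * ((1 - exp (- p / real n) * cos (w / sqrt (real n)) / 2)\<^sup>2 - (exp (- p / real n))\<^sup>2 / 4)))) =
     (\<Sum>k. of_real (exp (- p * (real k / real n))) * diag_char (\<Delta> n) (w / sqrt (real n)) k) / of_nat n"
    using eventually_gt_at_top[of 0] by eventually_elim (rule diag_char_laplace_eq[OF nonneg p, symmetric])
qed

lemma diag_char_laplace_vanish:
  assumes nonneg: "\<And>n. \<Delta> n \<ge> 0" and div: "filterlim \<Delta> at_top sequentially" and p: "p > 0"
    and \<beta>: "filterlim (\<lambda>n. 2 * sqrt (real n) / (2 + \<Delta> n)) at_top sequentially"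
  shows "(\<lambda>n. (\<Sum>k. of_real (exp (- p * (real k / real n))) * diag_char (\<Delta> n) (w / sqrt (real n)) k) / of_nat n)
    \<longlonglongrightarrow> 0"
proof (rule Lim_transform_eventually)
  let ?Q = "\<lambda>n. real n * ((1 - exp (- p / real n) * cos (w / sqrt (real n)) / 2)\<^sup>2 - (exp (- p / real n))\<^sup>2 / 4)"
  let ?A = "\<lambda>n. \<Delta> n / (2 + \<Delta> n) * (real n * (1 - exp (- p / real n) * cos (w / sqrt (real n))))"
  have A: "?A \<longlonglongrightarrow> 1 * (p + w\<^sup>2 / 2)"
    by (intro tendsto_mult ratio_tendsto_1[OF div] diag_char_laplace_parts[OF p])
  have Q: "(\<lambda>n. sqrt (?Q n)) \<longlonglongrightarrow> sqrt (p + w\<^sup>2 / 4)"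
    by (intro tendsto_real_sqrt diag_char_laplace_parts[OF p])
  have "sqrt (p + w\<^sup>2 / 4) > 0" using p by (simp add: add_pos_nonneg)
  then have "filterlim (\<lambda>n. 2 * sqrt (real n) / (2 + \<Delta> n) * sqrt (?Q n)) at_top sequentially"
    by (rule filterlim_at_top_mult_tendsto_pos[OF Q _ \<beta>])
  then have "filterlim (\<lambda>n. ?A n + 2 * sqrt (real n) / (2 + \<Delta> n) * sqrt (?Q n)) at_top sequentially"
    by (rule filterlim_tendsto_add_at_top[OF A])
  then have "(\<lambda>n. 1 / (?A n + 2 * sqrt (real n) / (2 + \<Delta> n) * sqrt (?Q n))) \<longlonglongrightarrow> 0"
    by (intro tendsto_divide_0[OF tendsto_const] filterlim_at_top_imp_at_infinity)
  then have "(\<lambda>n. complex_of_real (1 / (?A n + 2 * sqrt (real n) / (2 + \<Delta> n) * sqrt (?Q n)))) \<longlonglongrightarrow> of_real 0"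
    by (rule tendsto_of_real)
  then show "(\<lambda>n. complex_of_real (1 / (?A n + 2 * sqrt (real n) / (2 + \<Delta> n) * sqrt (?Q n)))) \<longlonglongrightarrow> 0" by simp
  show "\<forall>\<^sub>F n in sequentially. complex_of_real (1 / (?A n + 2 * sqrt (real n) / (2 + \<Delta> n) * sqrt (?Q n))) =
     (\<Sum>k. of_real (exp (- p * (real k / real n))) * diag_char (\<Delta> n) (w / sqrt (real n)) k) / of_nat n"
    using eventually_gt_at_top[of 0] by eventually_elim (rule diag_char_laplace_eq[OF nonneg p, symmetric])
qed

text \<open>Divided by \<open>n\<close>, the sum in \<open>walk_char_expand\<close> is an average of \<open>diag_char\<close> with the weights
  \<open>C n ^ (n - 1 - k)\<close>, where \<open>C n\<close> is a product of two cosines. These weights are uniformly close to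
  \<open>exp (- \<theta> * (1 - k / n))\<close>, and for the latter \<open>window_convergence\<close> applies.\<close>

lemma walk_char_limit:
  assumes nonneg: "\<And>n. \<Delta> n \<ge> 0" and div: "filterlim \<Delta> at_top sequentially"
    and lap: "laplace_convergence (\<lambda>n k. diag_char (\<Delta> n) ((s + t) / sqrt (real n)) k) l B s0"
  shows "(\<lambda>n. walk_char (\<Delta> n) (s / sqrt (real n)) (t / sqrt (real n)) n) \<longlonglongrightarrow>
     of_real (exp (- ((s\<^sup>2 + t\<^sup>2) / 2))) *
     (1 - of_real (t * s) * (CLBINT x:{0..1}. of_real (exp ((s\<^sup>2 + t\<^sup>2) / 2 * x)) * l x))"
proof -
  define \<theta> where "\<theta> = (s\<^sup>2 + t\<^sup>2) / 2"
  have \<theta>: "\<theta> \<ge> 0" by (simp add: \<theta>_def)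
  define C where "C n = cos (s / sqrt (real n)) * cos (t / sqrt (real n))" for n
  define q where "q n = exp (- \<theta> / real n)" for n
  define \<psi> where "\<psi> n k = diag_char (\<Delta> n) ((s + t) / sqrt (real n)) k" for n k
  define b where "b n = \<Delta> n / (2 + \<Delta> n) * (sin (s / sqrt (real n)) * sin (t / sqrt (real n)))" for n
  have C1: "\<bar>C n\<bar> \<le> 1" for n unfolding C_def abs_mult by (intro mult_le_one) auto
  have q1: "0 < q n" "q n \<le> 1" for n using \<theta> by (simp_all add: q_def)
  have nC: "(\<lambda>n. real n * (1 - C n)) \<longlonglongrightarrow> \<theta>"
  proof -
    have "(\<lambda>n. real n * (1 - cos (s / sqrt (real n))) + cos (s / sqrt (real n)) * (real n * (1 - cos (t / sqrt (real n)))))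
       \<longlonglongrightarrow> s\<^sup>2 / 2 + 1 * (t\<^sup>2 / 2)"
      by (intro tendsto_intros cos_scaling_limit cos_tendsto_1)
    then show ?thesis by (simp add: C_def \<theta>_def algebra_simps add_divide_distrib)
  qed
  have nq: "(\<lambda>n. real n * (1 - q n)) \<longlonglongrightarrow> \<theta>" unfolding q_def by (rule exp_scaling_limit)
  \<comment> \<open>Both \<open>C n\<close> and \<open>q n\<close> equal \<open>1 - \<theta> / n\<close> up to \<open>o(1 / n)\<close>, so even the \<open>n\<close>-th powers are close.\<close>
  define d where "d n = real n * \<bar>C n - q n\<bar>" for n
  have d0: "d \<longlonglongrightarrow> 0"
  proof -
    have "(\<lambda>n. \<bar>real n * (1 - q n) - real n * (1 - C n)\<bar>) \<longlonglongrightarrow> \<bar>\<theta> - \<theta>\<bar>"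
      by (intro tendsto_intros nq nC)
    moreover have "\<bar>real n * (1 - q n) - real n * (1 - C n)\<bar> = d n" for n
    proof -
      have "real n * (1 - q n) - real n * (1 - C n) = real n * (C n - q n)" by (simp add: algebra_simps)
      then show ?thesis by (simp add: d_def abs_mult)
    qed
    ultimately show ?thesis by simp
  qed
  have pow: "\<bar>C n ^ m - q n ^ m\<bar> \<le> d n" if "m \<le> n" for m n
  proof -
    have "\<bar>C n ^ m - q n ^ m\<bar> \<le> real m * \<bar>C n - q n\<bar>"
      using norm_power_diff[of "C n" "q n" m] C1[of n] q1[of n] by simp
    also have "\<dots> \<le> d n" unfolding d_def using that by (intro mult_right_mono) auto
    finally show ?thesis .
  qed
  have q_0: "(\<lambda>n. 1 - q n) \<longlonglongrightarrow> 1 - 1"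
    unfolding q_def by (intro tendsto_intros exp_tendsto_1)
  have Cn: "(\<lambda>n. C n ^ n) \<longlonglongrightarrow> exp (- \<theta>)"
  proof (rule LIM_zero_cancel, rule Lim_null_comparison[OF _ d0])
    show "\<forall>\<^sub>F n in sequentially. norm (C n ^ n - exp (- \<theta>)) \<le> d n"
      using eventually_gt_at_top[of 0]
    proof eventually_elim
      case (elim n)
      then have "q n ^ n = exp (- \<theta>)" by (simp add: q_def exp_of_nat_mult[symmetric])
      then show ?case using pow[of n n] by simp
    qed
  qed
  have nb: "(\<lambda>n. real n * b n) \<longlonglongrightarrow> t * s"
  proof -
    have "(\<lambda>n. \<Delta> n / (2 + \<Delta> n) * ((sqrt (real n) * sin (s / sqrt (real n))) * (sqrt (real n) * sin (t / sqrt (real n)))))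
       \<longlonglongrightarrow> 1 * (s * t)"
      by (intro tendsto_mult ratio_tendsto_1[OF div] sin_scaling_limit)
    moreover have "\<Delta> n / (2 + \<Delta> n) * ((sqrt (real n) * sin (s / sqrt (real n))) * (sqrt (real n) * sin (t / sqrt (real n))))
       = real n * b n" for n
    proof -
      have "(sqrt (real n) * x) * (sqrt (real n) * y) = real n * (x * y)" for x y
        using real_sqrt_mult_self[of "real n"] by (simp add: mult_ac)
      then show ?thesis unfolding b_def by simp
    qed
    ultimately show ?thesis by (simp add: mult.commute)
  qed
  define h where "h x = exp (- \<theta> * (1 - x))" for x
  have win: "(\<lambda>n. (\<Sum>k<n. of_real (h (real k / real n)) * \<psi> n k) / of_nat n) \<longlonglongrightarrow> (CLBINT x:{0..1}. of_real (h x) * l x)"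
    unfolding \<psi>_def h_def by (rule laplace_convergence.window_convergence[OF lap]) (intro continuous_intros)
  define S where "S n = (\<Sum>k<n. of_real (C n ^ (n - 1 - k)) * \<psi> n k)" for n
  have S_diff: "(\<lambda>n. S n / of_nat n - (\<Sum>k<n. of_real (h (real k / real n)) * \<psi> n k) / of_nat n) \<longlonglongrightarrow> 0"
  proof (rule Lim_null_comparison)
    show "(\<lambda>n. d n + (1 - q n)) \<longlonglongrightarrow> 0" using tendsto_add[OF d0 q_0] by simp
    show "\<forall>\<^sub>F n in sequentially. norm (S n / of_nat n - (\<Sum>k<n. of_real (h (real k / real n)) * \<psi> n k) / of_nat n) \<le> d n + (1 - q n)"
      using eventually_gt_at_top[of 0]
    proof eventually_elim
      case (elim n)
      have "norm (\<Sum>k<n. of_real (C n ^ (n - 1 - k) - h (real k / real n)) * \<psi> n k) \<le> (\<Sum>k<n. d n + (1 - q n))"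
      proof (rule sum_norm_le)
        fix k assume k: "k \<in> {..<n}"
        then have nk: "n - k = Suc (n - 1 - k)" by auto
        have "- \<theta> * (1 - real k / real n) = real (n - k) * (- \<theta> / real n)"
          using k elim by (simp add: field_simps of_nat_diff)
        then have "h (real k / real n) = q n ^ (n - k)"
          unfolding h_def q_def by (simp only: exp_of_nat_mult)
        then have hq: "h (real k / real n) = q n * q n ^ (n - 1 - k)" by (simp only: nk power_Suc)
        have "\<bar>q n ^ (n - 1 - k) - h (real k / real n)\<bar> = (1 - q n) * q n ^ (n - 1 - k)"
          unfolding hq using q1[of n] by (simp add: abs_mult algebra_simps flip: left_diff_distrib)
        also have "\<dots> \<le> (1 - q n) * 1" using q1[of n] by (intro mult_left_mono power_le_one) auto
        finally have "\<bar>C n ^ (n - 1 - k) - h (real k / real n)\<bar> \<le> d n + (1 - q n)"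
          using pow[of "n - 1 - k" n] by simp
        then have "\<bar>C n ^ (n - 1 - k) - h (real k / real n)\<bar> * norm (\<psi> n k) \<le> (d n + (1 - q n)) * 1"
          using norm_diag_char_le[of "\<Delta> n" "(s + t) / sqrt (real n)" k]
          by (intro mult_mono) (auto simp: \<psi>_def)
        then show "norm (of_real (C n ^ (n - 1 - k) - h (real k / real n)) * \<psi> n k) \<le> d n + (1 - q n)"
          by (simp only: norm_mult norm_of_real mult_1_right)
      qed
      then have "norm (S n - (\<Sum>k<n. of_real (h (real k / real n)) * \<psi> n k)) \<le> real n * (d n + (1 - q n))"
        unfolding S_def by (simp add: sum_subtractf[symmetric] left_diff_distrib)
      then have "norm (S n - (\<Sum>k<n. of_real (h (real k / real n)) * \<psi> n k)) / real n \<le> d n + (1 - q n)"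
        using elim by (simp add: divide_le_eq mult.commute)
      then show ?case by (simp add: diff_divide_distrib[symmetric] norm_divide)
    qed
  qed
  have S_lim: "(\<lambda>n. S n / of_nat n) \<longlonglongrightarrow> (CLBINT x:{0..1}. of_real (h x) * l x)"
    using tendsto_add[OF S_diff win] by simp
  have hx: "h x = exp (- \<theta>) * exp (\<theta> * x)" for x
    unfolding h_def by (simp add: exp_add[symmetric] algebra_simps)
  have h_int: "(CLBINT x:{0..1}. of_real (h x) * l x) = of_real (exp (- \<theta>)) * (CLBINT x:{0..1}. of_real (exp (\<theta> * x)) * l x)"
    unfolding hx of_real_mult mult.assoc by (rule set_integral_mult_right)
  have "(\<lambda>n. of_real (C n ^ n) - of_real (real n * b n) * (S n / of_nat n)) \<longlonglongrightarrow>
      of_real (exp (- \<theta>)) - of_real (t * s) * (of_real (exp (- \<theta>)) * (CLBINT x:{0..1}. of_real (exp (\<theta> * x)) * l x))"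
    using S_lim unfolding h_int by (intro tendsto_diff tendsto_mult tendsto_of_real Cn nb)
  moreover have "\<forall>\<^sub>F n in sequentially. of_real (C n ^ n) - of_real (real n * b n) * (S n / of_nat n) =
      walk_char (\<Delta> n) (s / sqrt (real n)) (t / sqrt (real n)) n"
    using eventually_gt_at_top[of 0]
  proof eventually_elim
    case (elim n)
    have "s / sqrt (real n) + t / sqrt (real n) = (s + t) / sqrt (real n)" by (simp add: add_divide_distrib)
    then show ?case
      unfolding walk_char_expand[OF nonneg] C_def[symmetric] b_def[symmetric] S_def \<psi>_def
      using elim by simp
  qed
  ultimately have "(\<lambda>n. walk_char (\<Delta> n) (s / sqrt (real n)) (t / sqrt (real n)) n) \<longlonglongrightarrow>
      of_real (exp (- \<theta>)) - of_real (t * s) * (of_real (exp (- \<theta>)) * (CLBINT x:{0..1}. of_real (exp (\<theta> * x)) * l x))"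
    by (rule Lim_transform_eventually)
  then show ?thesis unfolding \<theta>_def by (simp add: algebra_simps)
qed

section \<open>Weak convergence of the rescaled walk\<close>

definition scaled_walk :: "real \<Rightarrow> nat \<Rightarrow> (real \<times> real) pmf" where
  "scaled_walk \<Delta> n =
     map_pmf (\<lambda>p. (real_of_int (fst p) / sqrt (real n), real_of_int (snd p) / sqrt (real n))) (diag_walk \<Delta> n)"

lemma rescaled_law_chain:
  assumes "\<Delta> \<ge> 0" and chain: "markov_chain M (kernel_K \<Delta>) (0, 0) S"
  shows "rescaled_law M n (S n) = distr (measure_pmf (scaled_walk \<Delta> n)) borel (\<lambda>x. x)"
proof -
  have meas[measurable]: "S n \<in> measurable M (count_space UNIV)"
    using chain by (simp add: markov_chain_def)
  have "kernel_K \<Delta> = (\<lambda>x y. pmf (diag_step \<Delta> x) y)" by (simp add: fun_eq_iff pmf_diag_step[OF assms(1)])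
  then have law: "distr M (count_space UNIV) (S n) = measure_pmf (diag_walk \<Delta> n)"
    using chain by (intro markov_chain_law) simp
  show ?thesis
    unfolding rescaled_law_def scaled_walk_def map_pmf_rep_eq law[symmetric]
    by (simp add: distr_distr comp_def)
qed

lemma prob_space_scaled_walk: "prob_space (distr (measure_pmf (scaled_walk \<Delta> n)) borel (\<lambda>x. x))"
  by (intro prob_space.prob_space_distr prob_space_measure_pmf) simp

lemma integral_distr_pmf:
  fixes f :: "real \<times> real \<Rightarrow> 'c :: {banach, second_countable_topology}"
  assumes "f \<in> borel_measurable borel"
  shows "(\<integral>p. f p \<partial>distr (measure_pmf q) borel (\<lambda>x. x)) = measure_pmf.expectation q f"
  by (subst integral_distr) (use assms in auto)

lemma expectation_wave_scaled_walk:
  "measure_pmf.expectation (scaled_walk \<Delta> n) (\<lambda>p. iexp (s * fst p + t * snd p)) =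
     walk_char \<Delta> (s / sqrt (real n)) (t / sqrt (real n)) n"
  unfolding scaled_walk_def walk_char_def by (simp add: mult.commute)

lemma fourier2_scaled_walk:
  "fourier2 (distr (measure_pmf (scaled_walk \<Delta> n)) borel (\<lambda>x. x)) s t =
     walk_char \<Delta> (s / sqrt (real n)) (t / sqrt (real n)) n"
proof -
  have "continuous_on UNIV (\<lambda>p :: real \<times> real. iexp (s * fst p + t * snd p))"
    by (intro continuous_intros)
  then show ?thesis
    unfolding fourier2_def expectation_wave_scaled_walk[symmetric]
    by (intro integral_distr_pmf borel_measurable_continuous_onI)
qed

text \<open>Chebyshev's inequality in both coordinates. At \<open>n = 0\<close> the quotients are 0, so the second moments
  are at most 1 for every \<open>n\<close>.\<close>

lemma scaled_walk_tight:
  assumes "\<Delta> \<ge> 0" "L > 0"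
  shows "measure (measure_pmf (scaled_walk \<Delta> n)) (outside_square L) \<le> 2 / L\<^sup>2"
proof -
  let ?A = "outside_square L"
  have int: "integrable (measure_pmf (scaled_walk \<Delta> n)) f" for f :: "_ \<Rightarrow> real"
    by (rule integrable_measure_pmf_finite) (simp add: scaled_walk_def finite_set_diag_walk)
  have "indicator ?A p \<le> ((fst p)\<^sup>2 + (snd p)\<^sup>2) / L\<^sup>2" for p
  proof (cases "p \<in> ?A")
    case True
    then have "L\<^sup>2 \<le> (fst p)\<^sup>2 \<or> L\<^sup>2 \<le> (snd p)\<^sup>2"
      using \<open>L > 0\<close> by (auto simp: abs_le_square_iff[symmetric])
    then have "L\<^sup>2 \<le> (fst p)\<^sup>2 + (snd p)\<^sup>2" by (auto intro: add_increasing add_increasing2)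
    then show ?thesis unfolding indicator_simps(1)[OF True] using \<open>L > 0\<close> by (simp add: le_divide_eq)
  qed simp
  then have "measure_pmf.expectation (scaled_walk \<Delta> n) (indicator ?A) \<le>
     measure_pmf.expectation (scaled_walk \<Delta> n) (\<lambda>p. ((fst p)\<^sup>2 + (snd p)\<^sup>2) / L\<^sup>2)"
    by (intro integral_mono int)
  also have "\<dots> = (measure_pmf.expectation (scaled_walk \<Delta> n) (\<lambda>p. (fst p)\<^sup>2) +
      measure_pmf.expectation (scaled_walk \<Delta> n) (\<lambda>p. (snd p)\<^sup>2)) / L\<^sup>2"
    by (simp add: Bochner_Integration.integral_add[OF int int])
  also have "measure_pmf.expectation (scaled_walk \<Delta> n) (\<lambda>p. (fst p)\<^sup>2) = real n / real n"
    unfolding scaled_walk_def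
    by (simp add: power_divide expectation_fst_sq_diag_walk[OF assms(1)])
  also have "measure_pmf.expectation (scaled_walk \<Delta> n) (\<lambda>p. (snd p)\<^sup>2) = real n / real n"
    unfolding scaled_walk_def
    by (simp add: power_divide expectation_fst_sq_diag_walk[OF assms(1)])
  also have "(real n / real n + real n / real n) / L\<^sup>2 \<le> 2 / L\<^sup>2"
    by (intro divide_right_mono) auto
  finally show ?thesis by simp
qed

lemma scaled_walk_tight_ex:
  assumes "\<And>n. \<Delta> n \<ge> 0" "e > 0"
  shows "\<exists>L. \<forall>n. measure (measure_pmf (scaled_walk (\<Delta> n) n)) (outside_square L) < (e::real)"
proof -
  have "measure (measure_pmf (scaled_walk (\<Delta> n) n)) (outside_square (2 / sqrt e)) < e" for n
  proof -
    have "2 / (2 / sqrt e)\<^sup>2 = e / 2" using assms(2) by (simp add: power_divide)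
    then show ?thesis using scaled_walk_tight[OF assms(1), of "2 / sqrt e" n n] assms(2) by simp
  qed
  then show ?thesis by blast
qed

lemma scaled_walk_weakly_converges:
  assumes nonneg: "\<And>n. \<Delta> n \<ge> 0" and \<nu>: "prob_space \<nu>" "sets \<nu> = sets borel"
    and conv: "\<And>s t. (\<lambda>n. walk_char (\<Delta> n) (s / sqrt (real n)) (t / sqrt (real n)) n) \<longlonglongrightarrow> fourier2 \<nu> s t"
  shows "weakly_converges (\<lambda>n. distr (measure_pmf (scaled_walk (\<Delta> n) n)) borel (\<lambda>x. x)) \<nu>"
proof (rule levy_continuity_plane[OF prob_space_scaled_walk _ \<nu>])
  fix e :: real assume "e > 0"
  have "measure (distr (measure_pmf q) borel (\<lambda>x. x)) (outside_square l)
     = measure (measure_pmf q) (outside_square l)" for q l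
    by (subst measure_distr) auto
  then show "\<exists>L. \<forall>n. measure (distr (measure_pmf (scaled_walk (\<Delta> n) n)) borel (\<lambda>x. x)) (outside_square L) < e"
    using scaled_walk_tight_ex[of \<Delta>, OF nonneg \<open>e > 0\<close>] by simp
qed (use conv in \<open>simp_all add: fourier2_scaled_walk\<close>)

text \<open>In the regime \<open>\<beta> = \<infinity>\<close> the walk spends a negligible fraction of its time on the diagonal.\<close>

lemma laplace_convergence_zero:
  assumes nonneg: "\<And>n. \<Delta> n \<ge> 0" and div: "filterlim \<Delta> at_top sequentially"
    and \<beta>: "filterlim (\<lambda>n. 2 * sqrt (real n) / (2 + \<Delta> n)) at_top sequentially"
  shows "laplace_convergence (\<lambda>n k. diag_char (\<Delta> n) (w / sqrt (real n)) k) (\<lambda>x. 0) 0 0"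
proof
  show "(\<lambda>n. (\<Sum>k. of_real (exp (- p * (real k / real n))) * diag_char (\<Delta> n) (w / sqrt (real n)) k) / of_nat n)
     \<longlonglongrightarrow> (CLBINT x:{0..}. of_real (exp (- p * x)) * 0)" if "p > 0" for p
    using diag_char_laplace_vanish[OF nonneg div that \<beta>, of w] by simp
qed (simp_all add: norm_diag_char_le)

text \<open>In the regime \<open>\<beta> = 0\<close> the walk stays on the diagonal up to a negligible fraction of time, and it moves along it
  like a simple random walk.\<close>

lemma laplace_convergence_exp:
  assumes nonneg: "\<And>n. \<Delta> n \<ge> 0" and div: "filterlim \<Delta> at_top sequentially"
    and \<beta>: "(\<lambda>n. 2 * sqrt (real n) / (2 + \<Delta> n)) \<longlonglongrightarrow> 0"
  shows "laplace_convergence (\<lambda>n k. diag_char (\<Delta> n) (w / sqrt (real n)) k)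
     (\<lambda>x. of_real (exp (- (w\<^sup>2 / 2) * x))) 1 0"
proof
  fix p :: real assume p: "p > 0"
  have "(CLBINT x:{0..}. complex_of_real (exp (- p * x)) * of_real (exp (- (w\<^sup>2 / 2) * x))) =
     (CLBINT x:{0..}. complex_of_real (exp (- (p + w\<^sup>2 / 2) * x)))"
    by (simp add: exp_add[symmetric] algebra_simps flip: of_real_mult)
  also have "\<dots> = of_real (LBINT x:{0..}. exp (- (p + w\<^sup>2 / 2) * x))"
    by (rule set_integral_complex_of_real)
  also have "(LBINT x:{0..}. exp (- (p + w\<^sup>2 / 2) * x)) = 1 / (p + w\<^sup>2 / 2)"
    by (rule integrable_exp_decay(2)) (use p in \<open>simp add: add_pos_nonneg\<close>)
  finally show "(\<lambda>n. (\<Sum>k. of_real (exp (- p * (real k / real n))) * diag_char (\<Delta> n) (w / sqrt (real n)) k) / of_nat n)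
     \<longlonglongrightarrow> (CLBINT x:{0..}. of_real (exp (- p * x)) * of_real (exp (- (w\<^sup>2 / 2) * x)))"
    using diag_char_laplace_limit[OF nonneg div p \<beta>, of w] by simp
qed (simp_all add: norm_diag_char_le)

lemma laplace_convergence_ell:
  assumes nonneg: "\<And>n. \<Delta> n \<ge> 0" and div: "filterlim \<Delta> at_top sequentially" and \<alpha>: "\<alpha> > 0"
    and \<beta>: "(\<lambda>n. 2 * sqrt (real n) / (2 + \<Delta> n)) \<longlonglongrightarrow> 2 / \<alpha>"
  obtains B s0 where "laplace_convergence (\<lambda>n k. diag_char (\<Delta> n) (w / sqrt (real n)) k) (ell \<alpha> w) B s0"
proof -
  obtain B s1 where B: "B \<ge> 0" "s1 \<ge> 0" "\<And>x. x \<ge> 0 \<Longrightarrow> norm (ell \<alpha> w x) \<le> B * exp (s1 * x)"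
    using ell_exp_bounded[OF \<alpha>, of w] unfolding exp_bounded_def by blast
  obtain s2 where s2: "\<And>s. s > s2 \<Longrightarrow>
      has_laplace (ell \<alpha> w) s (of_real (1 / (s + w\<^sup>2 / 2 + 2 / \<alpha> * sqrt (s + w\<^sup>2 / 4))))"
    using has_laplace_ell[OF \<alpha>] by blast
  have "laplace_convergence (\<lambda>n k. diag_char (\<Delta> n) (w / sqrt (real n)) k) (ell \<alpha> w) B (max s1 s2)"
  proof
    show "ell \<alpha> w \<in> borel_measurable borel"
      by (rule borel_measurable_continuous_onI[OF continuous_ell[OF \<alpha>]])
    show "norm (ell \<alpha> w x) \<le> B * exp (max s1 s2 * x)" if "x \<ge> 0" for x
    proof -
      have "B * exp (s1 * x) \<le> B * exp (max s1 s2 * x)"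
        using B that by (intro mult_left_mono) (auto intro: mult_right_mono)
      then show ?thesis using B(3)[OF that] by linarith
    qed
    show "(\<lambda>n. (\<Sum>k. of_real (exp (- p * (real k / real n))) * diag_char (\<Delta> n) (w / sqrt (real n)) k) / of_nat n)
     \<longlonglongrightarrow> (CLBINT x:{0..}. of_real (exp (- p * x)) * ell \<alpha> w x)" if "p > max s1 s2" for p
    proof -
      have p: "p > 0" "p > s2" using that B(2) by auto
      show ?thesis
        unfolding has_laplace_integral_eq[OF s2[OF p(2)]]
        by (rule diag_char_laplace_limit[OF nonneg div p(1) \<beta>]) (use \<alpha> in simp)
    qed
  qed (use B in \<open>simp_all add: norm_diag_char_le\<close>)
  then show ?thesis by (rule that)
qed

lemma walk_char_limit_critical:
  assumes "\<And>n. \<Delta> n \<ge> 0" "filterlim \<Delta> at_top sequentially" "\<alpha> > 0"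
    and "(\<lambda>n. 2 * sqrt (real n) / (2 + \<Delta> n)) \<longlonglongrightarrow> 2 / \<alpha>"
  shows "(\<lambda>n. walk_char (\<Delta> n) (s / sqrt (real n)) (t / sqrt (real n)) n) \<longlonglongrightarrow> phi2 \<alpha> s t"
proof -
  obtain B s0 where "laplace_convergence (\<lambda>n k. diag_char (\<Delta> n) ((s + t) / sqrt (real n)) k) (ell \<alpha> (s + t)) B s0"
    using laplace_convergence_ell[OF assms] by blast
  from walk_char_limit[OF assms(1,2) this] show ?thesis unfolding phi2_def .
qed

lemma walk_char_limit_subcritical:
  assumes "\<And>n. \<Delta> n \<ge> 0" "filterlim \<Delta> at_top sequentially"
    and "filterlim (\<lambda>n. 2 * sqrt (real n) / (2 + \<Delta> n)) at_top sequentially"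
  shows "(\<lambda>n. walk_char (\<Delta> n) (s / sqrt (real n)) (t / sqrt (real n)) n) \<longlonglongrightarrow>
     of_real (exp (- ((s\<^sup>2 + t\<^sup>2) / 2)))"
  using walk_char_limit[OF assms(1,2) laplace_convergence_zero[OF assms]] by simp

text \<open>With \<open>l x = exp (- (s + t)\<^sup>2 / 2 * x)\<close> the integrand in \<open>walk_char_limit\<close> is \<open>exp (- t s x)\<close>,
  because \<open>(s\<^sup>2 + t\<^sup>2) / 2 - (s + t)\<^sup>2 / 2 = - t s\<close>.\<close>

lemma walk_char_limit_supercritical:
  assumes "\<And>n. \<Delta> n \<ge> 0" "filterlim \<Delta> at_top sequentially"
    and "(\<lambda>n. 2 * sqrt (real n) / (2 + \<Delta> n)) \<longlonglongrightarrow> 0"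
  shows "(\<lambda>n. walk_char (\<Delta> n) (s / sqrt (real n)) (t / sqrt (real n)) n) \<longlonglongrightarrow>
     of_real (exp (- ((s + t)\<^sup>2 / 2)))"
proof -
  have ftc: "(\<integral>x. indicator {0..1} x *\<^sub>R (t * s * exp (- (t * s) * x)) \<partial>lborel) =
     - exp (- (t * s) * 1) - - exp (- (t * s) * 0)"
  proof (rule integral_FTC_atLeastAtMost)
    fix x :: real
    show "((\<lambda>x. - exp (- (t * s) * x)) has_vector_derivative t * s * exp (- (t * s) * x)) (at x within {0..1})"
      unfolding has_real_derivative_iff_has_vector_derivative[symmetric]
      by (auto intro!: derivative_eq_intros)
  qed (auto intro!: continuous_intros)
  have e: "exp ((s\<^sup>2 + t\<^sup>2) / 2 * x) * exp (- ((s + t)\<^sup>2 / 2) * x) = exp (- (t * s) * x)" for x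
    by (simp add: exp_add[symmetric] power2_eq_square field_simps)
  have "(CLBINT x:{0..1}. complex_of_real (exp ((s\<^sup>2 + t\<^sup>2) / 2 * x)) * of_real (exp (- ((s + t)\<^sup>2 / 2) * x)))
     = of_real (LBINT x:{0..1}. exp (- (t * s) * x))"
    unfolding of_real_mult[symmetric] e by (rule set_integral_complex_of_real)
  then have "of_real (t * s) * (CLBINT x:{0..1}. complex_of_real (exp ((s\<^sup>2 + t\<^sup>2) / 2 * x)) * of_real (exp (- ((s + t)\<^sup>2 / 2) * x)))
     = of_real (t * s * (LBINT x:{0..1}. exp (- (t * s) * x)))"
    by (simp only: of_real_mult)
  also have "t * s * (LBINT x:{0..1}. exp (- (t * s) * x)) = (LBINT x:{0..1}. t * s * exp (- (t * s) * x))"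
    by (rule set_integral_mult_right[symmetric])
  also have "(LBINT x:{0..1}. t * s * exp (- (t * s) * x)) = 1 - exp (- (t * s))"
    using ftc unfolding set_lebesgue_integral_def by simp
  finally have I: "1 - of_real (t * s) * (CLBINT x:{0..1}. complex_of_real (exp ((s\<^sup>2 + t\<^sup>2) / 2 * x)) * of_real (exp (- ((s + t)\<^sup>2 / 2) * x)))
     = of_real (exp (- (t * s)))" by simp
  have "exp (- ((s\<^sup>2 + t\<^sup>2) / 2)) * exp (- (t * s)) = exp (- ((s + t)\<^sup>2 / 2))"
    by (simp add: exp_add[symmetric] power2_eq_square field_simps)
  then have E: "complex_of_real (exp (- ((s\<^sup>2 + t\<^sup>2) / 2))) * of_real (exp (- (t * s))) = of_real (exp (- ((s + t)\<^sup>2 / 2)))"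
    by (simp only: of_real_mult[symmetric])
  have "laplace_convergence (\<lambda>n k. diag_char (\<Delta> n) ((s + t) / sqrt (real n)) k)
     (\<lambda>x. of_real (exp (- ((s + t)\<^sup>2 / 2) * x))) 1 0"
    by (rule laplace_convergence_exp[OF assms])
  from walk_char_limit[OF assms(1,2) this] show ?thesis unfolding I E .
qed

lemma stickiness_ratio:
  assumes "n > 0"
  shows "2 * sqrt (real n) / (2 + \<Delta>) = 2 / (2 / sqrt (real n) + \<Delta> / sqrt (real n))"
proof -
  have "2 / sqrt (real n) + \<Delta> / sqrt (real n) = (2 + \<Delta>) / sqrt (real n)" by (simp add: add_divide_distrib)
  then show ?thesis by simp
qed

lemma two_over_sqrt_limit: "(\<lambda>n. 2 / sqrt (real n)) \<longlonglongrightarrow> 0"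
  by real_asymp

lemma stickiness_ratio_critical:
  assumes "\<Delta> \<sim>[sequentially] (\<lambda>n. \<alpha> * sqrt (real n))" "\<alpha> > 0"
  shows "(\<lambda>n. 2 * sqrt (real n) / (2 + \<Delta> n)) \<longlonglongrightarrow> 2 / \<alpha>"
proof -
  have "(\<lambda>n. if \<Delta> n = 0 \<and> \<alpha> * sqrt (real n) = 0 then 1 else \<Delta> n / (\<alpha> * sqrt (real n))) \<longlonglongrightarrow> 1"
    using assms(1) by (simp add: asymp_equiv_def)
  then have "(\<lambda>n. \<alpha> * (if \<Delta> n = 0 \<and> \<alpha> * sqrt (real n) = 0 then 1 else \<Delta> n / (\<alpha> * sqrt (real n)))) \<longlonglongrightarrow> \<alpha> * 1"
    by (intro tendsto_intros)
  moreover have "\<forall>\<^sub>F n in sequentially. \<alpha> * (if \<Delta> n = 0 \<and> \<alpha> * sqrt (real n) = 0 then 1 else \<Delta> n / (\<alpha> * sqrt (real n))) = \<Delta> n / sqrt (real n)"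
    using eventually_gt_at_top[of 0] by eventually_elim (use assms(2) in simp)
  ultimately have "(\<lambda>n. \<Delta> n / sqrt (real n)) \<longlonglongrightarrow> \<alpha>" by (simp add: tendsto_cong)
  then have "(\<lambda>n. 2 / (2 / sqrt (real n) + \<Delta> n / sqrt (real n))) \<longlonglongrightarrow> 2 / (0 + \<alpha>)"
    using assms(2) by (intro tendsto_intros two_over_sqrt_limit) auto
  moreover have "\<forall>\<^sub>F n in sequentially. 2 / (2 / sqrt (real n) + \<Delta> n / sqrt (real n)) = 2 * sqrt (real n) / (2 + \<Delta> n)"
    using eventually_gt_at_top[of 0] by eventually_elim (simp only: stickiness_ratio)
  ultimately show ?thesis by (simp add: Lim_transform_eventually)
qed

lemma stickiness_ratio_subcritical:
  assumes "\<Delta> \<in> o(\<lambda>n. sqrt (real n))" and nonneg: "\<And>n. \<Delta> n \<ge> 0"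
  shows "filterlim (\<lambda>n. 2 * sqrt (real n) / (2 + \<Delta> n)) at_top sequentially"
proof -
  have "(\<lambda>n. \<Delta> n / sqrt (real n)) \<longlonglongrightarrow> 0" by (rule smalloD_tendsto[OF assms(1)])
  then have z: "(\<lambda>n. 2 / sqrt (real n) + \<Delta> n / sqrt (real n)) \<longlonglongrightarrow> 0"
    using tendsto_add[OF two_over_sqrt_limit] by fastforce
  have pos: "\<forall>\<^sub>F n in sequentially. 0 < 2 / sqrt (real n) + \<Delta> n / sqrt (real n)"
    using eventually_gt_at_top[of 0] by eventually_elim (use nonneg in \<open>simp add: add_pos_nonneg\<close>)
  have "filterlim (\<lambda>n. 2 / (2 / sqrt (real n) + \<Delta> n / sqrt (real n))) at_top sequentially"
    by (rule LIM_at_top_divide[OF tendsto_const _ z pos]) simp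
  moreover have "\<forall>\<^sub>F n in sequentially. 2 / (2 / sqrt (real n) + \<Delta> n / sqrt (real n)) = 2 * sqrt (real n) / (2 + \<Delta> n)"
    using eventually_gt_at_top[of 0] by eventually_elim (simp only: stickiness_ratio)
  ultimately show ?thesis by (simp add: filterlim_cong)
qed

lemma stickiness_ratio_supercritical:
  assumes "filterlim (\<lambda>n. \<Delta> n / sqrt (real n)) at_top sequentially"
  shows "(\<lambda>n. 2 * sqrt (real n) / (2 + \<Delta> n)) \<longlonglongrightarrow> 0"
proof -
  have "filterlim (\<lambda>n. 2 / sqrt (real n) + \<Delta> n / sqrt (real n)) at_top sequentially"
    by (rule filterlim_tendsto_add_at_top[OF two_over_sqrt_limit assms])
  then have "(\<lambda>n. 2 / (2 / sqrt (real n) + \<Delta> n / sqrt (real n))) \<longlonglongrightarrow> 0"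
    by (intro tendsto_divide_0[OF tendsto_const] filterlim_at_top_imp_at_infinity)
  moreover have "\<forall>\<^sub>F n in sequentially. 2 / (2 / sqrt (real n) + \<Delta> n / sqrt (real n)) = 2 * sqrt (real n) / (2 + \<Delta> n)"
    using eventually_gt_at_top[of 0] by eventually_elim (simp only: stickiness_ratio)
  ultimately show ?thesis by (rule Lim_transform_eventually)
qed

text \<open>The walks with \<open>\<Delta> = \<alpha> sqrt n\<close> are tight and their Fourier transforms tend to \<open>phi2 \<alpha>\<close>, so the limit
  along any convergent subsequence has this Fourier transform.\<close>

lemma S2_law_exists:
  assumes "\<alpha> > 0"
  shows "\<exists>\<mu>. is_S2_law \<alpha> \<mu>"
proof -
  define \<Delta> where "\<Delta> n = \<alpha> * sqrt (real n)" for n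
  have nonneg: "\<Delta> n \<ge> 0" for n using assms by (simp add: \<Delta>_def)
  have div: "filterlim \<Delta> at_top sequentially" unfolding \<Delta>_def using assms by real_asymp
  have "\<Delta> \<sim>[sequentially] (\<lambda>n. \<alpha> * sqrt (real n))" unfolding \<Delta>_def by simp
  from walk_char_limit_critical[OF nonneg div assms stickiness_ratio_critical[OF this assms]]
  have lim: "(\<lambda>n. walk_char (\<Delta> n) (s / sqrt (real n)) (t / sqrt (real n)) n) \<longlonglongrightarrow> phi2 \<alpha> s t" for s t .
  obtain r \<mu> where r: "strict_mono (r :: nat \<Rightarrow> nat)" and \<mu>: "prob_space \<mu>" "sets \<mu> = sets borel"
    and conv: "\<And>f :: real \<times> real \<Rightarrow> complex. continuous_on UNIV f \<Longrightarrow> bounded (range f) \<Longrightarrow>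
        (\<lambda>n. measure_pmf.expectation (scaled_walk (\<Delta> (r n)) (r n)) f) \<longlonglongrightarrow> (\<integral>p. f p \<partial>\<mu>)"
    using tight_pmf_subsequence_plane[of "\<lambda>n. scaled_walk (\<Delta> n) n"] scaled_walk_tight_ex[of \<Delta>, OF nonneg] by blast
  have "fourier2 \<mu> s t = phi2 \<alpha> s t" for s t
  proof (rule LIMSEQ_unique)
    have "(\<lambda>n. measure_pmf.expectation (scaled_walk (\<Delta> (r n)) (r n)) (\<lambda>p. iexp (s * fst p + t * snd p))) \<longlonglongrightarrow> fourier2 \<mu> s t"
      unfolding fourier2_def
    proof (rule conv)
      show "continuous_on UNIV (\<lambda>p :: real \<times> real. iexp (s * fst p + t * snd p))" by (intro continuous_intros)
      show "bounded (range (\<lambda>p :: real \<times> real. iexp (s * fst p + t * snd p)))"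
        unfolding bounded_iff by (intro exI[of _ 1]) (auto simp del: of_real_add of_real_mult)
    qed
    then show "(\<lambda>n. walk_char (\<Delta> (r n)) (s / sqrt (real (r n))) (t / sqrt (real (r n))) (r n)) \<longlonglongrightarrow> fourier2 \<mu> s t"
      unfolding expectation_wave_scaled_walk .
    show "(\<lambda>n. walk_char (\<Delta> (r n)) (s / sqrt (real (r n))) (t / sqrt (real (r n))) (r n)) \<longlonglongrightarrow> phi2 \<alpha> s t"
      using LIMSEQ_subseq_LIMSEQ[OF lim r] by (simp add: comp_def)
  qed
  with \<mu> show ?thesis unfolding is_S2_law_def by blast
qed

lemma prob_space_std_normal: "prob_space std_normal_distribution"
  using real_dist_normal_dist by (simp add: real_distribution_def)

lemma sets_pair_std_normal: "sets (std_normal_distribution \<Otimes>\<^sub>M std_normal_distribution) = sets borel"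
proof -
  have "sets (std_normal_distribution \<Otimes>\<^sub>M std_normal_distribution) = sets (borel \<Otimes>\<^sub>M (borel :: real measure))"
    by (rule sets_pair_measure_cong) auto
  then show ?thesis by (simp only: borel_prod)
qed

lemma fourier2_pair_std_normal:
  "fourier2 (std_normal_distribution \<Otimes>\<^sub>M std_normal_distribution) s t = of_real (exp (- ((s\<^sup>2 + t\<^sup>2) / 2)))"
proof -
  interpret N: prob_space std_normal_distribution by (rule prob_space_std_normal)
  interpret P: pair_prob_space std_normal_distribution std_normal_distribution ..
  have wave: "iexp (s * x + t * y) = iexp (s * x) * iexp (t * y)" for x y :: real
    by (simp add: exp_add[symmetric] distrib_left)
  have "continuous_on UNIV (\<lambda>p :: real \<times> real. iexp (s * fst p + t * snd p))"
    by (intro continuous_intros)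
  then have int: "integrable (std_normal_distribution \<Otimes>\<^sub>M std_normal_distribution) (\<lambda>p. iexp (s * fst p + t * snd p))"
    by (rule integrable_bounded_continuous[OF P.prob_space_axioms sets_pair_std_normal, where B=1])
      (simp del: of_real_add of_real_mult)
  have "fourier2 (std_normal_distribution \<Otimes>\<^sub>M std_normal_distribution) s t =
     (\<integral>x. (\<integral>y. iexp (s * x + t * y) \<partial>std_normal_distribution) \<partial>std_normal_distribution)"
    unfolding fourier2_def using P.integral_fst'[OF int] by simp
  also have "\<dots> = char std_normal_distribution s * char std_normal_distribution t"
    unfolding wave char_def by simp
  also have "\<dots> = of_real (exp (- ((s\<^sup>2 + t\<^sup>2) / 2)))"
    unfolding char_std_normal_distribution of_real_mult[symmetric] exp_add[symmetric] by (simp add: field_simps)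
  finally show ?thesis .
qed

lemma measurable_diagonal_std_normal: "(\<lambda>z. (z, z)) \<in> std_normal_distribution \<rightarrow>\<^sub>M (borel :: (real \<times> real) measure)"
proof -
  have "(\<lambda>z::real. (z, z)) \<in> borel \<rightarrow>\<^sub>M borel"
    by (intro borel_measurable_continuous_onI continuous_intros)
  moreover have "measurable std_normal_distribution (borel :: (real \<times> real) measure) = measurable borel borel"
    by (rule measurable_cong_sets) simp_all
  ultimately show ?thesis by blast
qed

lemma fourier2_diagonal_std_normal:
  "fourier2 (distr std_normal_distribution borel (\<lambda>z. (z, z))) s t = of_real (exp (- ((s + t)\<^sup>2 / 2)))"
proof -
  have "continuous_on UNIV (\<lambda>p :: real \<times> real. iexp (s * fst p + t * snd p))"
    by (intro continuous_intros)
  then have wave: "(\<lambda>p :: real \<times> real. iexp (s * fst p + t * snd p)) \<in> borel_measurable borel"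
    by (rule borel_measurable_continuous_onI)
  have "fourier2 (distr std_normal_distribution borel (\<lambda>z. (z, z))) s t =
     (\<integral>z. iexp (s * z + t * z) \<partial>std_normal_distribution)"
    unfolding fourier2_def by (simp only: integral_distr[OF measurable_diagonal_std_normal wave] fst_conv snd_conv)
  also have "\<dots> = char std_normal_distribution (s + t)"
    unfolding char_def by (simp only: distrib_right)
  finally show ?thesis unfolding char_std_normal_distribution by simp
qed

theorem theorem1:
  fixes \<Delta> :: "nat \<Rightarrow> real"
    and M :: "nat \<Rightarrow> 'a measure"
    and S :: "nat \<Rightarrow> nat \<Rightarrow> 'a \<Rightarrow> int \<times> int"
  assumes nonneg: "\<And>n. \<Delta> n \<ge> 0"
    and diverges: "filterlim \<Delta> at_top sequentially"
    and chain: "\<And>n. markov_chain (M n) (kernel_K (\<Delta> n)) (0, 0) (S n)"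
  shows "(\<Delta> \<in> o(\<lambda>n. sqrt (real n)) \<longrightarrow>
            weakly_converges (\<lambda>n. rescaled_law (M n) n (S n n))
              (std_normal_distribution \<Otimes>\<^sub>M std_normal_distribution))
       \<and> (\<forall>\<alpha>>0.
            (\<exists>\<mu>. is_S2_law \<alpha> \<mu>) \<and>
            (\<Delta> \<sim>[sequentially] (\<lambda>n. \<alpha> * sqrt (real n)) \<longrightarrow>
               (\<forall>\<mu>. is_S2_law \<alpha> \<mu> \<longrightarrow>
                  weakly_converges (\<lambda>n. rescaled_law (M n) n (S n n)) \<mu>)))
       \<and> (filterlim (\<lambda>n. \<Delta> n / sqrt (real n)) at_top sequentially \<longrightarrow>
            weakly_converges (\<lambda>n. rescaled_law (M n) n (S n n))
              (distr std_normal_distribution borel (\<lambda>z. (z, z))))"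
proof -
  have law: "(\<lambda>n. rescaled_law (M n) n (S n n)) =
      (\<lambda>n. distr (measure_pmf (scaled_walk (\<Delta> n) n)) borel (\<lambda>x. x))"
    by (rule ext) (rule rescaled_law_chain[OF nonneg chain])
  interpret N: prob_space std_normal_distribution by (rule prob_space_std_normal)
  interpret P: pair_prob_space std_normal_distribution std_normal_distribution ..
  show ?thesis
    unfolding law
  proof (intro conjI impI allI)
    assume "\<Delta> \<in> o(\<lambda>n. sqrt (real n))"
    from walk_char_limit_subcritical[OF nonneg diverges stickiness_ratio_subcritical[OF this nonneg]]
    show "weakly_converges (\<lambda>n. distr (measure_pmf (scaled_walk (\<Delta> n) n)) borel (\<lambda>x. x))
        (std_normal_distribution \<Otimes>\<^sub>M std_normal_distribution)"
      by (intro scaled_walk_weakly_converges[OF nonneg P.prob_space_axioms sets_pair_std_normal])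
        (simp add: fourier2_pair_std_normal)
  next
    fix \<alpha> :: real assume "\<alpha> > 0"
    then show "\<exists>\<mu>. is_S2_law \<alpha> \<mu>" by (rule S2_law_exists)
  next
    fix \<alpha> :: real and \<mu> assume \<alpha>: "\<alpha> > 0" and "\<Delta> \<sim>[sequentially] (\<lambda>n. \<alpha> * sqrt (real n))" and \<mu>: "is_S2_law \<alpha> \<mu>"
    from walk_char_limit_critical[OF nonneg diverges \<alpha> stickiness_ratio_critical[OF this(2) \<alpha>]] \<mu>
    show "weakly_converges (\<lambda>n. distr (measure_pmf (scaled_walk (\<Delta> n) n)) borel (\<lambda>x. x)) \<mu>"
      unfolding is_S2_law_def by (intro scaled_walk_weakly_converges[OF nonneg]) auto
  next
    assume "filterlim (\<lambda>n. \<Delta> n / sqrt (real n)) at_top sequentially"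
    from walk_char_limit_supercritical[OF nonneg diverges stickiness_ratio_supercritical[OF this]]
    show "weakly_converges (\<lambda>n. distr (measure_pmf (scaled_walk (\<Delta> n) n)) borel (\<lambda>x. x))
        (distr std_normal_distribution borel (\<lambda>z. (z, z)))"
      by (intro scaled_walk_weakly_converges[OF nonneg N.prob_space_distr[OF measurable_diagonal_std_normal]])
        (simp_all add: fourier2_diagonal_std_normal)
  qed
qed

end
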